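(* Let $n,m\ge1$ be integers. The set $[\mathscr C_m]$ of isomorphism classes of irreducible finite-dimensional modules over the $n$-colored planar rook algebra $\mathbb CP_m$, together with the maps $(wt,\tilde e_{i,m},\tilde f_{i,m},\varepsilon_{i,m},\varphi_{i,m})_{1\le i\le n}$, is a $gl_{n+1}(\mathbb C)$-crystal.
   Context: Algebra. Fix $n\ge1$. In the ring $\mathbb Z_2^n$ (componentwise operations) let $u_i$ be the element with $i$-th component $1$ and other components $0$. For $m\ge1$, $P_m$ is the set of $m\times m$ matrices over $\mathbb Z_2^n$ with entries in $\{0,u_1,\dots,u_n\}$ such that (a) each row and each column has at most one nonzero entry; (b) for no $1\le i\le n$ is there a $2\times2$ submatrix $\begin{pmatrix}0 & u_i \\ u_i & 0\end{pmatrix}$. $P_m$ is a semigroup under matrix multiplication; $\mathbb CP_m$ is its semigroup algebra over $\mathbb C$. For $d_1\in P_{m_1},d_2\in P_{m_2}$, $d_1\otimes d_2\in P_{m_1+m_2}$ is the block diagonal matrix with blocks $d_1,d_2$; this extends bilinearly to an embedding $\mathbb CP_{m_1}\otimes\mathbb CP_{m_2}\to\mathbb CP_{m_1+m_2}$. Let $I_i=(u_i)$ ($1\le i\le n$) and $I_0=(0)$ in $P_1$, $e_1=\sum_{i=1}^nI_i-(n-1)I_0$; the identity of $\mathbb CP_m$ is $e_m=e_1^{\otimes m}$. For $d\in P_m$, $size(d)$ is the number of nonzero entries; $d'\subseteq d$ means $d'$ is obtained from $d$ by replacing some nonzero entries by $0$; $x_d=\sum_{d'\subseteq d}(-1)^{size(d)-size(d')}d'$.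 The $x_d$ form a basis of $\mathbb CP_m$. For $1\le k\le n$, $\beta_k(d)$ is the set of $j$ such that column $j$ of $d$ contains $u_k$, and $\beta_0(d)$ is the set of indices of zero columns; $\beta(d)=(\beta_0(d),\dots,\beta_n(d))$. Let $X_m$ be the set of $(n+1)$-tuples $T=(T_0,\dots,T_n)$ of pairwise disjoint, possibly empty, sets with union $\{1,\dots,m\}$. For $T\in X_m$, $W^m_T=\mathrm{span}_{\mathbb C}\{x_d: d\in P_m,\ \beta(d)=T\}$, a left $\mathbb CP_m$-module. Modules are left and unital. It is known that $\mathbb CP_m$ is semisimple, the $W^m_T$ are irreducible and exhaust the irreducibles up to isomorphism, and $W^m_T\cong W^m_{T'}$ iff $|T_i|=|T'_i|$ for all $0\le i\le n$. $W^m_{m_0,\dots,m_n}$ denotes $W^m_T$ for the $T$ consisting of consecutive intervals of sizes $m_0,\dots,m_n$ (in this order), where $\sum m_i=m$. Functors. $\mathscr C_m$ is the category of finite-dimensional $\mathbb CP_m$-modules and $[\mathscr C_m]=\{[W^m_{m_0,\dots,m_n}]: m_i\ge0,\ \sum m_i=m\}$. For $m\ge2$ let $\psi_{i,m}:\mathbb CP_{m-1}\to\mathbb CP_m$ be the (non-unital) algebra embedding $x\mapsto x\otimes(I_i-I_0)$ for $1\le i\le n$, and $x\mapsto x\otimes I_0$ for $i=0$. Then $Res_{i,m}:\mathscr C_m\to\mathscr C_{m-1}$ is $Res_{i,m}(M)=\psi_{i,m}(e_{m-1})M$ with $x\in\mathbb CP_{m-1}$ acting as $\psi_{i,m}(x)$,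 and $Ind_{i,m}:\mathscr C_{m-1}\to\mathscr C_m$ is $Ind_{i,m}(M)=\mathbb CP_m\otimes_{\mathbb CP_{m-1}}M$, where $\mathbb CP_{m-1}$ acts on $\mathbb CP_m$ on the right through $\psi_{i,m}$. For $1\le i\le n$, $m\ge1$: $\tilde{\mathscr E}_{i,m}=Res_{i,m+1}\circ Ind_{i-1,m+1}$, $\tilde{\mathscr F}_{i,m}=Res_{i-1,m+1}\circ Ind_{i,m+1}$, and $\tilde e_{i,m},\tilde f_{i,m}:[\mathscr C_m]\to[\mathscr C_m]\cup\{0\}$ are the maps they induce on isomorphism classes ($0$ meaning the zero module). Moreover $wt([W^m_{m_0,\dots,m_n}])=\sum_{j=0}^nm_j\epsilon_{j+1}$, $\varepsilon_{i,m}([W^m_{m_0,\dots,m_n}])=m_i$, $\varphi_{i,m}([W^m_{m_0,\dots,m_n}])=m_{i-1}$. Crystals. $\mathfrak h$ is the diagonal Cartan subalgebra of $gl_{n+1}(\mathbb C)$, $\epsilon_i(E_{jj})=\delta_{ij}$, $P=\bigoplus_{i=1}^{n+1}\mathbb Z\epsilon_i$. A $gl_{n+1}(\mathbb C)$-crystal is a set $B$ with maps $wt:B\to P$, $\varepsilon_i,\varphi_i:B\to\mathbb Z\cup\{-\infty\}$, $\tilde e_i,\tilde f_i:B\to B\cup\{0\}$ ($1\le i\le n$) such that: (a) $\varphi_i(b)=\varepsilon_i(b)+wt(b)(E_{ii}-E_{i+1,i+1})$; (b) $wt(\tilde e_ib)=wt(b)+\epsilon_i-\epsilon_{i+1}$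 if $\tilde e_ib\in B$, and $wt(\tilde f_ib)=wt(b)-\epsilon_i+\epsilon_{i+1}$ if $\tilde f_ib\in B$; (c) for $b_1,b_2\in B$, $\tilde f_ib_2=b_1$ iff $\tilde e_ib_1=b_2$; (d) if $\varepsilon_i(b)=-\infty$ then $\tilde e_ib=\tilde f_ib=0$. *)

theory Defs
  imports
    "HOL-Library.Z2"
    "HOL-Library.Extended"
    "HOL-Library.Function_Algebras"
    "HOL-Algebra.Free_Abelian_Groups"
    "Jordan_Normal_Form.Matrix"
begin

section \<open>Coloured planar rook matrices\<close>

text \<open>An element of the ring \<open>\<int>\<^sub>2\<^sup>n\<close> is a function \<^typ>\<open>nat \<Rightarrow> bit\<close> that vanishes outside \<open>{1..n}\<close>; the
  ring operations are the pointwise ones. Rows and columns of matrices are numbered from 0.\<close>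

type_synonym rook_mat = "(nat \<Rightarrow> bit) mat"

definition u :: "nat \<Rightarrow> nat \<Rightarrow> bit" where
  "u i = (\<lambda>k. if k = i then 1 else 0)"

definition planar_rook :: "nat \<Rightarrow> nat \<Rightarrow> rook_mat set" where
  "planar_rook n m = {d \<in> carrier_mat m m.
     (\<forall>r<m. \<forall>c<m. d $$ (r, c) \<in> insert 0 (u ` {1..n})) \<and>
     (\<forall>r<m. card {c. c < m \<and> d $$ (r, c) \<noteq> 0} \<le> 1) \<and>
     (\<forall>c<m. card {r. r < m \<and> d $$ (r, c) \<noteq> 0} \<le> 1) \<and>
     (\<forall>i\<in>{1..n}. \<not> (\<exists>r1 r2 c1 c2. r1 < r2 \<and> r2 < m \<and> c1 < c2 \<and> c2 < m \<and>
        d $$ (r1, c1) = 0 \<and> d $$ (r1, c2) = u i \<and>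
        d $$ (r2, c1) = u i \<and> d $$ (r2, c2) = 0))}"

definition mat_size :: "rook_mat \<Rightarrow> nat" where
  "mat_size d = card {(r, c). r < dim_row d \<and> c < dim_col d \<and> d $$ (r, c) \<noteq> 0}"

definition submatrices :: "rook_mat \<Rightarrow> rook_mat set" where
  "submatrices d = {d' \<in> carrier_mat (dim_row d) (dim_col d).
     \<forall>r<dim_row d. \<forall>c<dim_col d. d' $$ (r, c) \<in> {0, d $$ (r, c)}}"

definition I_mat :: "nat \<Rightarrow> rook_mat" where
  "I_mat i = mat 1 1 (\<lambda>_. if i = 0 then 0 else u i)"

text \<open>The tuple \<open>(\<beta>\<^sub>0(d), \<dots>, \<beta>\<^sub>n(d))\<close>, as a function on \<open>{0..n}\<close>.\<close>

definition \<beta> :: "rook_mat \<Rightarrow> nat \<Rightarrow> nat set" where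
  "\<beta> d k = (if k = 0
     then {c. c < dim_col d \<and> (\<forall>r<dim_row d. d $$ (r, c) = 0)}
     else {c. c < dim_col d \<and> (\<exists>r<dim_row d. d $$ (r, c) = u k)})"


section \<open>The planar rook algebra\<close>

text \<open>Elements of the semigroup algebra are the complex functions supported on
  \<^term>\<open>planar_rook n m\<close>.\<close>

type_synonym rook_alg = "rook_mat \<Rightarrow> complex"

definition cscale :: "complex \<Rightarrow> rook_alg \<Rightarrow> rook_alg" where
  "cscale c f = (\<lambda>d. c * f d)"

global_interpretation rook: vector_space cscale
  by unfold_locales (auto simp: cscale_def fun_eq_iff algebra_simps)

definition basis :: "rook_mat \<Rightarrow> rook_alg" where
  "basis d = (\<lambda>d'. if d' = d then 1 else 0)"

definition alg_mult :: "nat \<Rightarrow> nat \<Rightarrow> rook_alg \<Rightarrow> rook_alg \<Rightarrow> rook_alg" where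
  "alg_mult n m f g = (\<lambda>d. \<Sum>(a, b)\<in>planar_rook n m \<times> planar_rook n m.
     if a * b = d then f a * g b else 0)"

text \<open>The bilinear extension of \<open>(d\<^sub>1, d\<^sub>2) \<mapsto> d\<^sub>1 \<otimes> d\<^sub>2\<close> to
  \<open>\<complex>P\<^bsub>m\<^sub>1\<^esub> \<times> \<complex>P\<^bsub>m\<^sub>2\<^esub> \<rightarrow> \<complex>P\<^bsub>m\<^sub>1+m\<^sub>2\<^esub>\<close>.\<close>

definition alg_tensor :: "nat \<Rightarrow> nat \<Rightarrow> nat \<Rightarrow> rook_alg \<Rightarrow> rook_alg \<Rightarrow> rook_alg" where
  "alg_tensor n m1 m2 f g = (\<lambda>d. \<Sum>(a, b)\<in>planar_rook n m1 \<times> planar_rook n m2.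
     if diag_block_mat [a, b] = d then f a * g b else 0)"

definition e1 :: "nat \<Rightarrow> rook_alg" where
  "e1 n = (\<Sum>i\<in>{1..n}. basis (I_mat i)) - cscale (of_nat n - 1) (basis (I_mat 0))"

text \<open>The value at 0 is the empty tensor power, given by the \<open>0 \<times> 0\<close> matrix.\<close>

fun alg_one :: "nat \<Rightarrow> nat \<Rightarrow> rook_alg" where
  "alg_one n 0 = basis (mat 0 0 (\<lambda>_. 0))"
| "alg_one n (Suc m) = alg_tensor n m 1 (alg_one n m) (e1 n)"

definition CP :: "nat \<Rightarrow> nat \<Rightarrow> rook_alg ring" where
  "CP n m = \<lparr>carrier = {f. \<forall>d. d \<notin> planar_rook n m \<longrightarrow> f d = 0},
     monoid.mult = alg_mult n m, one = alg_one n m, zero = 0, add = (+)\<rparr>"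

definition x_elt :: "rook_mat \<Rightarrow> rook_alg" where
  "x_elt d = (\<Sum>d'\<in>submatrices d. cscale ((-1) ^ (mat_size d - mat_size d')) (basis d'))"


section \<open>Modules\<close>

text \<open>\<^locale>\<open>module\<close> requires a commutative ring of scalars, so unital left modules over an
  arbitrary ring are introduced here, on the same record type. As usual for this record, the
  fields for multiplication and one on the module are irrelevant.\<close>

locale left_module = R?: ring R + M?: abelian_group M for R (structure) and M (structure) +
  assumes smult_closed: "\<lbrakk>a \<in> carrier R; v \<in> carrier M\<rbrakk> \<Longrightarrow> a \<odot>\<^bsub>M\<^esub> v \<in> carrier M"
    and smult_l_distr: "\<lbrakk>a \<in> carrier R; b \<in> carrier R; v \<in> carrier M\<rbrakk> \<Longrightarrow>
      (a \<oplus> b) \<odot>\<^bsub>M\<^esub> v = a \<odot>\<^bsub>M\<^esub> v \<oplus>\<^bsub>M\<^esub> b \<odot>\<^bsub>M\<^esub> v"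
    and smult_r_distr: "\<lbrakk>a \<in> carrier R; v \<in> carrier M; w \<in> carrier M\<rbrakk> \<Longrightarrow>
      a \<odot>\<^bsub>M\<^esub> (v \<oplus>\<^bsub>M\<^esub> w) = a \<odot>\<^bsub>M\<^esub> v \<oplus>\<^bsub>M\<^esub> a \<odot>\<^bsub>M\<^esub> w"
    and smult_assoc: "\<lbrakk>a \<in> carrier R; b \<in> carrier R; v \<in> carrier M\<rbrakk> \<Longrightarrow>
      (a \<otimes> b) \<odot>\<^bsub>M\<^esub> v = a \<odot>\<^bsub>M\<^esub> (b \<odot>\<^bsub>M\<^esub> v)"
    and smult_one: "v \<in> carrier M \<Longrightarrow> \<one> \<odot>\<^bsub>M\<^esub> v = v"

definition module_iso ::
  "('a, 'b) ring_scheme \<Rightarrow> ('a, 'v) module \<Rightarrow> ('a, 'w) module \<Rightarrow> bool" where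
  "module_iso R M N \<longleftrightarrow> (\<exists>h. bij_betw h (carrier M) (carrier N) \<and>
     (\<forall>v\<in>carrier M. \<forall>w\<in>carrier M. h (v \<oplus>\<^bsub>M\<^esub> w) = h v \<oplus>\<^bsub>N\<^esub> h w) \<and>
     (\<forall>a\<in>carrier R. \<forall>v\<in>carrier M. h (a \<odot>\<^bsub>M\<^esub> v) = a \<odot>\<^bsub>N\<^esub> h v))"

definition irreducible_module :: "('a, 'b) ring_scheme \<Rightarrow> ('a, 'v) module \<Rightarrow> bool" where
  "irreducible_module R M \<longleftrightarrow> left_module R M \<and> carrier M \<noteq> {\<zero>\<^bsub>M\<^esub>} \<and>
     (\<forall>N. submodule N R M \<longrightarrow> N = {\<zero>\<^bsub>M\<^esub>} \<or> N = carrier M)"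

text \<open>The objects of \<open>\<C>\<^sub>m\<close>. The complex scalar \<open>c\<close> acts on a unital \<open>\<complex>P\<^sub>m\<close>-module as
  \<open>c e\<^sub>m\<close>.\<close>

definition fd_module :: "nat \<Rightarrow> nat \<Rightarrow> (rook_alg, 'v) module \<Rightarrow> bool" where
  "fd_module n m M \<longleftrightarrow> left_module (CP n m) M \<and>
     (\<exists>S. finite S \<and> S \<subseteq> carrier M \<and>
       (\<forall>v\<in>carrier M. \<exists>c. v = (\<Oplus>\<^bsub>M\<^esub>s\<in>S. cscale (c s) (alg_one n m) \<odot>\<^bsub>M\<^esub> s)))"

text \<open>Isomorphism classes are formed among the modules whose elements lie in the type
  \<^typ>\<open>rook_alg\<close>. A finite-dimensional module is trivial or has the cardinality of the
  continuum, so every finite-dimensional module, over whatever type \<open>'v\<close>, has an isomorphic copy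
  there, and two of them have the same class iff they are isomorphic.\<close>

type_synonym rook_module = "(rook_alg, rook_alg) module"

definition iso_class :: "nat \<Rightarrow> nat \<Rightarrow> (rook_alg, 'v) module \<Rightarrow> rook_module set" where
  "iso_class n m M = {N. fd_module n m N \<and> module_iso (CP n m) M N}"

text \<open>\<open>W\<^sup>m\<^sub>T\<close>, for a tuple \<open>(T\<^sub>0, \<dots>, T\<^sub>n)\<close> given as a function of which only the values on
  \<open>{0..n}\<close> are used, and \<open>W\<^sup>m\<close> for consecutive intervals of sizes \<open>m\<^sub>0, \<dots>, m\<^sub>n\<close>.\<close>

definition W :: "nat \<Rightarrow> nat \<Rightarrow> (nat \<Rightarrow> nat set) \<Rightarrow> rook_module" where
  "W n m T = \<lparr>carrier = rook.span {x_elt d |d. d \<in> planar_rook n m \<and> (\<forall>k\<le>n. \<beta> d k = T k)},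
     monoid.mult = undefined, one = undefined, zero = 0, add = (+), smult = alg_mult n m\<rparr>"

definition W_int :: "nat \<Rightarrow> nat \<Rightarrow> (nat \<Rightarrow> nat) \<Rightarrow> rook_module" where
  "W_int n m ms = W n m (\<lambda>k. {(\<Sum>j<k. ms j)..<(\<Sum>j\<le>k. ms j)})"

text \<open>The tuples \<open>(m\<^sub>0, \<dots>, m\<^sub>n)\<close> with sum \<open>m\<close>, extended by 0.\<close>

definition tuples :: "nat \<Rightarrow> nat \<Rightarrow> (nat \<Rightarrow> nat) set" where
  "tuples n m = {ms. (\<forall>k>n. ms k = 0) \<and> (\<Sum>k\<le>n. ms k) = m}"

definition irr_classes :: "nat \<Rightarrow> nat \<Rightarrow> rook_module set set" where
  "irr_classes n m = (\<lambda>ms. iso_class n m (W_int n m ms)) ` tuples n m"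


section \<open>Restriction and induction\<close>

definition \<psi> :: "nat \<Rightarrow> nat \<Rightarrow> nat \<Rightarrow> rook_alg \<Rightarrow> rook_alg" where
  "\<psi> n i m x = alg_tensor n (m - 1) 1 x
     (if i = 0 then basis (I_mat 0) else basis (I_mat i) - basis (I_mat 0))"

definition Res :: "nat \<Rightarrow> nat \<Rightarrow> nat \<Rightarrow> (rook_alg, 'v) module \<Rightarrow> (rook_alg, 'v) module" where
  "Res n i m M = M\<lparr>carrier := (\<lambda>v. \<psi> n i m (alg_one n (m - 1)) \<odot>\<^bsub>M\<^esub> v) ` carrier M,
     smult := (\<lambda>x v. \<psi> n i m x \<odot>\<^bsub>M\<^esub> v)\<rparr>"

text \<open>\<open>Ind\<^sub>i\<^sub>,\<^sub>m M = \<complex>P\<^sub>m \<otimes> M\<close>, the tensor product being taken over \<open>\<complex>P\<^bsub>m-1\<^esub>\<close>: the free abelian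
  group on \<open>\<complex>P\<^sub>m \<times> M\<close> modulo the subgroup generated by the biadditivity and balancing relations.\<close>

definition tensor_free ::
  "nat \<Rightarrow> nat \<Rightarrow> (rook_alg, 'v) module \<Rightarrow> ((rook_alg \<times> 'v) \<Rightarrow>\<^sub>0 int) monoid" where
  "tensor_free n m M = free_Abelian_group (carrier (CP n m) \<times> carrier M)"

definition tensor_rels ::
  "nat \<Rightarrow> nat \<Rightarrow> nat \<Rightarrow> (rook_alg, 'v) module \<Rightarrow> ((rook_alg \<times> 'v) \<Rightarrow>\<^sub>0 int) set" where
  "tensor_rels n i m M = generate (tensor_free n m M)
     ({frag_of (a + b, v) - frag_of (a, v) - frag_of (b, v) |a b v.
         a \<in> carrier (CP n m) \<and> b \<in> carrier (CP n m) \<and> v \<in> carrier M} \<union>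
      {frag_of (a, v \<oplus>\<^bsub>M\<^esub> w) - frag_of (a, v) - frag_of (a, w) |a v w.
         a \<in> carrier (CP n m) \<and> v \<in> carrier M \<and> w \<in> carrier M} \<union>
      {frag_of (alg_mult n m a (\<psi> n i m x), v) - frag_of (a, x \<odot>\<^bsub>M\<^esub> v) |a x v.
         a \<in> carrier (CP n m) \<and> x \<in> carrier (CP n (m - 1)) \<and> v \<in> carrier M})"

text \<open>The scalar \<open>a\<close> acts by \<open>a (b \<otimes> v) = a b \<otimes> v\<close>, expressed on cosets through their
  representatives.\<close>

definition Ind ::
  "nat \<Rightarrow> nat \<Rightarrow> nat \<Rightarrow> (rook_alg, 'v) module \<Rightarrow> (rook_alg, ((rook_alg \<times> 'v) \<Rightarrow>\<^sub>0 int) set) module"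
  where
  "Ind n i m M = (let F = tensor_free n m M; K = tensor_rels n i m M in
     \<lparr>carrier = carrier (F Mod K), monoid.mult = undefined, one = undefined,
      zero = one (F Mod K), add = monoid.mult (F Mod K),
      smult = (\<lambda>a X. \<Union>t\<in>X. K #>\<^bsub>F\<^esub> frag_extend (\<lambda>(b, v). frag_of (alg_mult n m a b, v)) t)\<rparr>)"

definition E_functor ::
  "nat \<Rightarrow> nat \<Rightarrow> nat \<Rightarrow> (rook_alg, 'v) module \<Rightarrow> (rook_alg, ((rook_alg \<times> 'v) \<Rightarrow>\<^sub>0 int) set) module"
  where "E_functor n i m M = Res n i (m + 1) (Ind n (i - 1) (m + 1) M)"

definition F_functor ::
  "nat \<Rightarrow> nat \<Rightarrow> nat \<Rightarrow> (rook_alg, 'v) module \<Rightarrow> (rook_alg, ((rook_alg \<times> 'v) \<Rightarrow>\<^sub>0 int) set) module"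
  where "F_functor n i m M = Res n (i - 1) (m + 1) (Ind n i (m + 1) M)"


section \<open>Crystals\<close>

text \<open>A weight \<open>\<Sum> \<lambda>\<^sub>j \<epsilon>\<^sub>j\<close> is given by its coordinates \<open>\<lambda>\<^sub>j\<close>, a function that vanishes outside
  \<open>{1..n+1}\<close>. Likewise the diagonal matrix \<open>\<Sum> h\<^sub>j E\<^sub>j\<^sub>j\<close> with integer entries is given by the function
  \<open>h\<close>. As \<open>\<epsilon>\<^sub>i(E\<^sub>j\<^sub>j) = \<delta>\<^sub>i\<^sub>j\<close>, evaluation is the sum of the products of the coordinates.\<close>

definition coord :: "nat \<Rightarrow> nat \<Rightarrow> int" where
  "coord i = (\<lambda>j. if j = i then 1 else 0)"

abbreviation \<epsilon> :: "nat \<Rightarrow> nat \<Rightarrow> int" where "\<epsilon> \<equiv> coord"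
abbreviation E_diag :: "nat \<Rightarrow> nat \<Rightarrow> int" where "E_diag \<equiv> coord"

definition weight_lattice :: "nat \<Rightarrow> (nat \<Rightarrow> int) set" where
  "weight_lattice n = {l. \<forall>j. j \<notin> {1..n + 1} \<longrightarrow> l j = 0}"

definition weight_eval :: "nat \<Rightarrow> (nat \<Rightarrow> int) \<Rightarrow> (nat \<Rightarrow> int) \<Rightarrow> int" where
  "weight_eval n l h = (\<Sum>j\<in>{1..n + 1}. l j * h j)"

text \<open>\<open>\<int> \<union> {-\<infinity>}\<close> is \<^typ>\<open>int extended\<close> without \<^const>\<open>Pinf\<close>. \<open>B \<union> {0}\<close> is \<open>insert None (Some ` B)\<close>,
  where \<^const>\<open>None\<close> is the extra element 0.\<close>

locale gl_crystal =
  fixes n :: nat and B :: "'b set"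
    and wt :: "'b \<Rightarrow> nat \<Rightarrow> int"
    and e f :: "nat \<Rightarrow> 'b \<Rightarrow> 'b option"
    and eps phi :: "nat \<Rightarrow> 'b \<Rightarrow> int extended"
  assumes wt_in: "b \<in> B \<Longrightarrow> wt b \<in> weight_lattice n"
    and eps_in: "\<lbrakk>i \<in> {1..n}; b \<in> B\<rbrakk> \<Longrightarrow> eps i b \<noteq> Pinf"
    and phi_in: "\<lbrakk>i \<in> {1..n}; b \<in> B\<rbrakk> \<Longrightarrow> phi i b \<noteq> Pinf"
    and e_in: "\<lbrakk>i \<in> {1..n}; b \<in> B\<rbrakk> \<Longrightarrow> e i b \<in> insert None (Some ` B)"
    and f_in: "\<lbrakk>i \<in> {1..n}; b \<in> B\<rbrakk> \<Longrightarrow> f i b \<in> insert None (Some ` B)"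
    and phi_eq: "\<lbrakk>i \<in> {1..n}; b \<in> B\<rbrakk> \<Longrightarrow>
      phi i b = eps i b + Fin (weight_eval n (wt b) (E_diag i - E_diag (i + 1)))"
    and wt_e: "\<lbrakk>i \<in> {1..n}; b \<in> B; e i b = Some b'\<rbrakk> \<Longrightarrow> wt b' = wt b + \<epsilon> i - \<epsilon> (i + 1)"
    and wt_f: "\<lbrakk>i \<in> {1..n}; b \<in> B; f i b = Some b'\<rbrakk> \<Longrightarrow> wt b' = wt b - \<epsilon> i + \<epsilon> (i + 1)"
    and f_iff_e: "\<lbrakk>i \<in> {1..n}; b1 \<in> B; b2 \<in> B\<rbrakk> \<Longrightarrow> f i b2 = Some b1 \<longleftrightarrow> e i b1 = Some b2"
    and Minf_e: "\<lbrakk>i \<in> {1..n}; b \<in> B; eps i b = Minf\<rbrakk> \<Longrightarrow> e i b = None"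
    and Minf_f: "\<lbrakk>i \<in> {1..n}; b \<in> B; eps i b = Minf\<rbrakk> \<Longrightarrow> f i b = None"


section \<open>The structure maps on isomorphism classes\<close>

text \<open>The map on isomorphism classes induced by a functor: all representatives \<open>M\<close> of the class are
  required to give the same \<open>[\<Phi> M]\<close>, and the zero module gives 0.\<close>

definition class_or_zero :: "nat \<Rightarrow> nat \<Rightarrow> (rook_alg, 'v) module \<Rightarrow> rook_module set option" where
  "class_or_zero n m M = (if carrier M = {\<zero>\<^bsub>M\<^esub>} then None else Some (iso_class n m M))"

definition induced_map :: "nat \<Rightarrow> nat \<Rightarrow> (rook_module \<Rightarrow> (rook_alg, 'v) module) \<Rightarrow>
    rook_module set \<Rightarrow> rook_module set option" where
  "induced_map n m \<Phi> b = the_elem ((\<lambda>M. class_or_zero n m (\<Phi> M)) ` b)"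

definition e_op :: "nat \<Rightarrow> nat \<Rightarrow> nat \<Rightarrow> rook_module set \<Rightarrow> rook_module set option" where
  "e_op n m i = induced_map n m (E_functor n i m)"

definition f_op :: "nat \<Rightarrow> nat \<Rightarrow> nat \<Rightarrow> rook_module set \<Rightarrow> rook_module set option" where
  "f_op n m i = induced_map n m (F_functor n i m)"

text \<open>The tuple \<open>(m\<^sub>0, \<dots>, m\<^sub>n)\<close> with \<open>b = [W\<^sup>m]\<close> for the intervals of these sizes.\<close>

definition class_tuple :: "nat \<Rightarrow> nat \<Rightarrow> rook_module set \<Rightarrow> nat \<Rightarrow> nat" where
  "class_tuple n m b = (THE ms. ms \<in> tuples n m \<and> b = iso_class n m (W_int n m ms))"

definition class_wt :: "nat \<Rightarrow> nat \<Rightarrow> rook_module set \<Rightarrow> nat \<Rightarrow> int" where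
  "class_wt n m b = (\<lambda>i. \<Sum>j\<le>n. int (class_tuple n m b j) * \<epsilon> (j + 1) i)"

definition class_eps :: "nat \<Rightarrow> nat \<Rightarrow> nat \<Rightarrow> rook_module set \<Rightarrow> int extended" where
  "class_eps n m i b = Fin (int (class_tuple n m b i))"

definition class_phi :: "nat \<Rightarrow> nat \<Rightarrow> nat \<Rightarrow> rook_module set \<Rightarrow> int extended" where
  "class_phi n m i b = Fin (int (class_tuple n m b (i - 1)))"

end

theory Submission
  imports Defs "HOL-Library.Multiset"
begin

text \<open>A matrix \<open>d\<close> acts as a partial injection on the words of length \<open>m\<close> over the colours \<open>{0..n}\<close>: it moves the
  coloured letters along its nonzero entries. This turns \<open>\<complex>P\<^sub>m\<close> into the algebra of complex matrices
  indexed by pairs of words with the same letter multiplicities, and \<open>x\<^sub>d\<close> into the matrix unit of the row and column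
  words of \<open>d\<close>. Under this isomorphism \<open>\<psi>\<^sub>i\<close> appends the letter \<open>i\<close> to both words, so that
  a cyclic module generated by the image of the diagonal matrix unit of \<open>w\<close> induces along \<open>\<psi>\<^sub>i\<close> to one generated from
  \<open>w i\<close>, and a module generated from \<open>w i\<close> restricts along \<open>\<psi>\<^sub>i\<close> to one generated from \<open>w\<close>. Irreducible modules are exactly
  these cyclic ones and depend only on the letter multiplicities of \<open>w\<close>, whence \<open>Res \<circ> Ind\<close> just moves one unit
  between two multiplicities.\<close>

section \<open>Products of planar rook matrices\<close>

text \<open>The letter 0 is what needs care. It marks an empty row or column, so a matrix says
  nothing about it, and a planar matrix may match two words although it has extra entries where both
  have 0. Hence a single matrix is not a matrix unit but the sum of the matrix units of all its
  submatrices, and the signs in \<open>x_d\<close> invert exactly this. For the same reason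
  \<open>I_i\<close> lets both 0 and \<open>i\<close> pass, and \<open>\<psi>\<close> has to
  subtract \<open>I_0\<close> to isolate \<open>i\<close>. Since the two words have equal length,
  the multiplicity of 0 is preserved with the others, which gives all \<open>n + 1\<close>
  coordinates of a weight.

  The modules live over different types: representatives over \<open>rook_alg\<close>, induced
  modules over cosets in a free abelian group. The predicate \<open>cyclic\<close> compares them
  through a word and a generator alone. The two functors meet in a rearrangement: induction yields a
  generator for \<open>w i\<close>, restriction wants one for a word that ends in \<open>j\<close>.
  For \<open>i \<noteq> j\<close> such a rearrangement of \<open>w i\<close> exists iff
  \<open>j\<close> occurs in \<open>w\<close>; otherwise the restriction is 0.\<close>

lemma u_neq_0 [simp]: "u k \<noteq> 0"
proof
  assume "u k = 0"
  then have "u k k = 0" by (simp add: zero_fun_def)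
  then show False by (simp add: u_def)
qed

lemma u_neq_0_sym [simp]: "0 \<noteq> u k"
  using u_neq_0 by metis

lemma u_eq_iff [simp]: "u k = u l \<longleftrightarrow> k = l"
proof
  assume "u k = u l"
  then have "u k k = u l k" by simp
  then show "k = l" by (simp add: u_def split: if_splits)
qed simp

lemma u_mult: "u k * u l = (if k = l then u k else 0)"
  by (auto simp: u_def fun_eq_iff)

text \<open>Once \<open>u k\<close> stands on the antidiagonal, uniqueness in rows and columns
  forces the two zeros of the forbidden submatrix, whence the last clause. As all entries are 0 or
  one of \<open>u 1\<close>, ..., \<open>u n\<close>, its colour \<open>k\<close> may range over all
  naturals.\<close>

lemma planar_rook_iff:
  "d \<in> planar_rook n m \<longleftrightarrow> d \<in> carrier_mat m m \<and>
     (\<forall>i<m. \<forall>j<m. d $$ (i, j) \<noteq> 0 \<longrightarrow> (\<exists>k\<in>{1..n}. d $$ (i, j) = u k)) \<and>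
     (\<forall>i<m. \<forall>j<m. \<forall>j'<m. d $$ (i, j) \<noteq> 0 \<longrightarrow> d $$ (i, j') \<noteq> 0 \<longrightarrow> j = j') \<and>
     (\<forall>i<m. \<forall>i'<m. \<forall>j<m. d $$ (i, j) \<noteq> 0 \<longrightarrow> d $$ (i', j) \<noteq> 0 \<longrightarrow> i = i') \<and>
     (\<forall>k i i' j j'. i < i' \<longrightarrow> i' < m \<longrightarrow> j < j' \<longrightarrow> j' < m \<longrightarrow> d $$ (i, j') = u k \<longrightarrow> d $$ (i', j) \<noteq> u k)"
  (is "?L \<longleftrightarrow> ?C \<and> ?E \<and> ?R \<and> ?K \<and> ?P")
proof -
  have card1: "card {c. c < m \<and> Q c} \<le> 1 \<longleftrightarrow> (\<forall>a<m. \<forall>b<m. Q a \<longrightarrow> Q b \<longrightarrow> a = b)" for Q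
    by (subst One_nat_def, subst card_le_Suc0_iff_eq) auto
  have 1: "?L \<longleftrightarrow> ?C \<and> ?E \<and> ?R \<and> ?K \<and>
     (\<forall>i\<in>{1..n}. \<not> (\<exists>r1 r2 c1 c2. r1 < r2 \<and> r2 < m \<and> c1 < c2 \<and> c2 < m \<and>
        d $$ (r1, c1) = 0 \<and> d $$ (r1, c2) = u i \<and> d $$ (r2, c1) = u i \<and> d $$ (r2, c2) = 0))"
    unfolding planar_rook_def mem_Collect_eq card1 by (intro conj_cong refl) auto
  show ?thesis
    unfolding 1
  proof (intro conj_cong refl iffI)
    assume E: ?E and R: ?R and K: ?K
      and A: "\<forall>i\<in>{1..n}. \<not> (\<exists>r1 r2 c1 c2. r1 < r2 \<and> r2 < m \<and> c1 < c2 \<and> c2 < m \<and>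
        d $$ (r1, c1) = 0 \<and> d $$ (r1, c2) = u i \<and> d $$ (r2, c1) = u i \<and> d $$ (r2, c2) = 0)"
    show ?P
    proof (intro allI impI notI)
      fix k i i' j j'
      assume h: "i < i'" "i' < m" "j < j'" "j' < m" "d $$ (i, j') = u k" "d $$ (i', j) = u k"
      then have im: "i < m" "j < m" by auto
      from E h im obtain k' where "k' \<in> {1..n}" "d $$ (i, j') = u k'"
        by (metis u_neq_0)
      with h have k: "k \<in> {1..n}" by auto
      have "d $$ (i, j) = 0" using R h im by (metis nat_neq_iff u_neq_0)
      moreover have "d $$ (i', j') = 0" using R h im by (metis nat_neq_iff u_neq_0)
      ultimately show False using A k h by blast
    qed
  next
    assume ?P
    then show "\<forall>i\<in>{1..n}. \<not> (\<exists>r1 r2 c1 c2. r1 < r2 \<and> r2 < m \<and> c1 < c2 \<and> c2 < m \<and>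
        d $$ (r1, c1) = 0 \<and> d $$ (r1, c2) = u i \<and> d $$ (r2, c1) = u i \<and> d $$ (r2, c2) = 0)"
      by blast
  qed
qed

lemma planar_carrier: "d \<in> planar_rook n m \<Longrightarrow> d \<in> carrier_mat m m"
  by (simp add: planar_rook_iff)

lemma planar_dim:
  assumes "d \<in> planar_rook n m" shows "dim_row d = m" "dim_col d = m"
  using planar_carrier[OF assms] by auto

lemma planar_entry:
  assumes "d \<in> planar_rook n m" "i < m" "j < m" "d $$ (i, j) \<noteq> 0"
  obtains k where "1 \<le> k" "k \<le> n" "d $$ (i, j) = u k"
  using assms unfolding planar_rook_iff by (metis atLeastAtMost_iff)

lemma planar_row_unique:
  "\<lbrakk>d \<in> planar_rook n m; i < m; j < m; j' < m; d $$ (i, j) \<noteq> 0; d $$ (i, j') \<noteq> 0\<rbrakk> \<Longrightarrow> j = j'"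
  by (rule planar_rook_iff[THEN iffD1, THEN conjunct2, THEN conjunct2, THEN conjunct1, rule_format])

lemma planar_col_unique:
  "\<lbrakk>d \<in> planar_rook n m; i < m; i' < m; j < m; d $$ (i, j) \<noteq> 0; d $$ (i', j) \<noteq> 0\<rbrakk> \<Longrightarrow> i = i'"
  by (rule planar_rook_iff[THEN iffD1, THEN conjunct2, THEN conjunct2, THEN conjunct2, THEN conjunct1, rule_format])

lemma planar_no_crossing:
  "\<lbrakk>d \<in> planar_rook n m; i < i'; i' < m; j < j'; j' < m; d $$ (i, j') = u k\<rbrakk> \<Longrightarrow> d $$ (i', j) \<noteq> u k"
  by (rule planar_rook_iff[THEN iffD1, THEN conjunct2, THEN conjunct2, THEN conjunct2, THEN conjunct2, rule_format])

lemma finite_planar_rook [simp]: "finite (planar_rook n m)"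
proof -
  let ?S = "insert 0 (u ` {1..n})"
  let ?I = "{..<m} \<times> {..<m}"
  have "planar_rook n m \<subseteq> (\<lambda>g. mat m m g) ` (?I \<rightarrow>\<^sub>E ?S)"
  proof
    fix d assume d: "d \<in> planar_rook n m"
    let ?g = "restrict (\<lambda>p. d $$ p) ?I"
    have "d = mat m m ?g" using planar_dim[OF d] by (intro eq_matI) auto
    moreover have "?g \<in> ?I \<rightarrow>\<^sub>E ?S"
      using d by (auto simp: planar_rook_def)
    ultimately show "d \<in> (\<lambda>g. mat m m g) ` (?I \<rightarrow>\<^sub>E ?S)" by blast
  qed
  then show ?thesis by (rule finite_subset) (intro finite_imageI finite_PiE, auto)
qed

text \<open>Row \<open>i\<close> of \<open>a\<close> has at most one nonzero entry, so at most one
  summand survives. The \<open>u k\<close> are orthogonal idempotents, so it survives iff the two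
  colours agree: products compose entries of equal colour.\<close>

lemma planar_mult_entry:
  assumes a: "a \<in> planar_rook n m" and b: "b \<in> planar_rook n m" and ij: "i < m" "j < m"
  shows "(a * b) $$ (i, j) \<noteq> 0 \<Longrightarrow> \<exists>k\<in>{1..n}. (a * b) $$ (i, j) = u k"
    and "(a * b) $$ (i, j) = u k \<longleftrightarrow> (\<exists>l<m. a $$ (i, l) = u k \<and> b $$ (l, j) = u k)"
proof -
  have sum: "(a * b) $$ (i, j) = (\<Sum>l<m. a $$ (i, l) * b $$ (l, j))"
    using ij planar_dim[OF a] planar_dim[OF b]
    by (auto simp: times_mat_def scalar_prod_def atLeast0LessThan intro!: sum.cong)
  have "((a * b) $$ (i, j) \<noteq> 0 \<longrightarrow> (\<exists>k\<in>{1..n}. (a * b) $$ (i, j) = u k)) \<and>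
    ((a * b) $$ (i, j) = u k \<longleftrightarrow> (\<exists>l<m. a $$ (i, l) = u k \<and> b $$ (l, j) = u k))"
  proof (cases "\<exists>l<m. a $$ (i, l) * b $$ (l, j) \<noteq> 0")
    case False
    then have "(\<Sum>l<m. a $$ (i, l) * b $$ (l, j)) = 0" by (intro sum.neutral) auto
    moreover have "\<not> (\<exists>l<m. a $$ (i, l) = u k \<and> b $$ (l, j) = u k)"
    proof
      assume "\<exists>l<m. a $$ (i, l) = u k \<and> b $$ (l, j) = u k"
      then obtain l where "l < m" "a $$ (i, l) = u k" "b $$ (l, j) = u k" by blast
      then show False using False by (metis u_mult u_neq_0)
    qed
    ultimately show ?thesis by (simp add: sum)
  next
    case True
    then obtain l where l: "l < m" "a $$ (i, l) * b $$ (l, j) \<noteq> 0" by blast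
    then have nz: "a $$ (i, l) \<noteq> 0" "b $$ (l, j) \<noteq> 0" by auto
    obtain k1 where k1: "1 \<le> k1" "k1 \<le> n" "a $$ (i, l) = u k1"
      using planar_entry[OF a ij(1) l(1) nz(1)] by blast
    obtain k2 where k2: "1 \<le> k2" "k2 \<le> n" "b $$ (l, j) = u k2"
      using planar_entry[OF b l(1) ij(2) nz(2)] by blast
    have kk: "k1 = k2" using l k1 k2 by (auto simp: u_mult split: if_splits)
    have others: "l' = l" if "l' < m" "a $$ (i, l') \<noteq> 0" for l'
      using planar_row_unique[OF a ij(1) that(1) l(1) that(2) nz(1)] .
    have "(\<Sum>l<m. a $$ (i, l) * b $$ (l, j)) = (\<Sum>l'<m. if l' = l then u k1 else 0)"
    proof (rule sum.cong[OF refl])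
      fix l' assume "l' \<in> {..<m}"
      then have "a $$ (i, l') = 0" if "l' \<noteq> l" using others that by blast
      then show "a $$ (i, l') * b $$ (l', j) = (if l' = l then u k1 else 0)"
        using k1(3) k2(3) kk by (simp add: u_mult)
    qed
    then have eq: "(a * b) $$ (i, j) = u k1" using l(1) by (simp add: sum)
    show ?thesis
    proof (intro conjI impI)
      show "\<exists>k\<in>{1..n}. (a * b) $$ (i, j) = u k" using eq k1 by auto
      show "((a * b) $$ (i, j) = u k) = (\<exists>l<m. a $$ (i, l) = u k \<and> b $$ (l, j) = u k)"
        unfolding eq using others k1 k2 kk l(1) by (metis u_eq_iff u_neq_0)
    qed
  qed
  then show "(a * b) $$ (i, j) \<noteq> 0 \<Longrightarrow> \<exists>k\<in>{1..n}. (a * b) $$ (i, j) = u k"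
    and "(a * b) $$ (i, j) = u k \<longleftrightarrow> (\<exists>l<m. a $$ (i, l) = u k \<and> b $$ (l, j) = u k)" by blast+
qed

lemma planar_mult:
  assumes a: "a \<in> planar_rook n m" and b: "b \<in> planar_rook n m"
  shows "a * b \<in> planar_rook n m"
  unfolding planar_rook_iff
proof (intro conjI allI impI notI)
  note ent = planar_mult_entry[OF a b]
  show "a * b \<in> carrier_mat m m"
    using planar_carrier[OF a] planar_carrier[OF b] by simp
  show "\<exists>k\<in>{1..n}. (a * b) $$ (i, j) = u k" if "i < m" "j < m" "(a * b) $$ (i, j) \<noteq> 0" for i j
    using ent(1) that by blast
  have fac: "\<exists>l<m. a $$ (i, l) \<noteq> 0 \<and> b $$ (l, j) \<noteq> 0" if "i < m" "j < m" "(a * b) $$ (i, j) \<noteq> 0" for i j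
    using ent(1)[OF that] ent(2)[OF that(1,2)] by (metis u_neq_0)
  show "j = j'" if "i < m" "j < m" "j' < m" "(a * b) $$ (i, j) \<noteq> 0" "(a * b) $$ (i, j') \<noteq> 0" for i j j'
    using fac[of i j] fac[of i j'] that planar_row_unique[OF a] planar_row_unique[OF b] by metis
  show "i = i'" if "i < m" "i' < m" "j < m" "(a * b) $$ (i, j) \<noteq> 0" "(a * b) $$ (i', j) \<noteq> 0" for i i' j
    using fac[of i j] fac[of i' j] that planar_col_unique[OF a] planar_col_unique[OF b] by metis
  fix k i i' j j'
  assume h: "i < i'" "i' < m" "j < j'" "j' < m" "(a * b) $$ (i, j') = u k" "(a * b) $$ (i', j) = u k"
  then have im: "i < m" "j < m" by auto
  from ent(2)[OF im(1) h(4)] h obtain l where l: "l < m" "a $$ (i, l) = u k" "b $$ (l, j') = u k" by blast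
  from ent(2)[OF h(2) im(2)] h obtain l' where l': "l' < m" "a $$ (i', l') = u k" "b $$ (l', j) = u k" by blast
  \<comment> \<open>A crossing in the product runs through the middle indices: it is a crossing of
    \<open>b\<close> if they are in order and of \<open>a\<close> if they are reversed, while equal
    indices would put two entries into one column of \<open>a\<close>.\<close>
  consider "l < l'" | "l = l'" | "l' < l" by linarith
  then show False
  proof cases
    case 1 then show False using planar_no_crossing[OF b 1 l'(1) h(3,4) l(3)] l' by blast
  next
    case 2 then show False using planar_col_unique[OF a im(1) h(2) l(1)] l l' h by auto
  next
    case 3 then show False using planar_no_crossing[OF a h(1,2) 3 l(1,2)] l' by blast
  qed
qed

section \<open>Words\<close>

text \<open>A word encodes a tuple in \<open>X_m\<close>: \<open>T_k\<close> is the set of positions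
  of the letter \<open>k\<close>, and 0 marks the empty rows or columns of a matrix.\<close>

definition words :: "nat \<Rightarrow> nat \<Rightarrow> nat list set" where
  "words n m = {w. set w \<subseteq> {..n} \<and> length w = m}"

lemma finite_words [simp]: "finite (words n m)"
  unfolding words_def by (rule finite_lists_length_eq) simp

lemma words_length: "w \<in> words n m \<Longrightarrow> length w = m"
  by (simp add: words_def)

lemma words_nth: "w \<in> words n m \<Longrightarrow> j < m \<Longrightarrow> w ! j \<le> n"
  unfolding words_def using nth_mem by fastforce

lemma words_snoc [simp]: "w @ [k] \<in> words n (Suc m) \<longleftrightarrow> w \<in> words n m \<and> k \<le> n"
  by (auto simp: words_def)

lemma words_SucE:
  assumes "w \<in> words n (Suc m)"
  obtains w' k where "w = w' @ [k]" "w' \<in> words n m" "k \<le> n"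
proof -
  have "w \<noteq> []" using assms by (auto simp: words_def)
  then have "w = butlast w @ [last w]" by simp
  then show thesis using that assms words_snoc by metis
qed

text \<open>The relation that \<open>d\<close> carries \<open>c\<close> to \<open>r\<close>: every
  nonzero letter has to travel along an entry of its own colour. Letters 0 impose nothing, so a
  planar \<open>d\<close> may have further entries in rows and columns where both words have
  0.\<close>

definition match :: "rook_mat \<Rightarrow> nat list \<Rightarrow> nat list \<Rightarrow> bool" where
  "match d r c \<longleftrightarrow>
     (\<forall>j<length c. c ! j \<noteq> 0 \<longrightarrow> (\<exists>i<length r. d $$ (i, j) = u (c ! j) \<and> r ! i = c ! j)) \<and>
     (\<forall>i<length r. r ! i \<noteq> 0 \<longrightarrow> (\<exists>j<length c. d $$ (i, j) = u (r ! i) \<and> c ! j = r ! i))"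

lemma match_col:
  assumes "match d r c" "c \<in> words n m" "r \<in> words n m" "j < m" "c ! j \<noteq> 0"
  obtains i where "i < m" "d $$ (i, j) = u (c ! j)" "r ! i = c ! j"
  using assms unfolding match_def words_def by auto

lemma match_row:
  assumes "match d r c" "c \<in> words n m" "r \<in> words n m" "i < m" "r ! i \<noteq> 0"
  obtains j where "j < m" "d $$ (i, j) = u (r ! i)" "c ! j = r ! i"
  using assms unfolding match_def words_def by auto

lemma match_iff_words:
  assumes "c \<in> words n m" "r \<in> words n m"
  shows "match d r c \<longleftrightarrow>
     (\<forall>j<m. c ! j \<noteq> 0 \<longrightarrow> (\<exists>i<m. d $$ (i, j) = u (c ! j) \<and> r ! i = c ! j)) \<and>
     (\<forall>i<m. r ! i \<noteq> 0 \<longrightarrow> (\<exists>j<m. d $$ (i, j) = u (r ! i) \<and> c ! j = r ! i))"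
  using assms by (simp add: match_def words_length)

lemma match_col_unique:
  assumes d: "d \<in> planar_rook n m" and w: "r \<in> words n m" "c \<in> words n m" "c' \<in> words n m"
    and mt: "match d r c" "match d r c'"
  shows "c = c'"
proof -
  \<comment> \<open>Only places with a nonzero letter in the first word are covered; exchanging the
    two words settles the others.\<close>
  have *: "c' ! j = c ! j" if H: "match d r c" "match d r c'" "c \<in> words n m" "c' \<in> words n m" "j < m" "c ! j \<noteq> 0" for c c' j
  proof -
    obtain i where i: "i < m" "d $$ (i, j) = u (c ! j)" "r ! i = c ! j"
      using match_col[OF H(1,3) w(1) H(5,6)] .
    then have "r ! i \<noteq> 0" using H by simp
    then obtain j' where j': "j' < m" "d $$ (i, j') = u (r ! i)" "c' ! j' = r ! i"
      using match_row[OF H(2,4) w(1) i(1)] by blast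
    have "j = j'" using planar_row_unique[OF d i(1) H(5) j'(1)] i j' by simp
    then show ?thesis using i j' by simp
  qed
  show ?thesis
  proof (rule nth_equalityI)
    show "length c = length c'" using w by (simp add: words_length)
    fix j assume "j < length c"
    then have "j < m" using w by (simp add: words_length)
    then show "c ! j = c' ! j" using *[OF mt w(2,3)] *[OF mt(2,1) w(3,2)] by metis
  qed
qed

text \<open>Matching composes like partial maps. In the forward direction the middle word is the
  image of \<open>c\<close> under \<open>b\<close>; the entries of the product guarantee that
  \<open>b\<close> loses no nonzero letter of \<open>c\<close>.\<close>

lemma match_mult:
  assumes a: "a \<in> planar_rook n m" and b: "b \<in> planar_rook n m"
    and w: "r \<in> words n m" "c \<in> words n m"
  shows "match (a * b) r c \<longleftrightarrow> (\<exists>s\<in>words n m. match a r s \<and> match b s c)"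
proof
  note ent = planar_mult_entry(2)[OF a b]
  assume mt: "match (a * b) r c"
  \<comment> \<open>\<open>P l k\<close> describes the letter at place \<open>l\<close> of the
    middle word: the letter of \<open>c\<close> that \<open>b\<close> carries there, and 0 if it
    carries none.\<close>
  define P where "P l k \<longleftrightarrow> k \<le> n \<and> (k \<noteq> 0 \<longrightarrow> (\<exists>j<m. c ! j = k \<and> b $$ (l, j) = u k)) \<and>
     (k = 0 \<longrightarrow> (\<forall>j<m. c ! j \<noteq> 0 \<longrightarrow> b $$ (l, j) \<noteq> u (c ! j)))" for l k
  have "\<exists>k. P l k" for l
  proof (cases "\<exists>j<m. c ! j \<noteq> 0 \<and> b $$ (l, j) = u (c ! j)")
    case True
    then obtain j where "j < m" "c ! j \<noteq> 0" "b $$ (l, j) = u (c ! j)" by blast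
    then have "P l (c ! j)" using words_nth[OF w(2)] by (auto simp: P_def)
    then show ?thesis ..
  next
    case False then have "P l 0" by (auto simp: P_def) then show ?thesis ..
  qed
  then obtain f where f: "P l (f l)" for l by metis
  let ?s = "map f [0..<m]"
  have s: "?s \<in> words n m" using f by (auto simp: words_def P_def)
  have sn: "?s ! l = f l" if "l < m" for l using that by simp
  have key: "f l = k" if H: "l < m" "j < m" "c ! j = k" "k \<noteq> 0" "b $$ (l, j) = u k" for l j k
  proof (cases "f l = 0")
    case True then show ?thesis using f[of l] H unfolding P_def by auto
  next
    case False
    then obtain j' where j': "j' < m" "c ! j' = f l" "b $$ (l, j') = u (f l)" using f[of l] unfolding P_def by auto
    have "j = j'" using planar_row_unique[OF b H(1,2) j'(1)] H j' by simp
    then show ?thesis using j' H by simp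
  qed
  have "match b ?s c"
    unfolding match_iff_words[OF w(2) s]
  proof (intro conjI allI impI)
    fix j assume j: "j < m" "c ! j \<noteq> 0"
    obtain i where i: "i < m" "(a * b) $$ (i, j) = u (c ! j)" using match_col[OF mt w(2,1) j] by metis
    then obtain l where l: "l < m" "b $$ (l, j) = u (c ! j)" using ent[OF i(1) j(1)] by blast
    then show "\<exists>i<m. b $$ (i, j) = u (c ! j) \<and> ?s ! i = c ! j" using key[OF l(1) j(1) refl j(2) l(2)] sn by auto
  next
    fix l assume l: "l < m" "?s ! l \<noteq> 0"
    then show "\<exists>j<m. b $$ (l, j) = u (?s ! l) \<and> c ! j = ?s ! l" using f[of l] sn[OF l(1)] by (auto simp: P_def)
  qed
  moreover have "match a r ?s"
    unfolding match_iff_words[OF s w(1)]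
  proof (intro conjI allI impI)
    fix l assume l: "l < m" "?s ! l \<noteq> 0"
    then obtain j where j: "j < m" "c ! j = f l" "b $$ (l, j) = u (f l)" using f[of l] unfolding P_def by auto
    then have nz: "c ! j \<noteq> 0" using l by simp
    obtain i where i: "i < m" "(a * b) $$ (i, j) = u (c ! j)" "r ! i = c ! j" using match_col[OF mt w(2,1) j(1) nz] .
    then obtain l' where l': "l' < m" "a $$ (i, l') = u (c ! j)" "b $$ (l', j) = u (c ! j)" using ent[OF i(1) j(1)] by blast
    \<comment> \<open>Column \<open>j\<close> of \<open>b\<close> has a single nonzero entry, so the
      path of the product through \<open>l'\<close> is the one through \<open>l\<close>.\<close>
    have "l' = l" using planar_col_unique[OF b l'(1) l(1) j(1)] l' j by simp
    then show "\<exists>i<m. a $$ (i, l) = u (?s ! l) \<and> r ! i = ?s ! l" using l' i j sn[OF l(1)] by metis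
  next
    fix i assume i: "i < m" "r ! i \<noteq> 0"
    obtain j where j: "j < m" "(a * b) $$ (i, j) = u (r ! i)" "c ! j = r ! i" using match_row[OF mt w(2,1) i] .
    then obtain l where l: "l < m" "a $$ (i, l) = u (r ! i)" "b $$ (l, j) = u (r ! i)" using ent[OF i(1) j(1)] by blast
    have "f l = r ! i" using key[OF l(1) j(1) j(3) i(2) l(3)] .
    then show "\<exists>j<m. a $$ (i, j) = u (r ! i) \<and> ?s ! j = r ! i" using l sn by auto
  qed
  ultimately show "\<exists>s\<in>words n m. match a r s \<and> match b s c" using s by blast
next
  note ent = planar_mult_entry(2)[OF a b]
  assume "\<exists>s\<in>words n m. match a r s \<and> match b s c"
  then obtain s where s: "s \<in> words n m" and ma: "match a r s" and mb: "match b s c" by blast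
  show "match (a * b) r c"
    unfolding match_iff_words[OF w(2,1)]
  proof (intro conjI allI impI)
    fix j assume j: "j < m" "c ! j \<noteq> 0"
    obtain l where l: "l < m" "b $$ (l, j) = u (c ! j)" "s ! l = c ! j" using match_col[OF mb w(2) s j] .
    then have "s ! l \<noteq> 0" using j by simp
    then obtain i where i: "i < m" "a $$ (i, l) = u (s ! l)" "r ! i = s ! l" using match_col[OF ma s w(1) l(1)] by blast
    have "(a * b) $$ (i, j) = u (c ! j)" unfolding ent[OF i(1) j(1)] using l i by auto
    then show "\<exists>i<m. (a * b) $$ (i, j) = u (c ! j) \<and> r ! i = c ! j" using i l by auto
  next
    fix i assume i: "i < m" "r ! i \<noteq> 0"
    obtain l where l: "l < m" "a $$ (i, l) = u (r ! i)" "s ! l = r ! i" using match_row[OF ma s w(1) i] .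
    then have "s ! l \<noteq> 0" using i by simp
    then obtain j where j: "j < m" "b $$ (l, j) = u (s ! l)" "c ! j = s ! l" using match_row[OF mb w(2) s l(1)] by blast
    have "(a * b) $$ (i, j) = u (r ! i)" unfolding ent[OF i(1) j(1)] using l j by auto
    then show "\<exists>j<m. (a * b) $$ (i, j) = u (r ! i) \<and> c ! j = r ! i" using j l by auto
  qed
qed

section \<open>Ranks of the occurrences of a letter, and the matrix of two words\<close>

definition rank_in :: "nat list \<Rightarrow> nat \<Rightarrow> nat \<Rightarrow> nat" where
  "rank_in w k i = card {l. l < i \<and> w ! l = k}"

lemma rank_in_less: "i < j \<Longrightarrow> w ! i = k \<Longrightarrow> rank_in w k i < rank_in w k j"
  unfolding rank_in_def by (rule psubset_card_mono) auto

lemma rank_in_inj: "w ! i = k \<Longrightarrow> w ! j = k \<Longrightarrow> rank_in w k i = rank_in w k j \<Longrightarrow> i = j"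
  using rank_in_less[of i j w k] rank_in_less[of j i w k] by (metis less_irrefl nat_neq_iff)

lemma rank_in_Suc: "rank_in w k (Suc i) = rank_in w k i + (if w ! i = k then 1 else 0)"
proof -
  have "{l. l < Suc i \<and> w ! l = k} = {l. l < i \<and> w ! l = k} \<union> (if w ! i = k then {i} else {})"
    by (auto simp: less_Suc_eq)
  then show ?thesis unfolding rank_in_def by (simp add: card_insert_if)
qed

lemma rank_in_surj: "p < rank_in w k m \<Longrightarrow> \<exists>i<m. w ! i = k \<and> rank_in w k i = p"
proof (induction m)
  case 0
  then show ?case by (simp add: rank_in_def)
next
  case (Suc m)
  show ?case
  proof (cases "p < rank_in w k m")
    case True
    then show ?thesis using Suc.IH less_SucI by metis
  next
    case False
    with Suc.prems have "w ! m = k" "rank_in w k m = p" by (auto simp: rank_in_Suc split: if_splits)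
    then show ?thesis by blast
  qed
qed

lemma rank_in_length: "rank_in w k (length w) = count (mset w) k"
  unfolding rank_in_def count_mset count_list_eq_length_filter length_filter_conv_card
  by (rule arg_cong[where f = card]) auto

text \<open>Compares cardinalities along a relation that need not be a function; below, the relation
  is the presence of an entry of colour \<open>k\<close>, read in either direction.\<close>

lemma card_le_relation:
  assumes "finite B" and R: "\<And>x. x \<in> A \<Longrightarrow> \<exists>y\<in>B. R x y"
    and inj: "\<And>x x' y. \<lbrakk>x \<in> A; x' \<in> A; y \<in> B; R x y; R x' y\<rbrakk> \<Longrightarrow> x = x'"
  shows "card A \<le> card B"
proof -
  obtain f where f: "\<And>x. x \<in> A \<Longrightarrow> f x \<in> B \<and> R x (f x)" using R by metis
  have "inj_on f A"
  proof (rule inj_onI)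
    fix x y assume "x \<in> A" "y \<in> A" "f x = f y"
    then show "x = y" using f[of x] f[of y] inj[of x y "f x"] by simp
  qed
  then show ?thesis using f assms(1) by (intro card_inj_on_le) auto
qed

text \<open>Planarity makes each colour order-preserving: the occurrences of \<open>k\<close> before
  row \<open>i\<close> are carried injectively to occurrences before column \<open>j\<close>, since
  one landing after \<open>j\<close> would cross the entry at \<open>(i, j)\<close>. The other
  inequality is the transposed argument.\<close>

lemma match_rank_in:
  assumes d: "d \<in> planar_rook n m" and w: "r \<in> words n m" "c \<in> words n m" and mt: "match d r c"
    and ij: "i < m" "j < m" and k: "d $$ (i, j) = u k" "r ! i = k" "k \<noteq> 0"
  shows "rank_in r k i = rank_in c k j"
proof (rule antisym)
  show "rank_in r k i \<le> rank_in c k j"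
    unfolding rank_in_def
  proof (rule card_le_relation[where R = "\<lambda>l l'. d $$ (l, l') = u k"])
    fix l assume "l \<in> {l. l < i \<and> r ! l = k}"
    then have l: "l < i" "l < m" "r ! l = k" using ij by auto
    then obtain l' where l': "l' < m" "d $$ (l, l') = u k" "c ! l' = k"
      using match_row[OF mt w(2,1), of l] k(3) by metis
    have "l' \<noteq> j" using planar_col_unique[OF d l(2) ij(1) l'(1)] l l' k by auto
    moreover have "\<not> j < l'" using planar_no_crossing[OF d l(1) ij(1) _ l'(1,2)] k by blast
    ultimately show "\<exists>l'\<in>{l. l < j \<and> c ! l = k}. d $$ (l, l') = u k" using l' by (intro bexI[of _ l']) auto
  next
    fix x x' y assume "x \<in> {l. l < i \<and> r ! l = k}" "x' \<in> {l. l < i \<and> r ! l = k}"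
      "y \<in> {l. l < j \<and> c ! l = k}" "d $$ (x, y) = u k" "d $$ (x', y) = u k"
    then show "x = x'" using planar_col_unique[OF d, of x x' y] ij by simp
  qed simp
  show "rank_in c k j \<le> rank_in r k i"
    unfolding rank_in_def
  proof (rule card_le_relation[where R = "\<lambda>l' l. d $$ (l, l') = u k"])
    fix l' assume "l' \<in> {l. l < j \<and> c ! l = k}"
    then have l': "l' < j" "l' < m" "c ! l' = k" using ij by auto
    then obtain l where l: "l < m" "d $$ (l, l') = u k" "r ! l = k"
      using match_col[OF mt w(2,1), of l'] k(3) by metis
    have "l \<noteq> i" using planar_row_unique[OF d ij(1) l'(2) ij(2)] l l' k by auto
    moreover have "\<not> i < l" using planar_no_crossing[OF d _ l(1) l'(1) ij(2) k(1)] l by blast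
    ultimately show "\<exists>l\<in>{l. l < i \<and> r ! l = k}. d $$ (l, l') = u k" using l by (intro bexI[of _ l]) auto
  next
    fix x x' y assume "x \<in> {l. l < j \<and> c ! l = k}" "x' \<in> {l. l < j \<and> c ! l = k}"
      "y \<in> {l. l < i \<and> r ! l = k}" "d $$ (y, x) = u k" "d $$ (y, x') = u k"
    then show "x = x'" using planar_row_unique[OF d, of y x x'] ij by simp
  qed simp
qed

text \<open>\<open>match\<close> controls nonzero letters only; the multiplicity of 0 is what the
  common length leaves over.\<close>

lemma mset_eq_if_count_eq:
  fixes r c :: "nat list"
  assumes len: "length r = length c" and cnt: "\<And>k. k \<noteq> 0 \<Longrightarrow> count (mset r) k = count (mset c) k"
  shows "mset r = mset c"
proof -
  have f: "filter_mset (\<lambda>k. k \<noteq> 0) (mset r) = filter_mset (\<lambda>k. k \<noteq> 0) (mset c)"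
    by (rule multiset_eqI) (use cnt in auto)
  have sz: "size M = count M 0 + size (filter_mset (\<lambda>k. k \<noteq> 0) M)" for M :: "nat multiset"
    by (induction M) auto
  have "size (mset r) = size (mset c)" using len by simp
  then have "count (mset r) 0 = count (mset c) 0"
    unfolding sz[of "mset r"] sz[of "mset c"] f by (rule add_right_imp_eq)
  then show ?thesis using cnt by (intro multiset_eqI) metis
qed

text \<open>The reason why the representation is block diagonal: entries of colour \<open>k\<close>
  inject the occurrences of \<open>k\<close> in either word into those in the other.\<close>

lemma match_mset:
  assumes d: "d \<in> planar_rook n m" and w: "r \<in> words n m" "c \<in> words n m" and mt: "match d r c"
  shows "mset r = mset c"
proof (rule mset_eq_if_count_eq)
  show "length r = length c" using w by (simp add: words_length)
  fix k :: nat assume k: "k \<noteq> 0"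
  have "rank_in r k m \<le> rank_in c k m"
    unfolding rank_in_def
  proof (rule card_le_relation[where R = "\<lambda>l l'. d $$ (l, l') = u k"])
    fix l assume "l \<in> {l. l < m \<and> r ! l = k}"
    then show "\<exists>l'\<in>{l. l < m \<and> c ! l = k}. d $$ (l, l') = u k"
      using match_row[OF mt w(2,1), of l] k by fastforce
  next
    fix x x' y assume "x \<in> {l. l < m \<and> r ! l = k}" "x' \<in> {l. l < m \<and> r ! l = k}"
      "y \<in> {l. l < m \<and> c ! l = k}" "d $$ (x, y) = u k" "d $$ (x', y) = u k"
    then show "x = x'" using planar_col_unique[OF d, of x x' y] by simp
  qed simp
  moreover have "rank_in c k m \<le> rank_in r k m"
    unfolding rank_in_def
  proof (rule card_le_relation[where R = "\<lambda>l' l. d $$ (l, l') = u k"])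
    fix l assume "l \<in> {l. l < m \<and> c ! l = k}"
    then show "\<exists>l'\<in>{l. l < m \<and> r ! l = k}. d $$ (l', l) = u k"
      using match_col[OF mt w(2,1), of l] k by fastforce
  next
    fix x x' y assume "x \<in> {l. l < m \<and> c ! l = k}" "x' \<in> {l. l < m \<and> c ! l = k}"
      "y \<in> {l. l < m \<and> r ! l = k}" "d $$ (y, x) = u k" "d $$ (y, x') = u k"
    then show "x = x'" using planar_row_unique[OF d, of y x x'] by simp
  qed simp
  ultimately show "count (mset r) k = count (mset c) k"
    using w by (metis antisym rank_in_length words_length)
qed

text \<open>Planarity forces the occurrences of each nonzero colour in the two words to be matched in order
  (lemma \<open>match_rank_in\<close>), which dictates the entries of the matrix.\<close>

definition word_mat :: "nat list \<Rightarrow> nat list \<Rightarrow> rook_mat" where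
  "word_mat r c = mat (length r) (length c) (\<lambda>(i, j).
     if r ! i \<noteq> 0 \<and> c ! j = r ! i \<and> rank_in r (r ! i) i = rank_in c (r ! i) j then u (r ! i) else 0)"

lemma word_mat_entry:
  assumes "r \<in> words n m" "c \<in> words n m" "i < m" "j < m"
  shows "word_mat r c $$ (i, j) = (if r ! i \<noteq> 0 \<and> c ! j = r ! i \<and> rank_in r (r ! i) i = rank_in c (r ! i) j then u (r ! i) else 0)"
  using assms by (simp add: word_mat_def words_length)

lemma word_mat_entryD:
  assumes "r \<in> words n m" "c \<in> words n m" "i < m" "j < m" "word_mat r c $$ (i, j) \<noteq> 0"
  shows "r ! i \<noteq> 0 \<and> c ! j = r ! i \<and> rank_in r (r ! i) i = rank_in c (r ! i) j \<and> word_mat r c $$ (i, j) = u (r ! i)"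
  using assms(5) unfolding word_mat_entry[OF assms(1-4)] by (simp split: if_splits)

text \<open>A crossing of colour \<open>k\<close> would reverse the order of two ranks, but ranks
  increase strictly along both words.\<close>

lemma word_mat_planar:
  assumes w: "r \<in> words n m" "c \<in> words n m"
  shows "word_mat r c \<in> planar_rook n m"
  unfolding planar_rook_iff
proof (intro conjI allI impI notI)
  note D = word_mat_entryD[OF w]
  show "word_mat r c \<in> carrier_mat m m" using w by (simp add: word_mat_def words_length)
  show "\<exists>k\<in>{1..n}. word_mat r c $$ (i, j) = u k" if "i < m" "j < m" "word_mat r c $$ (i, j) \<noteq> 0" for i j
    using D[OF that] words_nth[OF w(1) that(1)] by (intro bexI[of _ "r ! i"]) auto
  show "j = j'" if "i < m" "j < m" "j' < m" "word_mat r c $$ (i, j) \<noteq> 0" "word_mat r c $$ (i, j') \<noteq> 0" for i j j'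
    using D[OF that(1,2,4)] D[OF that(1,3,5)] by (intro rank_in_inj[of c j "r ! i"]) auto
  show "i = i'" if "i < m" "i' < m" "j < m" "word_mat r c $$ (i, j) \<noteq> 0" "word_mat r c $$ (i', j) \<noteq> 0" for i i' j
    using D[OF that(1,3,4)] D[OF that(2,3,5)] by (intro rank_in_inj[of r i "c ! j"]) auto
  fix k i i' j j'
  assume h: "i < i'" "i' < m" "j < j'" "j' < m" "word_mat r c $$ (i, j') = u k" "word_mat r c $$ (i', j) = u k"
  then have im: "i < m" "j < m" by auto
  have 1: "r ! i = k" "c ! j' = k" "rank_in r k i = rank_in c k j'" using D[OF im(1) h(4)] h by auto
  have 2: "r ! i' = k" "c ! j = k" "rank_in r k i' = rank_in c k j" using D[OF h(2) im(2)] h by auto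
  have "rank_in r k i < rank_in r k i'" using rank_in_less[OF h(1) 1(1)] .
  moreover have "rank_in c k j < rank_in c k j'" using rank_in_less[OF h(3) 2(2)] .
  ultimately show False using 1 2 by simp
qed

text \<open>Equal multiplicities enter here: every rank attained by a letter in one word is then
  attained in the other.\<close>

lemma match_word_mat:
  assumes w: "r \<in> words n m" "c \<in> words n m" and eq: "mset r = mset c"
  shows "match (word_mat r c) r c"
  unfolding match_iff_words[OF w(2,1)]
proof (intro conjI allI impI)
  have cnt: "rank_in r k m = rank_in c k m" for k using w eq rank_in_length words_length by metis
  fix j assume j: "j < m" "c ! j \<noteq> 0"
  have "rank_in c (c ! j) j < rank_in r (c ! j) m" using rank_in_less[OF j(1) refl] cnt by simp
  then obtain i where "i < m" "r ! i = c ! j" "rank_in r (c ! j) i = rank_in c (c ! j) j" using rank_in_surj by metis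
  then show "\<exists>i<m. word_mat r c $$ (i, j) = u (c ! j) \<and> r ! i = c ! j"
    using j word_mat_entry[OF w _ j(1), of i] by auto
next
  have cnt: "rank_in r k m = rank_in c k m" for k using w eq rank_in_length words_length by metis
  fix i assume i: "i < m" "r ! i \<noteq> 0"
  have "rank_in r (r ! i) i < rank_in c (r ! i) m" using rank_in_less[OF i(1) refl] cnt by metis
  then obtain j where "j < m" "c ! j = r ! i" "rank_in c (r ! i) j = rank_in r (r ! i) i" using rank_in_surj by metis
  then show "\<exists>j<m. word_mat r c $$ (i, j) = u (r ! i) \<and> c ! j = r ! i"
    using i word_mat_entry[OF w i(1), of j] by auto
qed

text \<open>\<open>word_mat r c\<close> is the least matrix matching \<open>r\<close> and
  \<open>c\<close>: ranks fix the entry of each row with a nonzero letter, so any other matching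
  matrix contains it and can have more entries only in rows where \<open>r\<close> has 0.\<close>

lemma match_entry_word_mat:
  assumes d: "d \<in> planar_rook n m" and w: "r \<in> words n m" "c \<in> words n m" and mt: "match d r c"
    and ij: "i < m" "j < m"
  shows "word_mat r c $$ (i, j) \<noteq> 0 \<Longrightarrow> d $$ (i, j) = word_mat r c $$ (i, j)"
    and "\<lbrakk>d $$ (i, j) \<noteq> 0; r ! i \<noteq> 0\<rbrakk> \<Longrightarrow> d $$ (i, j) = word_mat r c $$ (i, j)"
proof -
  have row: "\<exists>j'<m. d $$ (i, j') = u (r ! i) \<and> word_mat r c $$ (i, j') = u (r ! i)" if i: "r ! i \<noteq> 0"
  proof -
    obtain j' where j': "j' < m" "d $$ (i, j') = u (r ! i)" "c ! j' = r ! i"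
      using match_row[OF mt w(2,1) ij(1) i] .
    have "rank_in r (r ! i) i = rank_in c (r ! i) j'" using match_rank_in[OF d w mt ij(1) j'(1,2) refl i] .
    then have "word_mat r c $$ (i, j') = u (r ! i)" using word_mat_entry[OF w ij(1) j'(1)] i j'(3) by simp
    then show ?thesis using j' by blast
  qed
  show "d $$ (i, j) = word_mat r c $$ (i, j)" if nz: "word_mat r c $$ (i, j) \<noteq> 0"
  proof -
    have "r ! i \<noteq> 0" using word_mat_entryD[OF w ij nz] by simp
    then obtain j' where j': "j' < m" "d $$ (i, j') = u (r ! i)" "word_mat r c $$ (i, j') = u (r ! i)" using row by blast
    have "j' = j" using planar_row_unique[OF word_mat_planar[OF w] ij(1) j'(1) ij(2)] j'(3) nz by simp
    then show ?thesis using j' by simp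
  qed
  show "d $$ (i, j) = word_mat r c $$ (i, j)" if nz: "d $$ (i, j) \<noteq> 0" "r ! i \<noteq> 0"
  proof -
    obtain j' where j': "j' < m" "d $$ (i, j') = u (r ! i)" "word_mat r c $$ (i, j') = u (r ! i)" using row nz(2) by blast
    have "j' = j" using planar_row_unique[OF d ij(1) j'(1) ij(2)] j'(2) nz by simp
    then show ?thesis using j' by simp
  qed
qed

text \<open>A letter of the row word is the colour found in that row, or 0 for a zero row; likewise
  for columns. Then \<open>d\<close> has no entry in a row with letter 0, so it is the least matrix
  matching its two words.\<close>

lemma planar_eq_word_mat:
  assumes d: "d \<in> planar_rook n m"
  obtains r c where "r \<in> words n m" "c \<in> words n m" "mset r = mset c" "d = word_mat r c"
proof -
  define R where "R i k \<longleftrightarrow> k \<le> n \<and> (if k = 0 then \<forall>j<m. d $$ (i, j) = 0 else \<exists>j<m. d $$ (i, j) = u k)" for i k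
  define C where "C j k \<longleftrightarrow> k \<le> n \<and> (if k = 0 then \<forall>i<m. d $$ (i, j) = 0 else \<exists>i<m. d $$ (i, j) = u k)" for j k
  have "\<exists>k. R i k" if i: "i < m" for i
  proof (cases "\<forall>j<m. d $$ (i, j) = 0")
    case True then have "R i 0" by (simp add: R_def) then show ?thesis ..
  next
    case False
    then obtain j where j: "j < m" "d $$ (i, j) \<noteq> 0" by blast
    obtain k where "1 \<le> k" "k \<le> n" "d $$ (i, j) = u k" using planar_entry[OF d i j] .
    then have "R i k" using j by (auto simp: R_def)
    then show ?thesis ..
  qed
  then obtain rf where rf: "\<And>i. i < m \<Longrightarrow> R i (rf i)" by metis
  have "\<exists>k. C j k" if j: "j < m" for j
  proof (cases "\<forall>i<m. d $$ (i, j) = 0")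
    case True then have "C j 0" by (simp add: C_def) then show ?thesis ..
  next
    case False
    then obtain i where i: "i < m" "d $$ (i, j) \<noteq> 0" by blast
    obtain k where "1 \<le> k" "k \<le> n" "d $$ (i, j) = u k" using planar_entry[OF d i(1) j i(2)] .
    then have "C j k" using i by (auto simp: C_def)
    then show ?thesis ..
  qed
  then obtain cf where cf: "\<And>j. j < m \<Longrightarrow> C j (cf j)" by metis
  let ?r = "map rf [0..<m]" and ?c = "map cf [0..<m]"
  have w: "?r \<in> words n m" "?c \<in> words n m" using rf cf by (auto simp: words_def R_def C_def)
  have rn: "?r ! i = rf i" if "i < m" for i using that by simp
  have cn: "?c ! i = cf i" if "i < m" for i using that by simp
  have rf_eq: "rf i = k" if H: "i < m" "j < m" "d $$ (i, j) = u k" for i j k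
  proof -
    have "rf i \<noteq> 0" using rf[OF H(1)] H unfolding R_def by (metis u_neq_0)
    then obtain j' where "j' < m" "d $$ (i, j') = u (rf i)" using rf[OF H(1)] unfolding R_def by auto
    then show ?thesis using planar_row_unique[OF d H(1,2)] H(3) by (metis u_eq_iff u_neq_0)
  qed
  have cf_eq: "cf j = k" if H: "i < m" "j < m" "d $$ (i, j) = u k" for i j k
  proof -
    have "cf j \<noteq> 0" using cf[OF H(2)] H unfolding C_def by (metis u_neq_0)
    then obtain i' where "i' < m" "d $$ (i', j) = u (cf j)" using cf[OF H(2)] unfolding C_def by auto
    then show ?thesis using planar_col_unique[OF d H(1) _ H(2)] H(3) by (metis u_eq_iff u_neq_0)
  qed
  have mt: "match d ?r ?c"
    unfolding match_iff_words[OF w(2,1)]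
  proof (intro conjI allI impI)
    fix j assume j: "j < m" "?c ! j \<noteq> 0"
    then obtain i where "i < m" "d $$ (i, j) = u (cf j)" using cf[OF j(1)] unfolding C_def by auto
    then show "\<exists>i<m. d $$ (i, j) = u (?c ! j) \<and> ?r ! i = ?c ! j" using rf_eq j rn cn by metis
  next
    fix i assume i: "i < m" "?r ! i \<noteq> 0"
    then obtain j where "j < m" "d $$ (i, j) = u (rf i)" using rf[OF i(1)] unfolding R_def by auto
    then show "\<exists>j<m. d $$ (i, j) = u (?r ! i) \<and> ?c ! j = ?r ! i" using cf_eq i rn cn by metis
  qed
  have eq: "mset ?r = mset ?c" using match_mset[OF d w mt] .
  have "d = word_mat ?r ?c"
  proof (rule eq_matI)
    show "dim_row d = dim_row (word_mat ?r ?c)" "dim_col d = dim_col (word_mat ?r ?c)"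
      using planar_dim[OF d] planar_dim[OF word_mat_planar[OF w]] by auto
    fix i j assume "i < dim_row (word_mat ?r ?c)" "j < dim_col (word_mat ?r ?c)"
    then have ij: "i < m" "j < m" using planar_dim[OF word_mat_planar[OF w]] by auto
    show "d $$ (i, j) = word_mat ?r ?c $$ (i, j)"
    proof (cases "word_mat ?r ?c $$ (i, j) = 0")
      case False
      then show ?thesis using match_entry_word_mat(1)[OF d w mt ij] by simp
    next
      case True
      show ?thesis
      proof (rule ccontr)
        assume ne: "\<not> ?thesis"
        then have nz: "d $$ (i, j) \<noteq> 0" using True by simp
        obtain k where "1 \<le> k" "d $$ (i, j) = u k" using planar_entry[OF d ij nz] .
        then have "?r ! i \<noteq> 0" using rf_eq[OF ij] rn ij by simp
        then show False using match_entry_word_mat(2)[OF d w mt ij nz] ne by simp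
      qed
    qed
  qed
  then show thesis using that w eq by blast
qed

lemma word_mat_row_zero_iff:
  assumes w: "r \<in> words n m" "c \<in> words n m" and eq: "mset r = mset c" and i: "i < m"
  shows "r ! i \<noteq> 0 \<longleftrightarrow> (\<exists>j<m. word_mat r c $$ (i, j) \<noteq> 0)"
  using match_row[OF match_word_mat[OF w eq] w(2,1) i] word_mat_entryD[OF w i] by (metis u_neq_0)

lemma word_mat_col_zero_iff:
  assumes w: "r \<in> words n m" "c \<in> words n m" and eq: "mset r = mset c" and j: "j < m"
  shows "c ! j \<noteq> 0 \<longleftrightarrow> (\<exists>i<m. word_mat r c $$ (i, j) \<noteq> 0)"
  using match_col[OF match_word_mat[OF w eq] w(2,1) j] word_mat_entryD[OF w _ j] by (metis u_neq_0)

text \<open>Connects \<open>W_T\<close> with words: fixing \<open>\<beta> d\<close> fixes the column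
  word of \<open>d\<close> and lets the row word vary.\<close>

lemma \<beta>_word_mat:
  assumes w: "r \<in> words n m" "c \<in> words n m" and eq: "mset r = mset c"
  shows "\<beta> (word_mat r c) k = {j. j < m \<and> c ! j = k}"
proof -
  note dim = planar_dim[OF word_mat_planar[OF w]]
  show ?thesis
  proof (cases "k = 0")
    case True
    moreover have "(\<forall>i<m. word_mat r c $$ (i, j) = 0) \<longleftrightarrow> c ! j = 0" if "j < m" for j
      using word_mat_col_zero_iff[OF assms that] by metis
    ultimately show ?thesis by (auto simp: \<beta>_def dim)
  next
    case False
    have "(\<exists>i<m. word_mat r c $$ (i, j) = u k) \<longleftrightarrow> c ! j = k" if j: "j < m" for j
    proof
      assume "\<exists>i<m. word_mat r c $$ (i, j) = u k"
      then obtain i where "i < m" "word_mat r c $$ (i, j) = u k" by blast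
      then show "c ! j = k" using word_mat_entryD[OF w, of i j] j by simp
    next
      assume "c ! j = k"
      then show "\<exists>i<m. word_mat r c $$ (i, j) = u k"
        using match_col[OF match_word_mat[OF w eq] w(2,1) j] False by metis
    qed
    then show ?thesis using False by (simp add: \<beta>_def dim cong: conj_cong)
  qed
qed

section \<open>The matrix representation of the planar rook algebra\<close>

text \<open>The entry at \<open>(r, c)\<close> of the matrix by which \<open>f\<close> acts on the
  space with basis \<open>words n m\<close>: a planar \<open>d\<close> sends \<open>c\<close> to the
  word \<open>r\<close> with \<open>match d r c\<close>, or to 0 if there is none.\<close>

definition Phi :: "nat \<Rightarrow> nat \<Rightarrow> rook_alg \<Rightarrow> nat list \<Rightarrow> nat list \<Rightarrow> complex" where
  "Phi n m f r c = (\<Sum>d\<in>planar_rook n m. if match d r c then f d else 0)"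

lemma carrier_CP_iff: "f \<in> carrier (CP n m) \<longleftrightarrow> (\<forall>d. d \<notin> planar_rook n m \<longrightarrow> f d = 0)"
  by (simp add: CP_def)

lemma CP_simps [simp]:
  "monoid.mult (CP n m) = alg_mult n m" "one (CP n m) = alg_one n m" "zero (CP n m) = 0" "add (CP n m) = (+)"
  by (simp_all add: CP_def)

lemma CP_zero [simp]: "0 \<in> carrier (CP n m)"
  and CP_add [simp]: "f \<in> carrier (CP n m) \<Longrightarrow> g \<in> carrier (CP n m) \<Longrightarrow> f + g \<in> carrier (CP n m)"
  and CP_diff [simp]: "f \<in> carrier (CP n m) \<Longrightarrow> g \<in> carrier (CP n m) \<Longrightarrow> f - g \<in> carrier (CP n m)"
  and CP_uminus [simp]: "f \<in> carrier (CP n m) \<Longrightarrow> - f \<in> carrier (CP n m)"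
  and CP_cscale [simp]: "f \<in> carrier (CP n m) \<Longrightarrow> cscale a f \<in> carrier (CP n m)"
  and CP_basis [simp]: "d \<in> planar_rook n m \<Longrightarrow> basis d \<in> carrier (CP n m)"
  by (auto simp: carrier_CP_iff cscale_def basis_def)

lemma CP_sum [intro]: "(\<And>x. x \<in> S \<Longrightarrow> f x \<in> carrier (CP n m)) \<Longrightarrow> sum f S \<in> carrier (CP n m)"
  by (induction S rule: infinite_finite_induct) auto

lemma Phi_zero [simp]: "Phi n m 0 r c = 0"
  and Phi_add: "Phi n m (f + g) r c = Phi n m f r c + Phi n m g r c"
  and Phi_diff: "Phi n m (f - g) r c = Phi n m f r c - Phi n m g r c"
  and Phi_cscale: "Phi n m (cscale a f) r c = a * Phi n m f r c"
  unfolding Phi_def sum.distrib[symmetric] sum_subtractf[symmetric] sum_distrib_left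
  by (auto simp: cscale_def intro!: sum.cong sum.neutral)

lemma Phi_sum: "Phi n m (sum f S) r c = (\<Sum>x\<in>S. Phi n m (f x) r c)"
  by (induction S rule: infinite_finite_induct)
    (simp_all only: sum.infinite sum.empty sum.insert Phi_zero Phi_add simp_thms)

lemma Phi_basis: "d \<in> planar_rook n m \<Longrightarrow> Phi n m (basis d) r c = (if match d r c then 1 else 0)"
proof -
  assume d: "d \<in> planar_rook n m"
  have "Phi n m (basis d) r c = (\<Sum>d'\<in>planar_rook n m. if d' = d then (if match d r c then 1 else 0) else 0)"
    unfolding Phi_def basis_def by (rule sum.cong) auto
  then show ?thesis using d by simp
qed

lemma Phi_mset:
  assumes "r \<in> words n m" "c \<in> words n m" "mset r \<noteq> mset c"
  shows "Phi n m f r c = 0"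
  unfolding Phi_def using match_mset[OF _ assms(1,2)] assms(3) by (intro sum.neutral) auto

section \<open>Injectivity of the matrix representation\<close>

definition supp :: "rook_mat \<Rightarrow> (nat \<times> nat) set" where
  "supp d = {(i, j). i < dim_row d \<and> j < dim_col d \<and> d $$ (i, j) \<noteq> 0}"

lemma finite_supp [simp]: "finite (supp d)"
  by (rule finite_subset[of _ "{..<dim_row d} \<times> {..<dim_col d}"]) (auto simp: supp_def)

lemma mat_size_supp: "mat_size d = card (supp d)"
  by (simp add: mat_size_def supp_def)

text \<open>If \<open>f \<noteq> 0\<close> and \<open>d\<close> has maximal size among the matrices with \<open>f d \<noteq> 0\<close>, then \<open>f d\<close> is the
  value of \<open>Phi f\<close> at the row and column words of \<open>d\<close>.\<close>

lemma Phi_eq_0D: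
  assumes f: "f \<in> carrier (CP n m)"
    and 0: "\<And>r c. \<lbrakk>r \<in> words n m; c \<in> words n m; mset r = mset c\<rbrakk> \<Longrightarrow> Phi n m f r c = 0"
  shows "f = 0"
proof (rule ccontr)
  let ?S = "{d \<in> planar_rook n m. f d \<noteq> 0}"
  assume "f \<noteq> 0"
  then obtain d0 where "f d0 \<noteq> 0" by (auto simp: fun_eq_iff)
  then have "?S \<noteq> {}" using f by (auto simp: carrier_CP_iff)
  moreover have fin: "finite ?S" by simp
  ultimately have "Max (mat_size ` ?S) \<in> mat_size ` ?S" by (intro Max_in) auto
  then obtain d where d: "d \<in> ?S" and dmax: "mat_size d = Max (mat_size ` ?S)" by auto
  have max: "mat_size d' \<le> mat_size d" if "d' \<in> ?S" for d'
    unfolding dmax using that fin by (intro Max_ge) auto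
  have dP: "d \<in> planar_rook n m" using d by simp
  obtain r c where w: "r \<in> words n m" "c \<in> words n m" and eq: "mset r = mset c" and dm: "d = word_mat r c"
    using planar_eq_word_mat[OF dP] .
  \<comment> \<open>Every other matrix matching the words of \<open>d\<close> properly contains
    \<open>d\<close>, so its size exceeds the maximum.\<close>
  have "f d' = 0" if d': "d' \<in> planar_rook n m" "match d' r c" "d' \<noteq> d" for d'
  proof (rule ccontr)
    assume "f d' \<noteq> 0"
    then have le: "card (supp d') \<le> card (supp d)" using max[of d'] d' by (simp add: mat_size_supp)
    note dims = planar_dim[OF d'(1)] planar_dim[OF dP]
    have ent: "d' $$ (i, j) = d $$ (i, j)" if "i < m" "j < m" "d $$ (i, j) \<noteq> 0" for i j
      using match_entry_word_mat(1)[OF d'(1) w d'(2) that(1,2)] that(3) dm by simp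
    then have "supp d \<subseteq> supp d'" by (auto simp: supp_def dims)
    then have "supp d = supp d'" using le by (intro card_seteq) auto
    have "d' = d"
    proof (rule eq_matI)
      fix i j assume "i < dim_row d" "j < dim_col d"
      then have ij: "i < m" "j < m" by (auto simp: dims)
      then have "(i, j) \<in> supp d' \<longleftrightarrow> (i, j) \<in> supp d" using \<open>supp d = supp d'\<close> by simp
      then have "d' $$ (i, j) = 0" if "d $$ (i, j) = 0" using that ij by (simp add: supp_def dims)
      then show "d' $$ (i, j) = d $$ (i, j)" using ent[OF ij] by metis
    qed (simp_all add: dims)
    then show False using d' by simp
  qed
  then have "Phi n m f r c = (\<Sum>d'\<in>planar_rook n m. if d' = d then f d else 0)"
    unfolding Phi_def using match_word_mat[OF w eq] dm by (intro sum.cong) auto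
  then have "Phi n m f r c = f d" using dP by simp
  then show False using d 0[OF w eq] by simp
qed

text \<open>Identities in the algebra are checked entrywise by this rule; between words of different
  multiplicities both sides are 0, whence the premise \<open>mset r = mset c\<close>.\<close>

lemma Phi_eqI:
  assumes "f \<in> carrier (CP n m)" "g \<in> carrier (CP n m)"
    and "\<And>r c. \<lbrakk>r \<in> words n m; c \<in> words n m; mset r = mset c\<rbrakk> \<Longrightarrow> Phi n m f r c = Phi n m g r c"
  shows "f = g"
proof -
  have "f - g = 0" using assms by (intro Phi_eq_0D[of _ n m]) (auto simp: Phi_diff)
  then show ?thesis by simp
qed

lemma CP_mult [simp]: "alg_mult n m f g \<in> carrier (CP n m)"
  unfolding carrier_CP_iff alg_mult_def using planar_mult by (auto intro!: sum.neutral)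

lemma Phi_mult:
  assumes w: "r \<in> words n m" "c \<in> words n m"
  shows "Phi n m (alg_mult n m f g) r c = (\<Sum>s\<in>words n m. Phi n m f r s * Phi n m g s c)"
proof -
  let ?P = "planar_rook n m"
  \<comment> \<open>Given \<open>a\<close> and \<open>r\<close> there is at most one middle word, so
    summing over it counts each pair of matrices only once.\<close>
  have one: "(\<Sum>s\<in>words n m. if match a r s \<and> match b s c then x else 0) = (if match (a * b) r c then x else 0)"
    if ab: "a \<in> ?P" "b \<in> ?P" for a b and x :: complex
  proof (cases "match (a * b) r c")
    case True
    then obtain s where s: "s \<in> words n m" "match a r s" "match b s c" using match_mult[OF ab w] by blast
    have "(\<Sum>s\<in>words n m. if match a r s \<and> match b s c then x else 0) = (\<Sum>s'\<in>words n m. if s' = s then x else 0)"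
    proof (rule sum.cong[OF refl])
      fix s' assume "s' \<in> words n m"
      then have uniq: "match a r s' \<Longrightarrow> s' = s" using match_col_unique[OF ab(1) w(1)] s by blast
      show "(if match a r s' \<and> match b s' c then x else 0) = (if s' = s then x else 0)"
      proof (cases "s' = s")
        case True
        then show ?thesis using s by simp
      next
        case False
        then have "\<not> match a r s'" using uniq by blast
        then show ?thesis using False by simp
      qed
    qed
    then show ?thesis using True s by simp
  next
    case False
    then show ?thesis using match_mult[OF ab w] by (auto intro!: sum.neutral)
  qed
  have "Phi n m (alg_mult n m f g) r c =
      (\<Sum>d\<in>?P. \<Sum>(a, b)\<in>?P \<times> ?P. if d = a * b then (if match (a * b) r c then f a * g b else 0) else 0)"
    unfolding Phi_def alg_mult_def
    by (intro sum.cong refl) (auto intro!: sum.cong sum.neutral simp: case_prod_beta)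
  also have "\<dots> = (\<Sum>(a, b)\<in>?P \<times> ?P. \<Sum>d\<in>?P. if d = a * b then (if match (a * b) r c then f a * g b else 0) else 0)"
    unfolding case_prod_beta by (rule sum.swap)
  also have "\<dots> = (\<Sum>(a, b)\<in>?P \<times> ?P. if match (a * b) r c then f a * g b else 0)"
    by (intro sum.cong refl) (auto simp: planar_mult)
  also have "\<dots> = (\<Sum>(a, b)\<in>?P \<times> ?P. \<Sum>s\<in>words n m. if match a r s \<and> match b s c then f a * g b else 0)"
    by (intro sum.cong refl) (auto simp only: one split: prod.splits)
  also have "\<dots> = (\<Sum>s\<in>words n m. \<Sum>(a, b)\<in>?P \<times> ?P. if match a r s \<and> match b s c then f a * g b else 0)"
    unfolding case_prod_beta by (rule sum.swap)
  also have "\<dots> = (\<Sum>s\<in>words n m. Phi n m f r s * Phi n m g s c)"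
    unfolding Phi_def sum_product sum.cartesian_product by (intro sum.cong refl) auto
  finally show ?thesis .
qed

section \<open>The basis elements \<open>x_d\<close> as matrix units\<close>

definition restrict_mat :: "rook_mat \<Rightarrow> (nat \<times> nat) set \<Rightarrow> rook_mat" where
  "restrict_mat d S = mat (dim_row d) (dim_col d) (\<lambda>p. if p \<in> S then d $$ p else 0)"

lemma restrict_mat_entry [simp]:
  "\<lbrakk>i < dim_row d; j < dim_col d\<rbrakk> \<Longrightarrow> restrict_mat d S $$ (i, j) = (if (i, j) \<in> S then d $$ (i, j) else 0)"
  by (simp add: restrict_mat_def)

lemma supp_restrict_mat: "S \<subseteq> supp d \<Longrightarrow> supp (restrict_mat d S) = S"
  by (auto simp: supp_def restrict_mat_def split: if_splits)

text \<open>Turns the sum over submatrices into one over all subsets of the finite set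
  \<open>supp d\<close>, where inclusion-exclusion applies.\<close>

lemma bij_betw_restrict_mat: "bij_betw (restrict_mat d) (Pow (supp d)) (submatrices d)"
proof (rule bij_betwI[where g = supp])
  show "restrict_mat d \<in> Pow (supp d) \<rightarrow> submatrices d"
    by (auto simp: submatrices_def restrict_mat_def)
  show "supp \<in> submatrices d \<rightarrow> Pow (supp d)"
    by (fastforce simp: submatrices_def supp_def)
  show "supp (restrict_mat d S) = S" if "S \<in> Pow (supp d)" for S using that supp_restrict_mat by simp
  show "restrict_mat d (supp d') = d'" if d': "d' \<in> submatrices d" for d'
  proof (rule eq_matI)
    show "dim_row (restrict_mat d (supp d')) = dim_row d'" "dim_col (restrict_mat d (supp d')) = dim_col d'"
      using d' by (auto simp: submatrices_def restrict_mat_def)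
    fix i j assume "i < dim_row d'" "j < dim_col d'"
    then have "i < dim_row d" "j < dim_col d" using d' by (auto simp: submatrices_def)
    then show "restrict_mat d (supp d') $$ (i, j) = d' $$ (i, j)"
      using d' by (fastforce simp: submatrices_def supp_def)
  qed
qed

lemma restrict_mat_planar:
  assumes d: "d \<in> planar_rook n m"
  shows "restrict_mat d S \<in> planar_rook n m"
proof -
  note dim = planar_dim[OF d]
  have *: "restrict_mat d S $$ (i, j) \<noteq> 0 \<Longrightarrow> d $$ (i, j) = restrict_mat d S $$ (i, j)" if "i < m" "j < m" for i j
    using that dim by auto
  show ?thesis
    unfolding planar_rook_iff
  proof (intro conjI allI impI notI)
    show "restrict_mat d S \<in> carrier_mat m m" unfolding restrict_mat_def dim by (rule mat_carrier)
    show "\<exists>k\<in>{1..n}. restrict_mat d S $$ (i, j) = u k" if H: "i < m" "j < m" "restrict_mat d S $$ (i, j) \<noteq> 0" for i j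
    proof -
      have nz: "d $$ (i, j) \<noteq> 0" using *[OF H] H(3) by simp
      obtain k where "1 \<le> k" "k \<le> n" "d $$ (i, j) = u k" using planar_entry[OF d H(1,2) nz] .
      then show ?thesis using *[OF H] by auto
    qed
    show "j = j'" if "i < m" "j < m" "j' < m" "restrict_mat d S $$ (i, j) \<noteq> 0" "restrict_mat d S $$ (i, j') \<noteq> 0" for i j j'
      using planar_row_unique[OF d that(1-3)] *[OF that(1,2)] *[OF that(1,3)] that(4,5) by simp
    show "i = i'" if "i < m" "i' < m" "j < m" "restrict_mat d S $$ (i, j) \<noteq> 0" "restrict_mat d S $$ (i', j) \<noteq> 0" for i i' j
      using planar_col_unique[OF d that(1-3)] *[OF that(1,3)] *[OF that(2,3)] that(4,5) by simp
    fix k i i' j j'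
    assume h: "i < i'" "i' < m" "j < j'" "j' < m" "restrict_mat d S $$ (i, j') = u k" "restrict_mat d S $$ (i', j) = u k"
    then have im: "i < m" "j < m" by auto
    show False using planar_no_crossing[OF d h(1-4)] *[OF im(1) h(4)] *[OF h(2) im(2)] h(5,6) by simp
  qed
qed

lemma x_elt_restrict_mat:
  "x_elt d = (\<Sum>S\<in>Pow (supp d). cscale ((-1) ^ card (supp d - S)) (basis (restrict_mat d S)))"
proof -
  have "x_elt d = (\<Sum>S\<in>Pow (supp d). cscale ((-1) ^ (mat_size d - mat_size (restrict_mat d S))) (basis (restrict_mat d S)))"
    unfolding x_elt_def by (rule sum.reindex_bij_betw[OF bij_betw_restrict_mat, symmetric])
  also have "\<dots> = (\<Sum>S\<in>Pow (supp d). cscale ((-1) ^ card (supp d - S)) (basis (restrict_mat d S)))"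
    by (rule sum.cong) (auto simp: mat_size_supp supp_restrict_mat card_Diff_subset finite_subset[OF _ finite_supp])
  finally show ?thesis .
qed

lemma CP_x_elt [simp]: "d \<in> planar_rook n m \<Longrightarrow> x_elt d \<in> carrier (CP n m)"
  unfolding x_elt_restrict_mat by (intro CP_sum CP_cscale CP_basis restrict_mat_planar)

text \<open>Inclusion-exclusion by expanding the product of \<open>1 + ?g p\<close> over
  \<open>D\<close>. A factor is 1 on \<open>E\<close> and 0 elsewhere, so the product is 1 iff
  \<open>E = D\<close>; in the expansion the value 0 of \<open>?g\<close> on \<open>E\<close> kills
  each \<open>S\<close> that misses a point of \<open>E\<close>.\<close>

lemma alternating_sum_supersets:
  assumes "finite D" "E \<subseteq> D"
  shows "(\<Sum>S\<in>Pow D. (-1) ^ card (D - S) * (if E \<subseteq> S then 1 else 0)) = (if E = D then 1 else (0::complex))"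
proof -
  let ?g = "\<lambda>p. if p \<in> E then 0 else - 1 :: complex"
  have "prod ?g (D - S) = (-1) ^ card (D - S) * (if E \<subseteq> S then 1 else 0)" if "S \<subseteq> D" for S
  proof (cases "E \<subseteq> S")
    case True
    then have "prod ?g (D - S) = (\<Prod>p\<in>D - S. -1)" by (intro prod.cong) auto
    then show ?thesis using True by simp
  next
    case False
    then obtain p where "p \<in> E" "p \<notin> S" by blast
    then have "prod ?g (D - S) = 0" using assms by (intro prod_zero) auto
    then show ?thesis using False by simp
  qed
  then have "(\<Sum>S\<in>Pow D. (-1) ^ card (D - S) * (if E \<subseteq> S then 1 else 0)) =
      (\<Sum>S\<in>Pow D. (\<Prod>p\<in>S. 1) * prod ?g (D - S))"
    by (intro sum.cong) auto
  also have "\<dots> = (\<Prod>p\<in>D. 1 + ?g p)" by (rule prod_add[OF assms(1), symmetric])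
  also have "\<dots> = (if E = D then 1 else 0)"
  proof (cases "E = D")
    case True
    then show ?thesis by (simp add: prod.neutral)
  next
    case False
    then obtain p where "p \<in> D" "p \<notin> E" using assms by blast
    then show ?thesis using assms False by (auto intro: prod_zero)
  qed
  finally show ?thesis .
qed

text \<open>An entry may be erased iff it carries no nonzero letter, that is, iff its row has letter
  0 in \<open>r\<close>.\<close>

lemma match_restrict_mat:
  assumes d: "d \<in> planar_rook n m" and w: "r \<in> words n m" "c \<in> words n m" and S: "S \<subseteq> supp d"
  shows "match (restrict_mat d S) r c \<longleftrightarrow> match d r c \<and> {(i, j) \<in> supp d. r ! i \<noteq> 0} \<subseteq> S"
proof
  note dim = planar_dim[OF d]
  assume mt: "match (restrict_mat d S) r c"
  have ent: "d $$ (i, j) = u k \<and> (i, j) \<in> S" if "i < m" "j < m" "restrict_mat d S $$ (i, j) = u k" for i j k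
    using that dim by (auto split: if_splits)
  show "match d r c \<and> {(i, j) \<in> supp d. r ! i \<noteq> 0} \<subseteq> S"
  proof
    show "match d r c"
      using mt ent unfolding match_iff_words[OF w(2,1)] by metis
    show "{(i, j) \<in> supp d. r ! i \<noteq> 0} \<subseteq> S"
    proof clarify
      fix i j assume "(i, j) \<in> supp d" and i: "0 < r ! i"
      then have ij: "i < m" "j < m" "d $$ (i, j) \<noteq> 0" by (auto simp: supp_def dim)
      obtain j' where j': "j' < m" "restrict_mat d S $$ (i, j') = u (r ! i)"
        using match_row[OF mt w(2,1) ij(1)] i by auto
      have "j' = j" using planar_row_unique[OF d ij(1) j'(1) ij(2)] ent[OF ij(1) j'] ij(3) by simp
      then show "(i, j) \<in> S" using ent[OF ij(1) j'] by simp
    qed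
  qed
next
  note dim = planar_dim[OF d]
  assume "match d r c \<and> {(i, j) \<in> supp d. r ! i \<noteq> 0} \<subseteq> S"
  then have mt: "match d r c" and sub: "\<And>i j. (i, j) \<in> supp d \<Longrightarrow> r ! i \<noteq> 0 \<Longrightarrow> (i, j) \<in> S" by auto
  have ent: "restrict_mat d S $$ (i, j) = u k" if "i < m" "j < m" "d $$ (i, j) = u k" "r ! i \<noteq> 0" for i j k
    using that dim sub[of i j] by (auto simp: supp_def)
  show "match (restrict_mat d S) r c"
    unfolding match_iff_words[OF w(2,1)]
  proof (intro conjI allI impI)
    fix j assume j: "j < m" "c ! j \<noteq> 0"
    obtain i where "i < m" "d $$ (i, j) = u (c ! j)" "r ! i = c ! j" using match_col[OF mt w(2,1) j] .
    then show "\<exists>i<m. restrict_mat d S $$ (i, j) = u (c ! j) \<and> r ! i = c ! j" using ent j by metis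
  next
    fix i assume i: "i < m" "r ! i \<noteq> 0"
    obtain j where "j < m" "d $$ (i, j) = u (r ! i)" "c ! j = r ! i" using match_row[OF mt w(2,1) i] .
    then show "\<exists>j<m. restrict_mat d S $$ (i, j) = u (r ! i) \<and> c ! j = r ! i" using ent i by metis
  qed
qed

text \<open>The admissible \<open>S\<close> are the supersets of the set of entries in use, so the
  alternating sum leaves only words that use every entry of \<open>d\<close>.\<close>

lemma Phi_x_elt:
  assumes d: "d \<in> planar_rook n m" and w: "r \<in> words n m" "c \<in> words n m"
  shows "Phi n m (x_elt d) r c = (if match d r c \<and> (\<forall>(i, j)\<in>supp d. r ! i \<noteq> 0) then 1 else 0)"
proof -
  let ?E = "{(i, j) \<in> supp d. r ! i \<noteq> 0}"
  have "Phi n m (x_elt d) r c =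
      (\<Sum>S\<in>Pow (supp d). (-1) ^ card (supp d - S) * (if match (restrict_mat d S) r c then 1 else 0))"
    unfolding x_elt_restrict_mat Phi_sum Phi_cscale using Phi_basis[OF restrict_mat_planar[OF d]] by simp
  also have "\<dots> = (\<Sum>S\<in>Pow (supp d). (-1) ^ card (supp d - S) * (if match d r c \<and> ?E \<subseteq> S then 1 else 0))"
  proof (rule sum.cong[OF refl])
    fix S assume "S \<in> Pow (supp d)"
    then show "(-1) ^ card (supp d - S) * (if match (restrict_mat d S) r c then 1 else 0) =
      (-1) ^ card (supp d - S) * (if match d r c \<and> ?E \<subseteq> S then 1 else (0::complex))"
      using match_restrict_mat[OF d w, of S] by simp
  qed
  also have "\<dots> = (if match d r c \<and> ?E = supp d then 1 else 0)"
  proof (cases "match d r c")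
    case True
    have "?E \<subseteq> supp d" by auto
    from alternating_sum_supersets[OF finite_supp this] show ?thesis using True by simp
  qed simp
  also have "?E = supp d \<longleftrightarrow> (\<forall>(i, j)\<in>supp d. r ! i \<noteq> 0)" by auto
  finally show ?thesis .
qed

definition mat_unit :: "nat list \<Rightarrow> nat list \<Rightarrow> rook_alg" where
  "mat_unit r c = x_elt (word_mat r c)"

lemma CP_mat_unit [simp]: "r \<in> words n m \<Longrightarrow> c \<in> words n m \<Longrightarrow> mat_unit r c \<in> carrier (CP n m)"
  unfolding mat_unit_def by (intro CP_x_elt word_mat_planar)

text \<open>If all entries are in use, \<open>r\<close> has nonzero letters exactly in the nonzero
  rows, with the colours of their entries. This gives \<open>r = r0\<close>, and the row word
  determines the column word.\<close>

lemma Phi_mat_unit: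
  assumes w0: "r0 \<in> words n m" "c0 \<in> words n m" "mset r0 = mset c0"
    and w: "r \<in> words n m" "c \<in> words n m"
  shows "Phi n m (mat_unit r0 c0) r c = (if r = r0 \<and> c = c0 then 1 else 0)"
proof -
  note P = word_mat_planar[OF w0(1,2)] and mt0 = match_word_mat[OF w0]
  note dim = planar_dim[OF P]
  have "match (word_mat r0 c0) r c \<and> (\<forall>(i, j)\<in>supp (word_mat r0 c0). r ! i \<noteq> 0) \<longleftrightarrow> r = r0 \<and> c = c0"
  proof
    assume "match (word_mat r0 c0) r c \<and> (\<forall>(i, j)\<in>supp (word_mat r0 c0). r ! i \<noteq> 0)"
    then have mt: "match (word_mat r0 c0) r c" and nz: "\<And>i j. (i, j) \<in> supp (word_mat r0 c0) \<Longrightarrow> r ! i \<noteq> 0" by auto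
    have "r = r0"
    proof (rule nth_equalityI)
      show "length r = length r0" using w w0 by (simp add: words_length)
      fix i assume "i < length r"
      then have i: "i < m" using w by (simp add: words_length)
      show "r ! i = r0 ! i"
      proof (cases "r ! i = 0")
        case True
        then have "\<forall>j<m. word_mat r0 c0 $$ (i, j) = 0" using nz[of i] i by (auto simp: supp_def dim)
        then show ?thesis using word_mat_row_zero_iff[OF w0 i] True by auto
      next
        case False
        then obtain j where j: "j < m" "word_mat r0 c0 $$ (i, j) = u (r ! i)"
          using match_row[OF mt w(2,1) i] by blast
        then show ?thesis using word_mat_entryD[OF w0(1,2) i j(1)] by simp
      qed
    qed
    moreover have "c = c0" using match_col_unique[OF P w0(1) w(2) w0(2)] mt mt0 \<open>r = r0\<close> by blast
    ultimately show "r = r0 \<and> c = c0" ..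
  next
    assume eq: "r = r0 \<and> c = c0"
    have "r0 ! i \<noteq> 0" if "(i, j) \<in> supp (word_mat r0 c0)" for i j
      using that word_mat_entryD[OF w0(1,2), of i j] by (auto simp: supp_def dim)
    then show "match (word_mat r0 c0) r c \<and> (\<forall>(i, j)\<in>supp (word_mat r0 c0). r ! i \<noteq> 0)" using eq mt0 by auto
  qed
  then show ?thesis unfolding mat_unit_def Phi_x_elt[OF P w] by simp
qed

section \<open>Tensor products and the identity\<close>

lemma tensor_carrier:
  assumes "a \<in> planar_rook n m" "b \<in> planar_rook n 1"
  shows "diag_block_mat [a, b] \<in> carrier_mat (Suc m) (Suc m)"
  using planar_dim[OF assms(1)] planar_dim[OF assms(2)]
  by (intro carrier_matI) (simp_all add: dim_diag_block_mat del: diag_block_mat.simps)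

lemma tensor_entry:
  assumes a: "a \<in> planar_rook n m" and b: "b \<in> planar_rook n 1"
  shows "\<lbrakk>i < m; j < m\<rbrakk> \<Longrightarrow> diag_block_mat [a, b] $$ (i, j) = a $$ (i, j)"
    and "i < m \<Longrightarrow> diag_block_mat [a, b] $$ (i, m) = 0"
    and "j < m \<Longrightarrow> diag_block_mat [a, b] $$ (m, j) = 0"
    and "diag_block_mat [a, b] $$ (m, m) = b $$ (0, 0)"
  using planar_dim[OF a] planar_dim[OF b] by (simp_all add: Let_def)

lemma tensor_planar:
  assumes a: "a \<in> planar_rook n m" and b: "b \<in> planar_rook n 1"
  shows "diag_block_mat [a, b] \<in> planar_rook n (Suc m)"
proof -
  let ?D = "diag_block_mat [a, b]"
  note ent = tensor_entry[OF a b]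
  have nz: "(i < m \<and> j < m \<and> a $$ (i, j) = ?D $$ (i, j)) \<or> (i = m \<and> j = m \<and> b $$ (0, 0) = ?D $$ (i, j))"
    if H: "i < Suc m" "j < Suc m" "?D $$ (i, j) \<noteq> 0" for i j
  proof -
    consider "i < m" "j < m" | "i < m" "j = m" | "i = m" "j < m" | "i = m" "j = m"
      using H(1,2) by linarith
    then show ?thesis
    proof cases
      case 1 then show ?thesis using ent(1) by simp
    next
      case 2 then show ?thesis using ent(2) H(3) by simp
    next
      case 3 then show ?thesis using ent(3) H(3) by simp
    next
      case 4 then show ?thesis using ent(4) by simp
    qed
  qed
  show ?thesis
    unfolding planar_rook_iff
  proof (intro conjI allI impI notI)
    show "?D \<in> carrier_mat (Suc m) (Suc m)" using tensor_carrier[OF a b] .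
    show "\<exists>k\<in>{1..n}. ?D $$ (i, j) = u k" if H: "i < Suc m" "j < Suc m" "?D $$ (i, j) \<noteq> 0" for i j
      using nz[OF H]
    proof (elim disjE conjE)
      assume h: "i < m" "j < m" "a $$ (i, j) = ?D $$ (i, j)"
      then obtain k where "1 \<le> k" "k \<le> n" "a $$ (i, j) = u k"
        using planar_entry[OF a h(1,2)] H(3) by auto
      then show ?thesis using h by auto
    next
      assume h: "b $$ (0, 0) = ?D $$ (i, j)"
      then obtain k where "1 \<le> k" "k \<le> n" "b $$ (0, 0) = u k"
        using planar_entry[OF b, of 0 0] H(3) by auto
      then show ?thesis using h by auto
    qed
    show "j = j'" if H: "i < Suc m" "j < Suc m" "j' < Suc m" "?D $$ (i, j) \<noteq> 0" "?D $$ (i, j') \<noteq> 0" for i j j'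
      using nz[OF H(1,2,4)] nz[OF H(1,3,5)] planar_row_unique[OF a, of i j j'] H(4,5) by auto
    show "i = i'" if H: "i < Suc m" "i' < Suc m" "j < Suc m" "?D $$ (i, j) \<noteq> 0" "?D $$ (i', j) \<noteq> 0" for i i' j
      using nz[OF H(1,3,4)] nz[OF H(2,3,5)] planar_col_unique[OF a, of i i' j] H(4,5) by auto
    fix k i i' j j'
    assume H: "i < i'" "i' < Suc m" "j < j'" "j' < Suc m" "?D $$ (i, j') = u k" "?D $$ (i', j) = u k"
    then have "i < m" "j < m" by auto
    then show False
      using nz[of i j'] nz[of i' j] planar_no_crossing[OF a H(1) _ H(3), of k] H by auto
  qed
qed

lemma planar_rook_1_iff:
  "b \<in> planar_rook n 1 \<longleftrightarrow> b \<in> carrier_mat 1 1 \<and> (b $$ (0, 0) = 0 \<or> (\<exists>k\<in>{1..n}. b $$ (0, 0) = u k))"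
  unfolding planar_rook_iff by auto

lemma match_tensor:
  assumes a: "a \<in> planar_rook n m" and b: "b \<in> planar_rook n 1"
    and w: "r \<in> words n m" "c \<in> words n m"
  shows "match (diag_block_mat [a, b]) (r @ [k]) (c @ [l]) \<longleftrightarrow> match a r c \<and> match b [k] [l]"
proof -
  let ?D = "diag_block_mat [a, b]"
  note ent = tensor_entry[OF a b]
  have len: "length r = m" "length c = m" using w by (simp_all add: words_length)
  have all: "(\<forall>j<Suc m. P j) \<longleftrightarrow> (\<forall>j<m. P j) \<and> P m" for P :: "nat \<Rightarrow> bool"
    by (auto simp: less_Suc_eq)
  have ex: "(\<exists>j<Suc m. P j) \<longleftrightarrow> (\<exists>j<m. P j) \<or> P m" for P :: "nat \<Rightarrow> bool"
    by (auto simp: less_Suc_eq)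
  show ?thesis
    unfolding match_def length_append_singleton len all ex
    by (simp add: nth_append len ent del: diag_block_mat.simps cong: conj_cong imp_cong) blast
qed

lemma CP_tensor [simp]: "alg_tensor n m 1 f g \<in> carrier (CP n (Suc m))"
  unfolding carrier_CP_iff alg_tensor_def using tensor_planar
  by (auto intro!: sum.neutral simp del: diag_block_mat.simps)

lemma Phi_tensor:
  assumes w: "r \<in> words n m" "c \<in> words n m"
  shows "Phi n (Suc m) (alg_tensor n m 1 f g) (r @ [k]) (c @ [l]) = Phi n m f r c * Phi n 1 g [k] [l]"
proof -
  let ?P = "planar_rook n m \<times> planar_rook n 1" and ?Q = "planar_rook n (Suc m)"
  let ?M = "\<lambda>d. match d (r @ [k]) (c @ [l])"
  let ?t = "\<lambda>a b. diag_block_mat [a, b]"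
  have "Phi n (Suc m) (alg_tensor n m 1 f g) (r @ [k]) (c @ [l]) =
      (\<Sum>d\<in>?Q. \<Sum>(a, b)\<in>?P. if d = ?t a b then (if ?M (?t a b) then f a * g b else 0) else 0)"
    unfolding Phi_def alg_tensor_def
    by (intro sum.cong refl) (auto intro!: sum.cong sum.neutral simp: case_prod_beta simp del: diag_block_mat.simps)
  also have "\<dots> = (\<Sum>(a, b)\<in>?P. \<Sum>d\<in>?Q. if d = ?t a b then (if ?M (?t a b) then f a * g b else 0) else 0)"
    unfolding case_prod_beta by (rule sum.swap)
  also have "\<dots> = (\<Sum>(a, b)\<in>?P. if ?M (?t a b) then f a * g b else 0)"
    by (intro sum.cong refl) (auto simp: tensor_planar simp del: diag_block_mat.simps)
  also have "\<dots> = (\<Sum>(a, b)\<in>?P. (if match a r c then f a else 0) * (if match b [k] [l] then g b else 0))"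
    using match_tensor[OF _ _ w] by (intro sum.cong refl) (auto simp del: diag_block_mat.simps)
  also have "\<dots> = Phi n m f r c * Phi n 1 g [k] [l]"
    unfolding Phi_def sum_product sum.cartesian_product ..
  finally show ?thesis .
qed

lemma I_mat_planar: "i \<le> n \<Longrightarrow> I_mat i \<in> planar_rook n 1"
  unfolding planar_rook_1_iff by (auto simp: I_mat_def)

text \<open>The letter 0 passes through every \<open>I_mat i\<close>, a nonzero letter only through
  its own. So \<open>I_0\<close> is the diagonal unit at 0, and \<open>I_i - I_0\<close> is the one
  at \<open>i\<close> for \<open>i \<ge> 1\<close>.\<close>

lemma match_I_mat: "match (I_mat i) [k] [l] \<longleftrightarrow> k = l \<and> (k = 0 \<or> k = i)"
  unfolding match_def by (auto simp: I_mat_def)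

lemma Phi_I_mat: "i \<le> n \<Longrightarrow> Phi n 1 (basis (I_mat i)) [k] [l] = (if k = l \<and> (k = 0 \<or> k = i) then 1 else 0)"
  unfolding Phi_basis[OF I_mat_planar] match_I_mat ..

text \<open>The sum of the \<open>I_mat i\<close> counts each nonzero letter once but the letter 0
  \<open>n\<close> times; subtracting \<open>n - 1\<close> copies of \<open>I_mat 0\<close> corrects
  this.\<close>

lemma Phi_e1:
  assumes "k \<le> n" "l \<le> n"
  shows "Phi n 1 (e1 n) [k] [l] = (if k = l then 1 else 0)"
proof -
  have "Phi n 1 (e1 n) [k] [l] = (\<Sum>i\<in>{1..n}. Phi n 1 (basis (I_mat i)) [k] [l])
      - (of_nat n - 1) * Phi n 1 (basis (I_mat 0)) [k] [l]"
    unfolding e1_def Phi_diff Phi_cscale Phi_sum ..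
  also have "(\<Sum>i\<in>{1..n}. Phi n 1 (basis (I_mat i)) [k] [l]) =
      (\<Sum>i\<in>{1..n}. if k = l \<and> (k = 0 \<or> k = i) then 1 else 0)"
    by (intro sum.cong refl Phi_I_mat) auto
  also have "Phi n 1 (basis (I_mat 0)) [k] [l] = (if k = l \<and> k = 0 then 1 else 0)"
    using Phi_I_mat[of 0 n k l] by auto
  finally show ?thesis using assms by (cases "k = 0"; cases "k = l") auto
qed

lemma words_0: "words n 0 = {[]}"
  by (auto simp: words_def)

lemma CP_one [simp]: "alg_one n m \<in> carrier (CP n m)"
proof (cases m)
  case 0
  have "mat 0 0 (\<lambda>_. 0) \<in> planar_rook n 0" by (simp add: planar_rook_iff)
  then show ?thesis using 0 by simp
next
  case (Suc k)
  then show ?thesis by (metis CP_tensor alg_one.simps(2))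
qed

lemma Phi_one:
  "r \<in> words n m \<Longrightarrow> c \<in> words n m \<Longrightarrow> Phi n m (alg_one n m) r c = (if r = c then 1 else 0)"
proof (induction m arbitrary: r c)
  case 0
  have "mat 0 0 (\<lambda>_. 0) \<in> planar_rook n 0" by (simp add: planar_rook_iff)
  then show ?case using 0 by (simp add: words_0 Phi_basis match_def)
next
  case (Suc m)
  obtain r' k where r: "r = r' @ [k]" "r' \<in> words n m" "k \<le> n" using words_SucE[OF Suc.prems(1)] .
  obtain c' l where c: "c = c' @ [l]" "c' \<in> words n m" "l \<le> n" using words_SucE[OF Suc.prems(2)] .
  show ?case
    unfolding alg_one.simps r(1) c(1) Phi_tensor[OF r(2) c(2)] Suc.IH[OF r(2) c(2)] Phi_e1[OF r(3) c(3)]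
    by simp
qed

lemma CP_\<psi> [simp]: "\<psi> n i (Suc m) f \<in> carrier (CP n (Suc m))"
  unfolding \<psi>_def diff_Suc_1 by (rule CP_tensor)

lemma Phi_\<psi>:
  assumes i: "i \<le> n" and w: "r \<in> words n m" "c \<in> words n m"
  shows "Phi n (Suc m) (\<psi> n i (Suc m) f) (r @ [k]) (c @ [l]) = (if k = i \<and> l = i then Phi n m f r c else 0)"
proof -
  have "Phi n 1 (if i = 0 then basis (I_mat 0) else basis (I_mat i) - basis (I_mat 0)) [k] [l]
      = (if k = i \<and> l = i then 1 else 0)"
    using Phi_I_mat[OF i, of k l] Phi_I_mat[of 0 n k l] by (auto simp: Phi_diff)
  then show ?thesis unfolding \<psi>_def diff_Suc_1 Phi_tensor[OF w] by simp
qed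

section \<open>Algebra laws read off from matrix entries\<close>

lemma alg_mult_assoc: "alg_mult n m (alg_mult n m f g) h = alg_mult n m f (alg_mult n m g h)"
proof (rule Phi_eqI)
  fix r c assume w: "r \<in> words n m" "c \<in> words n m"
  have "Phi n m (alg_mult n m (alg_mult n m f g) h) r c =
      (\<Sum>s\<in>words n m. \<Sum>t\<in>words n m. Phi n m f r t * Phi n m g t s * Phi n m h s c)"
    by (simp add: Phi_mult w sum_distrib_right cong: sum.cong)
  also have "\<dots> = (\<Sum>t\<in>words n m. \<Sum>s\<in>words n m. Phi n m f r t * Phi n m g t s * Phi n m h s c)"
    by (rule sum.swap)
  also have "\<dots> = Phi n m (alg_mult n m f (alg_mult n m g h)) r c"
    by (simp add: Phi_mult w sum_distrib_left mult.assoc cong: sum.cong)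
  finally show "Phi n m (alg_mult n m (alg_mult n m f g) h) r c = Phi n m (alg_mult n m f (alg_mult n m g h)) r c" .
qed simp_all

lemma alg_mult_distrib_right: "alg_mult n m (f + g) h = alg_mult n m f h + alg_mult n m g h"
  by (rule Phi_eqI[of _ n m]; simp add: Phi_mult Phi_add sum.distrib algebra_simps)

lemma alg_mult_distrib_left: "alg_mult n m h (f + g) = alg_mult n m h f + alg_mult n m h g"
  by (rule Phi_eqI[of _ n m]; simp add: Phi_mult Phi_add sum.distrib algebra_simps)

lemma alg_mult_cscale_left: "alg_mult n m (cscale a f) g = cscale a (alg_mult n m f g)"
  by (rule Phi_eqI[of _ n m]; simp add: Phi_mult Phi_cscale sum_distrib_left mult.assoc)

lemma alg_mult_zero_left [simp]: "alg_mult n m 0 f = 0"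
  by (rule Phi_eqI[of _ n m]; simp add: Phi_mult)

lemma alg_mult_zero_right [simp]: "alg_mult n m f 0 = 0"
  by (rule Phi_eqI[of _ n m]; simp add: Phi_mult)

lemma alg_one_mult [simp]: "f \<in> carrier (CP n m) \<Longrightarrow> alg_mult n m (alg_one n m) f = f"
  by (rule Phi_eqI[of _ n m]; simp add: Phi_mult Phi_one if_distrib[of "\<lambda>x. x * _"] if_distrib[of "\<lambda>x. _ * x"] cong: if_cong sum.cong)

lemma alg_mult_one [simp]: "f \<in> carrier (CP n m) \<Longrightarrow> alg_mult n m f (alg_one n m) = f"
  by (rule Phi_eqI[of _ n m]; simp add: Phi_mult Phi_one if_distrib[of "\<lambda>x. x * _"] if_distrib[of "\<lambda>x. _ * x"] cong: if_cong sum.cong)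

lemma ring_CP: "ring (CP n m)"
proof (rule ringI)
  show "abelian_group (CP n m)"
  proof (rule abelian_groupI)
    fix x assume "x \<in> carrier (CP n m)"
    then show "\<exists>y\<in>carrier (CP n m). y \<oplus>\<^bsub>CP n m\<^esub> x = \<zero>\<^bsub>CP n m\<^esub>"
      by (intro bexI[of _ "- x"]) simp_all
  qed (simp_all add: algebra_simps)
  show "monoid (CP n m)"
    by (rule monoidI) (simp_all add: alg_mult_assoc)
qed (simp_all add: alg_mult_distrib_right alg_mult_distrib_left)

lemma \<psi>_add: "i \<le> n \<Longrightarrow> \<psi> n i (Suc m) (f + g) = \<psi> n i (Suc m) f + \<psi> n i (Suc m) g"
  and \<psi>_mult: "i \<le> n \<Longrightarrow>
    \<psi> n i (Suc m) (alg_mult n m f g) = alg_mult n (Suc m) (\<psi> n i (Suc m) f) (\<psi> n i (Suc m) g)"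
proof -
  assume i: "i \<le> n"
  have eqI: "F = G" if H: "F \<in> carrier (CP n (Suc m))" "G \<in> carrier (CP n (Suc m))"
    and *: "\<And>r k c l. \<lbrakk>r \<in> words n m; k \<le> n; c \<in> words n m; l \<le> n\<rbrakk> \<Longrightarrow>
      Phi n (Suc m) F (r @ [k]) (c @ [l]) = Phi n (Suc m) G (r @ [k]) (c @ [l])" for F G
  proof (rule Phi_eqI[OF H])
    fix r1 c1 assume w1: "r1 \<in> words n (Suc m)" "c1 \<in> words n (Suc m)"
    obtain r' k where r: "r1 = r' @ [k]" "r' \<in> words n m" "k \<le> n" using words_SucE[OF w1(1)] .
    obtain c' l where c: "c1 = c' @ [l]" "c' \<in> words n m" "l \<le> n" using words_SucE[OF w1(2)] .
    show "Phi n (Suc m) F r1 c1 = Phi n (Suc m) G r1 c1"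
      unfolding r(1) c(1) by (rule *[OF r(2,3) c(2,3)])
  qed
  show "\<psi> n i (Suc m) (f + g) = \<psi> n i (Suc m) f + \<psi> n i (Suc m) g"
    by (rule eqI) (simp_all add: Phi_\<psi> i Phi_add)
  \<comment> \<open>Splits the middle word into an initial part and a last letter; only the last
    letter \<open>i\<close> contributes to a product of two images of \<open>\<psi>\<close>.\<close>
  have snoc_sum: "(\<Sum>s\<in>words n (Suc m). F s) = (\<Sum>(s, j)\<in>words n m \<times> {..n}. F (s @ [j]))" for F :: "nat list \<Rightarrow> complex"
  proof -
    have "bij_betw (\<lambda>(s, j). s @ [j]) (words n m \<times> {..n}) (words n (Suc m))"
      unfolding bij_betw_def
    proof
      show "inj_on (\<lambda>(s, j). s @ [j]) (words n m \<times> {..n})" by (auto simp: inj_on_def)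
      have "w \<in> (\<lambda>(s, j). s @ [j]) ` (words n m \<times> {..n})" if "w \<in> words n (Suc m)" for w
        by (rule words_SucE[OF that]) auto
      then show "(\<lambda>(s, j). s @ [j]) ` (words n m \<times> {..n}) = words n (Suc m)" by auto
    qed
    from sum.reindex_bij_betw[OF this, of F] show ?thesis by (simp add: case_prod_beta)
  qed
  show "\<psi> n i (Suc m) (alg_mult n m f g) = alg_mult n (Suc m) (\<psi> n i (Suc m) f) (\<psi> n i (Suc m) g)"
  proof (rule eqI)
    fix r k c l assume w: "r \<in> words n m" "k \<le> n" "c \<in> words n m" "l \<le> n"
    have "Phi n (Suc m) (alg_mult n (Suc m) (\<psi> n i (Suc m) f) (\<psi> n i (Suc m) g)) (r @ [k]) (c @ [l]) =
        (\<Sum>(s, j)\<in>words n m \<times> {..n}. if j = i then (if k = i \<and> l = i then Phi n m f r s * Phi n m g s c else 0) else 0)"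
      using w i by (subst Phi_mult) (auto simp: snoc_sum Phi_\<psi> intro!: sum.cong)
    also have "\<dots> = (\<Sum>s\<in>words n m. if k = i \<and> l = i then Phi n m f r s * Phi n m g s c else 0)"
      using i by (simp add: sum.cartesian_product[symmetric])
    also have "\<dots> = Phi n (Suc m) (\<psi> n i (Suc m) (alg_mult n m f g)) (r @ [k]) (c @ [l])"
      using w i by (cases "k = i \<and> l = i") (auto simp: Phi_\<psi> Phi_mult)
    finally show "Phi n (Suc m) (\<psi> n i (Suc m) (alg_mult n m f g)) (r @ [k]) (c @ [l]) =
       Phi n (Suc m) (alg_mult n (Suc m) (\<psi> n i (Suc m) f) (\<psi> n i (Suc m) g)) (r @ [k]) (c @ [l])" ..
  qed simp_all
qed

section \<open>Products with matrix units\<close>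

lemma \<psi>_mat_unit:
  assumes i: "i \<le> n" and w: "r \<in> words n m" "c \<in> words n m" and eq: "mset r = mset c"
  shows "\<psi> n i (Suc m) (mat_unit r c) = mat_unit (r @ [i]) (c @ [i])"
proof (rule Phi_eqI)
  show "mat_unit (r @ [i]) (c @ [i]) \<in> carrier (CP n (Suc m))" using i w by (intro CP_mat_unit) simp_all
  fix r1 c1 assume w1: "r1 \<in> words n (Suc m)" "c1 \<in> words n (Suc m)"
  obtain r' k where r: "r1 = r' @ [k]" "r' \<in> words n m" "k \<le> n" using words_SucE[OF w1(1)] .
  obtain c' l where c: "c1 = c' @ [l]" "c' \<in> words n m" "l \<le> n" using words_SucE[OF w1(2)] .
  have "Phi n (Suc m) (mat_unit (r @ [i]) (c @ [i])) r1 c1 = (if r1 = r @ [i] \<and> c1 = c @ [i] then 1 else 0)"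
    using i w eq w1 by (intro Phi_mat_unit) simp_all
  then show "Phi n (Suc m) (\<psi> n i (Suc m) (mat_unit r c)) r1 c1 = Phi n (Suc m) (mat_unit (r @ [i]) (c @ [i])) r1 c1"
    unfolding r(1) c(1) Phi_\<psi>[OF i r(2) c(2)] Phi_mat_unit[OF w eq r(2) c(2)] by simp
qed simp

lemma mat_unit_mult:
  assumes w: "r \<in> words n m" "c \<in> words n m" "r' \<in> words n m" "c' \<in> words n m"
    and eq: "mset r = mset c" "mset r' = mset c'"
  shows "alg_mult n m (mat_unit r c) (mat_unit r' c') = (if c = r' then mat_unit r c' else 0)"
proof (rule Phi_eqI)
  show "(if c = r' then mat_unit r c' else 0) \<in> carrier (CP n m)" using w by simp
  fix r1 c1 assume w1: "r1 \<in> words n m" "c1 \<in> words n m"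
  have "Phi n m (alg_mult n m (mat_unit r c) (mat_unit r' c')) r1 c1 =
      (\<Sum>s\<in>words n m. if s = c then (if r1 = r \<and> c = r' \<and> c1 = c' then 1 else 0) else 0)"
    unfolding Phi_mult[OF w1] using w w1 eq by (intro sum.cong refl) (auto simp: Phi_mat_unit)
  then show "Phi n m (alg_mult n m (mat_unit r c) (mat_unit r' c')) r1 c1 = Phi n m (if c = r' then mat_unit r c' else 0) r1 c1"
    using w w1 eq by (simp add: Phi_mat_unit)
qed simp

lemma mult_mat_unit:
  assumes f: "f \<in> carrier (CP n m)" and w: "r \<in> words n m" "c \<in> words n m" and eq: "mset r = mset c"
  shows "alg_mult n m f (mat_unit r c) = (\<Sum>s\<in>{s \<in> words n m. mset s = mset c}. cscale (Phi n m f s r) (mat_unit s c))"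
    (is "_ = ?R")
proof (rule Phi_eqI)
  show "?R \<in> carrier (CP n m)" using w by auto
  fix r1 c1 assume w1: "r1 \<in> words n m" "c1 \<in> words n m" "mset r1 = mset c1"
  have "Phi n m (alg_mult n m f (mat_unit r c)) r1 c1 = (\<Sum>s\<in>words n m. if s = r then (if c1 = c then Phi n m f r1 r else 0) else 0)"
    unfolding Phi_mult[OF w1(1,2)] using w w1 eq by (intro sum.cong refl) (auto simp: Phi_mat_unit)
  also have "\<dots> = (if c1 = c then Phi n m f r1 r else 0)" using w by simp
  also have "\<dots> = (\<Sum>s\<in>{s \<in> words n m. mset s = mset c}. if s = r1 then (if c1 = c then Phi n m f r1 r else 0) else 0)"
    using w1 by simp
  also have "\<dots> = Phi n m ?R r1 c1"
    unfolding Phi_sum Phi_cscale using w w1 by (intro sum.cong refl) (auto simp: Phi_mat_unit)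
  finally show "Phi n m (alg_mult n m f (mat_unit r c)) r1 c1 = Phi n m ?R r1 c1" .
qed simp

text \<open>The identity as a sum of orthogonal idempotents: on a nonzero vector one of them acts
  nontrivially, which is how words enter an abstract module.\<close>

lemma alg_one_eq_sum_mat_unit: "alg_one n m = (\<Sum>w\<in>words n m. mat_unit w w)"
proof (rule Phi_eqI)
  show "(\<Sum>w\<in>words n m. mat_unit w w) \<in> carrier (CP n m)" by auto
  fix r c assume w: "r \<in> words n m" "c \<in> words n m"
  have "Phi n m (\<Sum>w\<in>words n m. mat_unit w w) r c = (\<Sum>w\<in>words n m. if w = r then (if r = c then 1 else 0) else 0)"
    unfolding Phi_sum using w by (intro sum.cong refl) (auto simp: Phi_mat_unit)
  then show "Phi n m (alg_one n m) r c = Phi n m (\<Sum>w\<in>words n m. mat_unit w w) r c"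
    using w by (simp add: Phi_one)
qed simp

lemma Phi_mult_mat_unit_right:
  assumes w: "r0 \<in> words n m" "c0 \<in> words n m" "mset r0 = mset c0" and rc: "r \<in> words n m" "c \<in> words n m"
  shows "Phi n m (alg_mult n m f (mat_unit r0 c0)) r c = (if c = c0 then Phi n m f r r0 else 0)"
proof -
  have "Phi n m (alg_mult n m f (mat_unit r0 c0)) r c =
      (\<Sum>s\<in>words n m. if s = r0 then (if c = c0 then Phi n m f r r0 else 0) else 0)"
    unfolding Phi_mult[OF rc] using w rc by (intro sum.cong refl) (auto simp: Phi_mat_unit)
  then show ?thesis using w by simp
qed

lemma Phi_mult_mat_unit_left:
  assumes w: "r0 \<in> words n m" "c0 \<in> words n m" "mset r0 = mset c0" and rc: "r \<in> words n m" "c \<in> words n m"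
  shows "Phi n m (alg_mult n m (mat_unit r0 c0) f) r c = (if r = r0 then Phi n m f c0 c else 0)"
proof -
  have "Phi n m (alg_mult n m (mat_unit r0 c0) f) r c =
      (\<Sum>s\<in>words n m. if s = c0 then (if r = r0 then Phi n m f c0 c else 0) else 0)"
    unfolding Phi_mult[OF rc] using w rc by (intro sum.cong refl) (auto simp: Phi_mat_unit)
  then show ?thesis using w by simp
qed

text \<open>Cuts out a single entry of \<open>f\<close>, which can be inverted when it is
  nonzero.\<close>

lemma mat_unit_corner:
  assumes w: "w \<in> words n m" "s \<in> words n m" "mset s = mset w"
  shows "alg_mult n m (mat_unit w s) (alg_mult n m f (mat_unit w w)) = cscale (Phi n m f s w) (mat_unit w w)"
  by (rule Phi_eqI[of _ n m]) (use w in \<open>auto simp: Phi_mult_mat_unit_left Phi_mult_mat_unit_right Phi_cscale Phi_mat_unit\<close>)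

section \<open>Modules\<close>

locale CP_module =
  fixes n m :: nat and M :: "(rook_alg, 'v) module" (structure)
  assumes lm: "left_module (CP n m) M"
begin

sublocale L: left_module "CP n m" M by (rule lm)

lemma closed [simp]: "\<lbrakk>a \<in> carrier (CP n m); v \<in> carrier M\<rbrakk> \<Longrightarrow> a \<odot> v \<in> carrier M"
  by (rule L.smult_closed)

lemma add_left: "\<lbrakk>a \<in> carrier (CP n m); b \<in> carrier (CP n m); v \<in> carrier M\<rbrakk> \<Longrightarrow> (a + b) \<odot> v = a \<odot> v \<oplus> b \<odot> v"
  using L.smult_l_distr by simp

lemma mult: "\<lbrakk>a \<in> carrier (CP n m); b \<in> carrier (CP n m); v \<in> carrier M\<rbrakk> \<Longrightarrow> a \<odot> (b \<odot> v) = alg_mult n m a b \<odot> v"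
  using L.smult_assoc by simp

lemma one [simp]: "v \<in> carrier M \<Longrightarrow> alg_one n m \<odot> v = v"
  using L.smult_one by simp

lemma zero_left [simp]: "v \<in> carrier M \<Longrightarrow> 0 \<odot> v = \<zero>"
proof -
  assume v: "v \<in> carrier M"
  have "0 \<odot> v \<oplus> 0 \<odot> v = 0 \<odot> v" using add_left[of 0 0 v] v by simp
  then show ?thesis using v closed[of 0 v] by (metis CP_zero L.M.add.r_cancel_one)
qed

lemma zero_right [simp]: "a \<in> carrier (CP n m) \<Longrightarrow> a \<odot> \<zero> = \<zero>"
  using mult[of a 0 "\<zero>"] by simp

lemma sum_left_zero:
  assumes "\<And>x. x \<in> S \<Longrightarrow> f x \<in> carrier (CP n m)" "\<And>x. x \<in> S \<Longrightarrow> f x \<odot> v = \<zero>" "v \<in> carrier M"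
  shows "sum f S \<odot> v = \<zero>"
  using assms
proof (induction S rule: infinite_finite_induct)
  case (insert x F)
  have "sum f F \<in> carrier (CP n m)" using insert.prems by (intro CP_sum) auto
  then have "(f x + sum f F) \<odot> v = \<zero>" using insert add_left by simp
  then show ?case unfolding sum.insert[OF insert.hyps] .
qed simp_all

end

text \<open>These data make sense over any element type, so they also apply to the cosets of an
  induced module, and they determine the module up to isomorphism. The condition that
  \<open>mat_unit w w\<close> fixes \<open>v\<close> ties the generator to a word.\<close>

definition cyclic :: "nat \<Rightarrow> nat \<Rightarrow> (rook_alg, 'v) module \<Rightarrow> nat list \<Rightarrow> 'v \<Rightarrow> bool" where
  "cyclic n m M w v \<longleftrightarrow> w \<in> words n m \<and> v \<in> carrier M \<and> v \<noteq> \<zero>\<^bsub>M\<^esub> \<and> mat_unit w w \<odot>\<^bsub>M\<^esub> v = v \<and>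
     (\<forall>x\<in>carrier M. \<exists>a\<in>carrier (CP n m). x = a \<odot>\<^bsub>M\<^esub> v)"

lemma cyclicD:
  assumes "cyclic n m M w v"
  shows "w \<in> words n m" "v \<in> carrier M" "v \<noteq> \<zero>\<^bsub>M\<^esub>" "mat_unit w w \<odot>\<^bsub>M\<^esub> v = v"
    and "x \<in> carrier M \<Longrightarrow> \<exists>a\<in>carrier (CP n m). x = a \<odot>\<^bsub>M\<^esub> v"
  using assms unfolding cyclic_def by blast+

context CP_module
begin

text \<open>\<open>mat_unit w w'\<close> brings the new vector back to \<open>v\<close>, so it is
  nonzero and generates.\<close>

lemma cyclic_change_word:
  assumes cyc: "cyclic n m M w v" and w': "w' \<in> words n m" "mset w' = mset w"
  shows "cyclic n m M w' (mat_unit w' w \<odot> v)"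
proof -
  note c = cyclicD[OF cyc]
  have recov: "mat_unit w w' \<odot> (mat_unit w' w \<odot> v) = v" using c w' by (simp add: mult mat_unit_mult)
  show ?thesis
    unfolding cyclic_def
  proof (intro conjI ballI)
    show "mat_unit w' w \<odot> v \<noteq> \<zero>" using recov c w' by (metis CP_mat_unit zero_right)
    show "mat_unit w' w' \<odot> (mat_unit w' w \<odot> v) = mat_unit w' w \<odot> v" using c w' by (simp add: mult mat_unit_mult)
    fix x assume "x \<in> carrier M"
    then obtain a where a: "a \<in> carrier (CP n m)" "x = a \<odot> v" using c(5) by blast
    have "x = alg_mult n m a (mat_unit w w') \<odot> (mat_unit w' w \<odot> v)"
      using a c w' recov by (metis CP_mat_unit closed mult)
    then show "\<exists>a\<in>carrier (CP n m). x = a \<odot> (mat_unit w' w \<odot> v)" by (rule bexI[of _ "alg_mult n m a (mat_unit w w')"]) (rule CP_mult)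
  qed (use c w' in auto)
qed

text \<open>\<open>a\<close> has a nonzero entry at some \<open>(s, w)\<close>, and a suitable
  multiple of \<open>mat_unit w s\<close> moves it to the diagonal. This serves both for
  irreducibility and for the injectivity of \<open>a \<mapsto> a v\<close> on a left ideal.\<close>

lemma cyclic_recover:
  assumes cyc: "cyclic n m M w v" and a: "a \<in> carrier (CP n m)" "alg_mult n m a (mat_unit w w) \<noteq> 0"
  shows "\<exists>b\<in>carrier (CP n m). b \<odot> (a \<odot> v) = v"
proof -
  note c = cyclicD[OF cyc]
  have "\<exists>s\<in>words n m. mset s = mset w \<and> Phi n m a s w \<noteq> 0"
  proof (rule ccontr)
    assume "\<not> ?thesis"
    then have "alg_mult n m a (mat_unit w w) = 0"
      unfolding mult_mat_unit[OF a(1) c(1) c(1) refl] by (intro sum.neutral) (auto simp: cscale_def fun_eq_iff)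
    then show False using a(2) by simp
  qed
  then obtain s where s: "s \<in> words n m" "mset s = mset w" "Phi n m a s w \<noteq> 0" by blast
  let ?b = "cscale (inverse (Phi n m a s w)) (mat_unit w s)"
  have av: "a \<odot> v = alg_mult n m a (mat_unit w w) \<odot> v" using c a by (metis CP_mat_unit mult)
  have "?b \<odot> (a \<odot> v) = alg_mult n m ?b (alg_mult n m a (mat_unit w w)) \<odot> v"
    unfolding av using c s by (intro mult) simp_all
  also have "alg_mult n m ?b (alg_mult n m a (mat_unit w w)) = mat_unit w w"
    unfolding alg_mult_cscale_left mat_unit_corner[OF c(1) s(1,2)]
    using s(3) by (simp add: cscale_def flip: mult.assoc)
  finally have "?b \<odot> (a \<odot> v) = v" using c(4) by simp
  moreover have "?b \<in> carrier (CP n m)" using c s by simp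
  ultimately show ?thesis by blast
qed

lemma cyclic_irreducible:
  assumes cyc: "cyclic n m M w v"
  shows "irreducible_module (CP n m) M"
  unfolding irreducible_module_def
proof (intro conjI allI impI)
  note c = cyclicD[OF cyc]
  show "left_module (CP n m) M" by (rule lm)
  show "carrier M \<noteq> {\<zero>}" using c by blast
  fix N assume N: "submodule N (CP n m) M"
  interpret N: submodule N "CP n m" M by (rule N)
  show "N = {\<zero>} \<or> N = carrier M"
  proof (cases "N = {\<zero>}")
    case False
    have z: "\<zero> \<in> N" using N.one_closed by simp
    have sub: "N \<subseteq> carrier M" using N.subset by simp
    obtain x where x: "x \<in> N" "x \<noteq> \<zero>" using False z by blast
    then obtain a where a: "a \<in> carrier (CP n m)" "x = a \<odot> v" using c(5) sub by blast
    have "x = alg_mult n m a (mat_unit w w) \<odot> v" using a c by (metis CP_mat_unit mult)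
    then have "alg_mult n m a (mat_unit w w) \<noteq> 0" using x c by auto
    then obtain b where "b \<in> carrier (CP n m)" "b \<odot> x = v" using cyclic_recover[OF cyc a(1)] a by blast
    then have "v \<in> N" using N.smult_closed[OF _ x(1)] by metis
    then have "carrier M \<subseteq> N" using c(5) N.smult_closed by blast
    then show ?thesis using sub by blast
  qed simp
qed

text \<open>Some diagonal matrix unit does not annihilate a given nonzero vector; the image
  generates a nonzero submodule, hence everything.\<close>

lemma irreducible_cyclic:
  assumes irr: "irreducible_module (CP n m) M"
  obtains w v where "cyclic n m M w v"
proof -
  have "carrier M \<noteq> {\<zero>}" using irr by (simp add: irreducible_module_def)
  then obtain v0 where v0: "v0 \<in> carrier M" "v0 \<noteq> \<zero>" using L.M.zero_closed by blast
  have "\<exists>w\<in>words n m. mat_unit w w \<odot> v0 \<noteq> \<zero>"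
  proof (rule ccontr)
    assume "\<not> ?thesis"
    then have "alg_one n m \<odot> v0 = \<zero>"
      unfolding alg_one_eq_sum_mat_unit using v0 by (intro sum_left_zero) auto
    then show False using v0 by simp
  qed
  then obtain w where w: "w \<in> words n m" "mat_unit w w \<odot> v0 \<noteq> \<zero>" by blast
  let ?v = "mat_unit w w \<odot> v0"
  let ?N = "(\<lambda>a. a \<odot> ?v) ` carrier (CP n m)"
  have v: "?v \<in> carrier M" using w v0 by simp
  have "submodule ?N (CP n m) M"
  proof
    show "?N \<subseteq> carrier (add_monoid M)" using v by auto
    show "\<one>\<^bsub>add_monoid M\<^esub> \<in> ?N" using v by (auto intro!: image_eqI[of _ _ 0])
    fix x assume "x \<in> ?N"
    then obtain a where a: "a \<in> carrier (CP n m)" "x = a \<odot> ?v" by blast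
    have xm: "x \<in> carrier M" using a v by simp
    have mm: "(- a) \<odot> ?v \<in> carrier M" using a v by simp
    have "x \<oplus> (- a) \<odot> ?v = \<zero>" using add_left[of a "- a" ?v] a v by simp
    then have "(- a) \<odot> ?v \<oplus> x = \<zero>" using xm mm L.M.a_comm by metis
    then have "inv\<^bsub>add_monoid M\<^esub> x = (- a) \<odot> ?v"
      using L.M.minus_equality[OF _ xm mm] by (simp add: a_inv_def)
    then show "inv\<^bsub>add_monoid M\<^esub> x \<in> ?N" using a by simp
    fix y assume "y \<in> ?N"
    then obtain b where b: "b \<in> carrier (CP n m)" "y = b \<odot> ?v" by blast
    have "x \<oplus> y = (a + b) \<odot> ?v" using a b v by (simp add: add_left)
    then show "x \<otimes>\<^bsub>add_monoid M\<^esub> y \<in> ?N" using a b by simp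
  next
    fix b x assume b: "b \<in> carrier (CP n m)" and "x \<in> ?N"
    then obtain a where a: "a \<in> carrier (CP n m)" "x = a \<odot> ?v" by blast
    then show "b \<odot> x \<in> ?N" using mult[OF b a(1) v] by simp
  qed
  then have "?N = {\<zero>} \<or> ?N = carrier M" using irr by (simp add: irreducible_module_def)
  moreover have "?v \<in> ?N" using v by (intro image_eqI[of _ _ "alg_one n m"]) simp_all
  ultimately have "?N = carrier M" using w by blast
  moreover have "mat_unit w w \<odot> ?v = ?v" using w v0 by (simp add: mult mat_unit_mult)
  ultimately have "cyclic n m M w ?v" unfolding cyclic_def using w v by blast
  then show thesis by (rule that)
qed

text \<open>\<open>Phi a\<close> vanishes between words of different multiplicities, so the product
  of \<open>mat_unit w' w'\<close>, \<open>a\<close> and \<open>mat_unit w w\<close> is 0. This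
  invariant separates the isomorphism classes.\<close>

lemma cyclic_other_word:
  assumes cyc: "cyclic n m M w v" and w': "w' \<in> words n m" "mset w' \<noteq> mset w" and x: "x \<in> carrier M"
  shows "mat_unit w' w' \<odot> x = \<zero>"
proof -
  note c = cyclicD[OF cyc]
  obtain a where a: "a \<in> carrier (CP n m)" "x = a \<odot> v" using c(5) x by blast
  have "mat_unit w' w' \<odot> x = mat_unit w' w' \<odot> (a \<odot> (mat_unit w w \<odot> v))" using a c(4) by simp
  also have "a \<odot> (mat_unit w w \<odot> v) = alg_mult n m a (mat_unit w w) \<odot> v" using a c by (intro mult) simp_all
  also have "mat_unit w' w' \<odot> \<dots> = alg_mult n m (mat_unit w' w') (alg_mult n m a (mat_unit w w)) \<odot> v"
    using a c w' by (intro mult) simp_all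
  also have "alg_mult n m (mat_unit w' w') (alg_mult n m a (mat_unit w w)) = 0"
    by (rule Phi_eqI[of _ n m]) (use c w' Phi_mset[OF w'(1) c(1) w'(2)] in \<open>auto simp: Phi_mult_mat_unit_left Phi_mult_mat_unit_right\<close>)
  finally show ?thesis using zero_left[OF c(2)] by (rule trans)
qed

end

section \<open>Isomorphisms and the transport of generators\<close>

definition module_iso_map :: "('a, 'b) ring_scheme \<Rightarrow> ('a, 'v) module \<Rightarrow> ('a, 'w) module \<Rightarrow> ('v \<Rightarrow> 'w) \<Rightarrow> bool" where
  "module_iso_map R M N h \<longleftrightarrow> bij_betw h (carrier M) (carrier N) \<and>
     (\<forall>v\<in>carrier M. \<forall>w\<in>carrier M. h (v \<oplus>\<^bsub>M\<^esub> w) = h v \<oplus>\<^bsub>N\<^esub> h w) \<and>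
     (\<forall>a\<in>carrier R. \<forall>v\<in>carrier M. h (a \<odot>\<^bsub>M\<^esub> v) = a \<odot>\<^bsub>N\<^esub> h v)"

lemma module_iso_iff: "module_iso R M N \<longleftrightarrow> (\<exists>h. module_iso_map R M N h)"
  by (simp add: module_iso_def module_iso_map_def)

lemma module_iso_mapD:
  assumes "module_iso_map R M N h"
  shows "bij_betw h (carrier M) (carrier N)"
    and "\<lbrakk>v \<in> carrier M; w \<in> carrier M\<rbrakk> \<Longrightarrow> h (v \<oplus>\<^bsub>M\<^esub> w) = h v \<oplus>\<^bsub>N\<^esub> h w"
    and "\<lbrakk>a \<in> carrier R; v \<in> carrier M\<rbrakk> \<Longrightarrow> h (a \<odot>\<^bsub>M\<^esub> v) = a \<odot>\<^bsub>N\<^esub> h v"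
    and "v \<in> carrier M \<Longrightarrow> h v \<in> carrier N"
  using assms by (auto simp: module_iso_map_def bij_betw_def)

lemma module_iso_refl: "module_iso R M M"
  unfolding module_iso_iff module_iso_map_def by (intro exI[of _ id]) simp

lemma module_iso_trans:
  assumes "module_iso R M N" "module_iso R N K"
  shows "module_iso R M K"
proof -
  from assms obtain h g where h: "module_iso_map R M N h" and g: "module_iso_map R N K g" unfolding module_iso_iff by blast
  note hD = module_iso_mapD[OF h] and gD = module_iso_mapD[OF g]
  have "module_iso_map R M K (g \<circ> h)"
    unfolding module_iso_map_def
    using hD(2-4) gD(2-4) bij_betw_trans[OF hD(1) gD(1)] by simp
  then show ?thesis unfolding module_iso_iff by blast
qed

lemma module_iso_sym:
  assumes lm: "left_module R M" and iso: "module_iso R M N"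
  shows "module_iso R N M"
proof -
  interpret left_module R M by (rule lm)
  from iso obtain h where h: "module_iso_map R M N h" unfolding module_iso_iff by blast
  note hD = module_iso_mapD[OF h]
  let ?g = "inv_into (carrier M) h"
  have g: "bij_betw ?g (carrier N) (carrier M)" by (rule bij_betw_inv_into[OF hD(1)])
  have inv: "?g (h v) = v" if "v \<in> carrier M" for v by (rule bij_betw_inv_into_left[OF hD(1) that])
  have ex: "\<exists>v\<in>carrier M. x = h v" if "x \<in> carrier N" for x using hD(1) that by (auto simp: bij_betw_def)
  have "module_iso_map R N M ?g"
    unfolding module_iso_map_def
  proof (intro conjI ballI g)
    fix x y assume "x \<in> carrier N" "y \<in> carrier N"
    then obtain v w where v: "v \<in> carrier M" "x = h v" and w: "w \<in> carrier M" "y = h w" using ex by blast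
    then have "x \<oplus>\<^bsub>N\<^esub> y = h (v \<oplus>\<^bsub>M\<^esub> w)" using hD(2) by simp
    then show "?g (x \<oplus>\<^bsub>N\<^esub> y) = ?g x \<oplus>\<^bsub>M\<^esub> ?g y" using v w inv by simp
  next
    fix a x assume a: "a \<in> carrier R" and "x \<in> carrier N"
    then obtain v where v: "v \<in> carrier M" "x = h v" using ex by blast
    then have "a \<odot>\<^bsub>N\<^esub> x = h (a \<odot>\<^bsub>M\<^esub> v)" using hD(3) a by simp
    then show "?g (a \<odot>\<^bsub>N\<^esub> x) = a \<odot>\<^bsub>M\<^esub> ?g x" using v a inv smult_closed by simp
  qed
  then show ?thesis unfolding module_iso_iff by blast
qed

lemma iso_class_eq:
  assumes "left_module (CP n m) M" "module_iso (CP n m) M N"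
  shows "iso_class n m N = iso_class n m M"
  unfolding iso_class_def
  using module_iso_trans[OF assms(2)] module_iso_trans[OF module_iso_sym[OF assms]] by blast

lemma module_iso_map_zero:
  assumes "left_module (CP n m) M" "left_module (CP n m) N" "module_iso_map (CP n m) M N h"
  shows "h \<zero>\<^bsub>M\<^esub> = \<zero>\<^bsub>N\<^esub>"
proof -
  interpret M: CP_module n m M using assms(1) by (rule CP_module.intro)
  interpret N: CP_module n m N using assms(2) by (rule CP_module.intro)
  note hD = module_iso_mapD[OF assms(3)]
  have "h (0 \<odot>\<^bsub>M\<^esub> \<zero>\<^bsub>M\<^esub>) = 0 \<odot>\<^bsub>N\<^esub> h \<zero>\<^bsub>M\<^esub>" by (rule hD(3)) simp_all
  then show ?thesis using hD(4)[of "\<zero>\<^bsub>M\<^esub>"] by simp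
qed

lemma cyclic_transfer:
  assumes lM: "left_module (CP n m) M" and lN: "left_module (CP n m) N" and h: "module_iso_map (CP n m) M N h"
    and cyc: "cyclic n m M w v"
  shows "cyclic n m N w (h v)"
proof -
  note hD = module_iso_mapD[OF h] and c = cyclicD[OF cyc]
  interpret M: CP_module n m M using lM by (rule CP_module.intro)
  show ?thesis
    unfolding cyclic_def
  proof (intro conjI ballI)
    show "h v \<noteq> \<zero>\<^bsub>N\<^esub>"
      using module_iso_map_zero[OF lM lN h] hD(1) c(2,3) M.L.M.zero_closed
      unfolding bij_betw_def inj_on_def by metis
    show "mat_unit w w \<odot>\<^bsub>N\<^esub> h v = h v" using hD(3)[of "mat_unit w w" v] c by simp
    fix x assume "x \<in> carrier N"
    then obtain y where y: "y \<in> carrier M" "x = h y" using hD(1) by (auto simp: bij_betw_def)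
    then obtain a where "a \<in> carrier (CP n m)" "y = a \<odot>\<^bsub>M\<^esub> v" using c(5) by blast
    then show "\<exists>a\<in>carrier (CP n m). x = a \<odot>\<^bsub>N\<^esub> h v" using y hD(3) c(2) by blast
  qed (use c hD in auto)
qed

lemma cyclic_iso_mset:
  assumes lM: "left_module (CP n m) M" and lN: "left_module (CP n m) N" and iso: "module_iso (CP n m) M N"
    and cM: "cyclic n m M w v" and cN: "cyclic n m N w' v'"
  shows "mset w' = mset w"
proof (rule ccontr)
  assume ne: "mset w' \<noteq> mset w"
  from iso obtain h where h: "module_iso_map (CP n m) M N h" unfolding module_iso_iff by blast
  interpret N: CP_module n m N using lN by (rule CP_module.intro)
  have "mat_unit w' w' \<odot>\<^bsub>N\<^esub> v' = \<zero>\<^bsub>N\<^esub>"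
    using N.cyclic_other_word[OF cyclic_transfer[OF lM lN h cM] _ ne] cyclicD[OF cN] by blast
  then show False using cyclicD[OF cN] by simp
qed

text \<open>The isomorphism is \<open>a \<mapsto> a v\<close> on the left ideal of
  \<open>mat_unit w w\<close>. \<open>N\<close> is given by its carrier and operations, so that any
  \<open>W\<close> with column word \<open>w\<close> fits.\<close>

lemma (in CP_module) cyclic_column_iso:
  assumes cyc: "cyclic n m M w v"
    and N: "carrier N = (\<lambda>a. alg_mult n m a (mat_unit w w)) ` carrier (CP n m)"
      "add N = (+)" "smult N = alg_mult n m"
  shows "module_iso (CP n m) N M"
proof -
  note c = cyclicD[OF cyc]
  have NE: "x \<in> carrier (CP n m) \<and> alg_mult n m x (mat_unit w w) = x" if "x \<in> carrier N" for x
    using that c unfolding N by (auto simp: alg_mult_assoc mat_unit_mult)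
  have EN: "alg_mult n m x (mat_unit w w) \<in> carrier N" if "x \<in> carrier (CP n m)" for x
    using that unfolding N by blast
  have "module_iso_map (CP n m) N M (\<lambda>a. a \<odot> v)"
    unfolding module_iso_map_def
  proof (intro conjI ballI)
    show "bij_betw (\<lambda>a. a \<odot> v) (carrier N) (carrier M)"
      unfolding bij_betw_def
    proof
      show "inj_on (\<lambda>a. a \<odot> v) (carrier N)"
      proof (rule inj_onI, rule ccontr)
        fix a b assume ab: "a \<in> carrier N" "b \<in> carrier N" "a \<odot> v = b \<odot> v" "a \<noteq> b"
        have d: "a - b \<in> carrier (CP n m)" using NE ab by simp
        have "alg_mult n m (a - b) (mat_unit w w) + alg_mult n m b (mat_unit w w) = alg_mult n m a (mat_unit w w)"
          by (simp add: alg_mult_distrib_right[symmetric])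
        \<comment> \<open>Elements of the ideal are fixed by \<open>mat_unit w w\<close> on the
          right, so the product is nonzero and \<open>cyclic_recover\<close> applies to
          \<open>a - b\<close>.\<close>
        then have "alg_mult n m (a - b) (mat_unit w w) = a - b" using NE ab by (simp add: eq_diff_eq)
        then obtain e where e: "e \<in> carrier (CP n m)" "e \<odot> ((a - b) \<odot> v) = v"
          using cyclic_recover[OF cyc d] ab(4) by auto
        have "(a - b) \<odot> v \<oplus> b \<odot> v = b \<odot> v"
          using add_left[OF d, of b v] NE ab c(2) by simp
        then have "(a - b) \<odot> v = \<zero>"
          using d NE[OF ab(2)] c(2) by (metis L.M.add.r_cancel_one closed)
        then show False using e c by simp
      qed
      show "(\<lambda>a. a \<odot> v) ` carrier N = carrier M"
      proof
        show "(\<lambda>a. a \<odot> v) ` carrier N \<subseteq> carrier M" using NE c by auto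
        show "carrier M \<subseteq> (\<lambda>a. a \<odot> v) ` carrier N"
        proof
          fix x assume "x \<in> carrier M"
          then obtain a where a: "a \<in> carrier (CP n m)" "x = a \<odot> v" using c(5) by blast
          then have "x = alg_mult n m a (mat_unit w w) \<odot> v" using c by (metis CP_mat_unit mult)
          then show "x \<in> (\<lambda>a. a \<odot> v) ` carrier N" using EN[OF a(1)] by blast
        qed
      qed
    qed
    show "(a \<oplus>\<^bsub>N\<^esub> b) \<odot> v = a \<odot> v \<oplus> b \<odot> v" if "a \<in> carrier N" "b \<in> carrier N" for a b
      unfolding N using NE that c by (intro add_left) auto
    show "(a \<odot>\<^bsub>N\<^esub> b) \<odot> v = a \<odot> (b \<odot> v)" if "a \<in> carrier (CP n m)" "b \<in> carrier N" for a b
      unfolding N using NE that c by (intro mult[symmetric]) auto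
  qed
  then show ?thesis unfolding module_iso_iff by blast
qed

section \<open>The irreducible modules\<close>

lemma x_elt_column:
  assumes w: "w \<in> words n m" and T: "\<And>k. k \<le> n \<Longrightarrow> T k = {j. j < m \<and> w ! j = k}"
  shows "{x_elt d |d. d \<in> planar_rook n m \<and> (\<forall>k\<le>n. \<beta> d k = T k)} = (\<lambda>r. mat_unit r w) ` {r \<in> words n m. mset r = mset w}"
    (is "?L = ?R")
proof
  show "?L \<subseteq> ?R"
  proof clarify
    fix d assume d: "d \<in> planar_rook n m" and b: "\<forall>k\<le>n. \<beta> d k = T k"
    obtain r c where rc: "r \<in> words n m" "c \<in> words n m" "mset r = mset c" "d = word_mat r c"
      using planar_eq_word_mat[OF d] .
    have "c = w"
    proof (rule nth_equalityI)
      show "length c = length w" using rc w by (simp add: words_length)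
      fix j assume "j < length c"
      then have j: "j < m" using rc by (simp add: words_length)
      have "w ! j \<le> n" using words_nth[OF w j] .
      \<comment> \<open>Both sets collect the places of the letter found at the fixed place
        \<open>j\<close>, written \<open>j'\<close> beside the bound variable. The fixed
        \<open>j\<close> lies in the second set, hence in the first.\<close>
      then have "{j. j < m \<and> c ! j = w ! j'} = {j. j < m \<and> w ! j = w ! j'}" if "j' = j" for j'
        using b T that unfolding rc(4) \<beta>_word_mat[OF rc(1-3)] by simp
      then show "c ! j = w ! j" using j by blast
    qed
    then have "x_elt d = mat_unit r w" using rc by (simp add: mat_unit_def)
    then show "x_elt d \<in> ?R" using rc \<open>c = w\<close> by auto
  qed
  show "?R \<subseteq> ?L"
  proof clarify
    fix r assume r: "r \<in> words n m" "mset r = mset w"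
    show "\<exists>d. mat_unit r w = x_elt d \<and> d \<in> planar_rook n m \<and> (\<forall>k\<le>n. \<beta> d k = T k)"
      using r w T word_mat_planar[OF r(1) w] \<beta>_word_mat[OF r(1) w r(2)] by (intro exI[of _ "word_mat r w"]) (simp add: mat_unit_def)
  qed
qed

text \<open>Identifies \<open>W_T\<close> with one column of the matrix algebra, the left ideal of a
  diagonal matrix unit; the coefficients in the span are the entries of column \<open>w\<close> of
  \<open>a\<close>.\<close>

lemma span_column:
  assumes w: "w \<in> words n m"
  shows "rook.span ((\<lambda>r. mat_unit r w) ` {r \<in> words n m. mset r = mset w}) = (\<lambda>a. alg_mult n m a (mat_unit w w)) ` carrier (CP n m)"
    (is "rook.span ?S = ?I")
proof
  have "rook.subspace ?I"
    unfolding rook.subspace_def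
  proof (intro conjI ballI allI)
    show "0 \<in> ?I" by (rule image_eqI[of _ _ 0]) simp_all
    fix x assume "x \<in> ?I"
    then obtain a where a: "a \<in> carrier (CP n m)" "x = alg_mult n m a (mat_unit w w)" by blast
    show "cscale z x \<in> ?I" for z
      using a by (intro image_eqI[of _ _ "cscale z a"]) (simp_all add: alg_mult_cscale_left)
    fix y assume "y \<in> ?I"
    then obtain b where b: "b \<in> carrier (CP n m)" "y = alg_mult n m b (mat_unit w w)" by blast
    show "x + y \<in> ?I"
      using a b by (intro image_eqI[of _ _ "a + b"]) (simp_all add: alg_mult_distrib_right)
  qed
  moreover have "?S \<subseteq> ?I"
  proof clarify
    fix r assume r: "r \<in> words n m" "mset r = mset w"
    have "alg_mult n m (mat_unit r w) (mat_unit w w) = mat_unit r w" using r w by (simp add: mat_unit_mult)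
    then show "mat_unit r w \<in> ?I" using r w by (intro image_eqI[of _ _ "mat_unit r w"]) simp_all
  qed
  ultimately show "rook.span ?S \<subseteq> ?I" by (rule rook.span_minimal[rotated])
  show "?I \<subseteq> rook.span ?S"
  proof clarify
    fix a assume "a \<in> carrier (CP n m)"
    then show "alg_mult n m a (mat_unit w w) \<in> rook.span ?S"
      unfolding mult_mat_unit[OF \<open>a \<in> _\<close> w w refl]
      by (intro rook.span_sum rook.span_scale rook.span_base) auto
  qed
qed

locale column_module =
  fixes n m :: nat and T :: "nat \<Rightarrow> nat set" and w :: "nat list"
  assumes w: "w \<in> words n m" and T: "\<And>k. k \<le> n \<Longrightarrow> T k = {j. j < m \<and> w ! j = k}"
begin

lemma carrier_W: "carrier (W n m T) = (\<lambda>a. alg_mult n m a (mat_unit w w)) ` carrier (CP n m)"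
  unfolding W_def using x_elt_column[OF w T] span_column[OF w] by simp

lemma W_simps: "add (W n m T) = (+)" "smult (W n m T) = alg_mult n m" "zero (W n m T) = 0"
  by (simp_all add: W_def)

lemma carrier_W_iff: "x \<in> carrier (W n m T) \<longleftrightarrow> x \<in> carrier (CP n m) \<and> alg_mult n m x (mat_unit w w) = x"
proof
  assume "x \<in> carrier (W n m T)"
  then show "x \<in> carrier (CP n m) \<and> alg_mult n m x (mat_unit w w) = x"
    unfolding carrier_W using w by (auto simp: alg_mult_assoc mat_unit_mult)
next
  assume "x \<in> carrier (CP n m) \<and> alg_mult n m x (mat_unit w w) = x"
  then show "x \<in> carrier (W n m T)" unfolding carrier_W by (metis image_eqI)
qed

lemma left_module_W: "left_module (CP n m) (W n m T)"
proof -
  have ab: "abelian_group (W n m T)"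
  proof (rule abelian_groupI)
    fix x assume x: "x \<in> carrier (W n m T)"
    have "cscale (-1) x \<in> carrier (W n m T)" 
      using x CP_cscale unfolding carrier_W_iff alg_mult_cscale_left by metis
    moreover have "cscale (-1) x + x = 0" by (simp add: cscale_def fun_eq_iff)
    ultimately show "\<exists>y\<in>carrier (W n m T). y \<oplus>\<^bsub>W n m T\<^esub> x = \<zero>\<^bsub>W n m T\<^esub>" unfolding W_simps by blast
  qed (simp_all add: W_simps carrier_W_iff alg_mult_distrib_right add_ac)
  show ?thesis
  proof (intro left_module.intro left_module_axioms.intro)
    show "ring (CP n m)" by (rule ring_CP)
    show "abelian_group (W n m T)" by (rule ab)
  qed (auto simp: W_simps carrier_W_iff alg_mult_distrib_right alg_mult_distrib_left alg_mult_assoc)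
qed

sublocale CP_module n m "W n m T" by (rule CP_module.intro[OF left_module_W])

lemma cyclic_W: "cyclic n m (W n m T) w (mat_unit w w)"
  unfolding cyclic_def
proof (intro conjI ballI)
  show "mat_unit w w \<noteq> \<zero>\<^bsub>W n m T\<^esub>"
  proof
    assume "mat_unit w w = \<zero>\<^bsub>W n m T\<^esub>"
    then have "Phi n m (mat_unit w w) w w = 0" by (simp add: W_simps)
    then show False using w by (simp add: Phi_mat_unit)
  qed
  fix x assume "x \<in> carrier (W n m T)"
  then show "\<exists>a\<in>carrier (CP n m). x = a \<odot>\<^bsub>W n m T\<^esub> mat_unit w w" unfolding carrier_W W_simps by blast
qed (use w in \<open>auto simp: W_simps carrier_W_iff mat_unit_mult\<close>)

lemma finsum_W:
  assumes "finite S" "\<And>s. s \<in> S \<Longrightarrow> f s \<in> carrier (W n m T)"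
  shows "finsum (W n m T) f S = sum f S"
  using assms
proof (induction S rule: finite_induct)
  case empty
  show ?case by (simp add: W_simps)
next
  case (insert x F)
  then have "finsum (W n m T) f (insert x F) = f x \<oplus>\<^bsub>W n m T\<^esub> finsum (W n m T) f F"
    by (intro L.M.finsum_insert) auto
  moreover have "finsum (W n m T) f F = sum f F" using insert by auto
  ultimately show ?case unfolding W_simps by (simp only: sum.insert[OF insert.hyps])
qed

lemma fd_W: "fd_module n m (W n m T)"
  unfolding fd_module_def
proof (intro conjI left_module_W)
  let ?S = "(\<lambda>r. mat_unit r w) ` {r \<in> words n m. mset r = mset w}"
  have sub: "?S \<subseteq> carrier (W n m T)" using w by (auto simp: carrier_W_iff mat_unit_mult)
  have fin: "finite ?S" by simp
  have "\<exists>c. v = (\<Oplus>\<^bsub>W n m T\<^esub>s\<in>?S. cscale (c s) (alg_one n m) \<odot>\<^bsub>W n m T\<^esub> s)" if v: "v \<in> carrier (W n m T)" for v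
  proof -
    have "v \<in> rook.span ?S" using v unfolding carrier_W span_column[OF w] .
    then obtain c where c: "v = (\<Sum>s\<in>?S. cscale (c s) s)" unfolding rook.span_finite[OF fin] by blast
    have sc: "cscale (c s) (alg_one n m) \<odot>\<^bsub>W n m T\<^esub> s = cscale (c s) s" if "s \<in> ?S" for s
      using that sub unfolding W_simps by (auto simp: alg_mult_cscale_left carrier_W_iff)
    have "(\<Oplus>\<^bsub>W n m T\<^esub>s\<in>?S. cscale (c s) (alg_one n m) \<odot>\<^bsub>W n m T\<^esub> s) = (\<Sum>s\<in>?S. cscale (c s) (alg_one n m) \<odot>\<^bsub>W n m T\<^esub> s)"
      using sub by (intro finsum_W fin closed CP_cscale CP_one) blast
    also have "\<dots> = v" unfolding c by (intro sum.cong refl sc)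
    finally have eq: "(\<Oplus>\<^bsub>W n m T\<^esub>s\<in>?S. cscale (c s) (alg_one n m) \<odot>\<^bsub>W n m T\<^esub> s) = v" .
    show ?thesis by (rule exI[of _ c]) (rule eq[symmetric])
  qed
  then show "\<exists>S. finite S \<and> S \<subseteq> carrier (W n m T) \<and>
       (\<forall>v\<in>carrier (W n m T). \<exists>c. v = (\<Oplus>\<^bsub>W n m T\<^esub>s\<in>S. cscale (c s) (alg_one n m) \<odot>\<^bsub>W n m T\<^esub> s))"
    using fin sub by (intro exI[of _ ?S] conjI ballI)
qed

end

section \<open>Multiplicities of letters and isomorphism classes\<close>

lemma count_words_tuple:
  assumes "w \<in> words n m" shows "count (mset w) \<in> tuples n m"
proof -
  have "count (mset w) = count_list w" by (rule ext) (rule count_mset)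
  moreover have "sum (count_list w) {..n} = m" using assms by (simp add: words_def sum_count_set)
  moreover have "count_list w k = 0" if "k > n" for k
    using assms that by (auto simp: words_def count_list_0_iff)
  ultimately show ?thesis by (simp add: tuples_def)
qed

lemma tuple_word:
  assumes ms: "ms \<in> tuples n m"
  obtains w where "column_module n m (\<lambda>k. {(\<Sum>j<k. ms j)..<(\<Sum>j\<le>k. ms j)}) w" "count (mset w) = ms"
proof -
  define S where "S k = (\<Sum>j<k. ms j)" for k
  have S_Suc: "(\<Sum>j\<le>k. ms j) = S (Suc k)" for k by (simp add: S_def lessThan_Suc_atMost)
  have mono: "S i \<le> S j" if "i \<le> j" for i j
    unfolding S_def using that by (intro sum_mono2) auto
  have Sn: "S (Suc n) = m" using ms S_Suc[of n] by (simp add: tuples_def)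
  \<comment> \<open>The word has \<open>ms 0\<close> letters 0, then \<open>ms 1\<close> letters 1,
    and so on: place \<open>j\<close> gets the first \<open>k\<close> whose interval ends beyond
    \<open>j\<close>.\<close>
  define f where "f j = (LEAST k. j < S (Suc k))" for j
  have f: "f j = k \<longleftrightarrow> S k \<le> j \<and> j < S (Suc k)" if j: "j < m" for j k
  proof
    have ex: "j < S (Suc n)" using j Sn by simp
    assume k: "f j = k"
    have "j < S (Suc k)" using LeastI[of "\<lambda>k. j < S (Suc k)", OF ex] k by (simp add: f_def)
    moreover have "S k \<le> j"
    proof (cases k)
      case 0 then show ?thesis by (simp add: S_def)
    next
      case (Suc i)
      then show ?thesis using not_less_Least[of i "\<lambda>k. j < S (Suc k)"] k by (simp add: f_def)
    qed
    ultimately show "S k \<le> j \<and> j < S (Suc k)" by simp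
  next
    assume k: "S k \<le> j \<and> j < S (Suc k)"
    show "f j = k"
      unfolding f_def
    proof (rule Least_equality)
      show "j < S (Suc k)" using k by simp
      fix i assume "j < S (Suc i)"
      then show "k \<le> i" using mono[of "Suc i" k] k by (cases "k \<le> i") auto
    qed
  qed
  let ?w = "map f [0..<m]"
  have fn: "f j \<le> n" if "j < m" for j
    unfolding f_def by (rule Least_le) (use that Sn in simp)
  have w: "?w \<in> words n m" using fn by (auto simp: words_def)
  have T: "{S k..<S (Suc k)} = {j. j < m \<and> ?w ! j = k}" if k: "k \<le> n" for k
  proof -
    have "S (Suc k) \<le> m" using mono[of "Suc k" "Suc n"] k Sn by simp
    then have "j \<in> {S k..<S (Suc k)} \<longleftrightarrow> j \<in> {j. j < m \<and> ?w ! j = k}" for j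
      using f[of j k] by (cases "j < m") auto
    then show ?thesis by blast
  qed
  have "count (mset ?w) k = ms k" for k
  proof (cases "k \<le> n")
    case True
    have "count (mset ?w) k = card {j. j < m \<and> ?w ! j = k}"
      using rank_in_length[of ?w k] by (simp add: rank_in_def)
    also have "\<dots> = ms k" unfolding T[OF True, symmetric] by (simp add: S_def)
    finally show ?thesis .
  next
    case False
    then show ?thesis using ms count_words_tuple[OF w] by (simp add: tuples_def)
  qed
  then have "count (mset ?w) = ms" by (rule ext)
  moreover have "column_module n m (\<lambda>k. {(\<Sum>j<k. ms j)..<(\<Sum>j\<le>k. ms j)}) ?w"
    by (rule column_module.intro[OF w]) (use T in \<open>simp add: S_Suc S_def[symmetric]\<close>)
  ultimately show thesis using that by blast
qed

definition W_class :: "nat \<Rightarrow> nat \<Rightarrow> (nat \<Rightarrow> nat) \<Rightarrow> rook_module set" where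
  "W_class n m ms = iso_class n m (W_int n m ms)"

lemma W_int_cyclic:
  assumes "ms \<in> tuples n m"
  obtains w v where "count (mset w) = ms" "cyclic n m (W_int n m ms) w v"
    "fd_module n m (W_int n m ms)" "left_module (CP n m) (W_int n m ms)"
    "carrier (W_int n m ms) = (\<lambda>a. alg_mult n m a (mat_unit w w)) ` carrier (CP n m)"
    "add (W_int n m ms) = (+)" "smult (W_int n m ms) = alg_mult n m"
proof -
  obtain w where "column_module n m (\<lambda>k. {(\<Sum>j<k. ms j)..<(\<Sum>j\<le>k. ms j)}) w" and cnt: "count (mset w) = ms"
    using tuple_word[OF assms] .
  then interpret column_module n m "\<lambda>k. {(\<Sum>j<k. ms j)..<(\<Sum>j\<le>k. ms j)}" w by simp
  show thesis
    using that[OF cnt] cyclic_W fd_W left_module_W carrier_W W_simps unfolding W_int_def by blast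
qed

text \<open>The word attached to \<open>W_int\<close> is in general only a rearrangement of
  \<open>w\<close>, so the generator of \<open>M\<close> is moved to that word before the column
  isomorphism applies.\<close>

lemma cyclic_module_iso:
  assumes lM: "left_module (CP n m) M" and cyc: "cyclic n m M w v"
  shows "module_iso (CP n m) (W_int n m (count (mset w))) M"
proof -
  interpret CP_module n m M using lM by (rule CP_module.intro)
  note w = cyclicD(1)[OF cyc]
  obtain w' v' where w': "count (mset w') = count (mset w)" and c: "cyclic n m (W_int n m (count (mset w))) w' v'"
    and W: "carrier (W_int n m (count (mset w))) = (\<lambda>a. alg_mult n m a (mat_unit w' w')) ` carrier (CP n m)"
    "add (W_int n m (count (mset w))) = (+)" "smult (W_int n m (count (mset w))) = alg_mult n m"
    using W_int_cyclic[OF count_words_tuple[OF w]] by metis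
  have "mset w' = mset w" using w' by (simp add: count_inject)
  then have "cyclic n m M w' (mat_unit w' w \<odot>\<^bsub>M\<^esub> v)"
    using cyclic_change_word[OF cyc cyclicD(1)[OF c]] by simp
  from cyclic_column_iso[OF this W] show ?thesis .
qed

lemma iso_class_cyclic:
  assumes lM: "left_module (CP n m) M" and cyc: "cyclic n m M w v"
  shows "iso_class n m M = W_class n m (count (mset w))"
  unfolding W_class_def using W_int_cyclic[OF count_words_tuple[OF cyclicD(1)[OF cyc]]]
    iso_class_eq[OF _ cyclic_module_iso[OF assms]] by metis

text \<open>Supplies a word and a generator for every representative of a class, as
  \<open>induced_map\<close> evaluates the functor on all of them.\<close>

lemma W_class_member:
  assumes ms: "ms \<in> tuples n m" and M: "M \<in> W_class n m ms"
  obtains w v where "count (mset w) = ms" "cyclic n m M w v" "left_module (CP n m) M"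
proof -
  have lM: "left_module (CP n m) M" and iso: "module_iso (CP n m) (W_int n m ms) M"
    using M by (auto simp: W_class_def iso_class_def fd_module_def)
  obtain w v where w: "count (mset w) = ms" "cyclic n m (W_int n m ms) w v" "left_module (CP n m) (W_int n m ms)"
    using W_int_cyclic[OF ms] by metis
  obtain h where h: "module_iso_map (CP n m) (W_int n m ms) M h" using iso unfolding module_iso_iff by blast
  show thesis using that[OF w(1) cyclic_transfer[OF w(3) lM h w(2)] lM] .
qed

lemma W_class_self: "ms \<in> tuples n m \<Longrightarrow> W_int n m ms \<in> W_class n m ms"
  unfolding W_class_def iso_class_def using module_iso_refl W_int_cyclic by (metis (mono_tags, lifting) mem_Collect_eq)

text \<open>Each \<open>W_int\<close> lies in its own class, so equal classes make the two modules
  isomorphic, and isomorphic cyclic modules have words of equal multiplicities. This makes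
  \<open>class_tuple\<close> well defined.\<close>

lemma W_class_inject:
  assumes "ms \<in> tuples n m" "ms' \<in> tuples n m" "W_class n m ms = W_class n m ms'"
  shows "ms = ms'"
proof -
  have mem: "W_int n m ms \<in> W_class n m ms'" using W_class_self[OF assms(1)] assms(3) by simp
  obtain w v where w: "count (mset w) = ms" "cyclic n m (W_int n m ms) w v" "left_module (CP n m) (W_int n m ms)"
    using W_int_cyclic[OF assms(1)] by metis
  obtain w' v' where w': "count (mset w') = ms'" "cyclic n m (W_int n m ms') w' v'" "left_module (CP n m) (W_int n m ms')"
    using W_int_cyclic[OF assms(2)] by metis
  have "module_iso (CP n m) (W_int n m ms') (W_int n m ms)" using mem by (simp add: W_class_def iso_class_def)
  from cyclic_iso_mset[OF w'(3) w(3) this w'(2) w(2)] show ?thesis using w w' by simp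
qed

lemma irr_classes_eq: "irr_classes n m = W_class n m ` tuples n m"
  by (simp add: irr_classes_def W_class_def)

lemma class_tuple_W_class: "ms \<in> tuples n m \<Longrightarrow> class_tuple n m (W_class n m ms) = ms"
  unfolding class_tuple_def W_class_def[symmetric] by (rule the_equality) (auto dest: W_class_inject)

lemma irr_classes_irreducible:
  "irr_classes n m = {iso_class n m M |M :: rook_module. fd_module n m M \<and> irreducible_module (CP n m) M}"
proof
  show "irr_classes n m \<subseteq> {iso_class n m M |M :: rook_module. fd_module n m M \<and> irreducible_module (CP n m) M}"
  proof
    fix b assume "b \<in> irr_classes n m"
    then obtain ms where ms: "ms \<in> tuples n m" "b = W_class n m ms" unfolding irr_classes_eq by blast
    obtain w v where w: "cyclic n m (W_int n m ms) w v" "fd_module n m (W_int n m ms)" "left_module (CP n m) (W_int n m ms)"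
      using W_int_cyclic[OF ms(1)] by metis
    have "irreducible_module (CP n m) (W_int n m ms)"
      by (rule CP_module.cyclic_irreducible[OF CP_module.intro[OF w(3)] w(1)])
    then show "b \<in> {iso_class n m M |M :: rook_module. fd_module n m M \<and> irreducible_module (CP n m) M}"
      using ms(2) w(2) unfolding W_class_def by blast
  qed
  show "{iso_class n m M |M :: rook_module. fd_module n m M \<and> irreducible_module (CP n m) M} \<subseteq> irr_classes n m"
  proof clarify
    fix M :: rook_module assume M: "fd_module n m M" "irreducible_module (CP n m) M"
    then have lM: "left_module (CP n m) M" by (simp add: fd_module_def)
    obtain w v where c: "cyclic n m M w v"
      using CP_module.irreducible_cyclic[OF CP_module.intro[OF lM] M(2)] .
    show "iso_class n m M \<in> irr_classes n m"
      unfolding irr_classes_eq iso_class_cyclic[OF lM c] using count_words_tuple[OF cyclicD(1)[OF c]] by blast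
  qed
qed

lemma Phi_\<psi>_one:
  assumes j: "j \<le> n" and s: "s \<in> words n (Suc m)" and t: "t \<in> words n (Suc m)"
  shows "Phi n (Suc m) (\<psi> n j (Suc m) (alg_one n m)) s t = (if t = s then (if last s = j then 1 else 0) else 0)"
proof -
  obtain s' k where s': "s = s' @ [k]" "s' \<in> words n m" "k \<le> n" using words_SucE[OF s] .
  obtain t' l where t': "t = t' @ [l]" "t' \<in> words n m" "l \<le> n" using words_SucE[OF t] .
  show ?thesis
    unfolding s'(1) t'(1) Phi_\<psi>[OF j s'(2) t'(2)] Phi_one[OF s'(2) t'(2)] by auto
qed

lemma Phi_\<psi>_one_mult:
  assumes j: "j \<le> n" and s: "s \<in> words n (Suc m)" and t: "t \<in> words n (Suc m)"
  shows "Phi n (Suc m) (alg_mult n (Suc m) (\<psi> n j (Suc m) (alg_one n m)) f) s t = (if last s = j then Phi n (Suc m) f s t else 0)"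
    and "Phi n (Suc m) (alg_mult n (Suc m) f (\<psi> n j (Suc m) (alg_one n m))) s t = (if last t = j then Phi n (Suc m) f s t else 0)"
proof -
  have "Phi n (Suc m) (alg_mult n (Suc m) (\<psi> n j (Suc m) (alg_one n m)) f) s t =
      (\<Sum>r\<in>words n (Suc m). if r = s then (if last s = j then Phi n (Suc m) f s t else 0) else 0)"
    unfolding Phi_mult[OF s t] using Phi_\<psi>_one[OF j s] by (intro sum.cong refl) simp
  then show "Phi n (Suc m) (alg_mult n (Suc m) (\<psi> n j (Suc m) (alg_one n m)) f) s t = (if last s = j then Phi n (Suc m) f s t else 0)"
    using s by simp
  have "Phi n (Suc m) (alg_mult n (Suc m) f (\<psi> n j (Suc m) (alg_one n m))) s t =
      (\<Sum>r\<in>words n (Suc m). if r = t then (if last t = j then Phi n (Suc m) f s t else 0) else 0)"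
    unfolding Phi_mult[OF s t] using Phi_\<psi>_one[OF j _ t] by (intro sum.cong refl) auto
  then show "Phi n (Suc m) (alg_mult n (Suc m) f (\<psi> n j (Suc m) (alg_one n m))) s t = (if last t = j then Phi n (Suc m) f s t else 0)"
    using t by simp
qed

text \<open>\<open>\<psi>\<close> sends the identity to the diagonal idempotent of the words ending
  in \<open>j\<close>, so compressing \<open>a\<close> keeps the entries between such words. Erasing
  the last letter on both sides gives \<open>b\<close>.\<close>

lemma \<psi>_compress:
  assumes j: "j \<le> n"
  shows "\<exists>b\<in>carrier (CP n m). alg_mult n (Suc m) (\<psi> n j (Suc m) (alg_one n m)) (alg_mult n (Suc m) a (\<psi> n j (Suc m) (alg_one n m))) = \<psi> n j (Suc m) b"
proof
  let ?I = "{(r, c). r \<in> words n m \<and> c \<in> words n m \<and> mset r = mset c}"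
  let ?b = "\<Sum>(r, c)\<in>?I. cscale (Phi n (Suc m) a (r @ [j]) (c @ [j])) (mat_unit r c)"
  show b: "?b \<in> carrier (CP n m)" by (intro CP_sum) auto
  have fin: "finite ?I" by (rule finite_subset[of _ "words n m \<times> words n m"]) auto
  have Phi_b: "Phi n m ?b r c = Phi n (Suc m) a (r @ [j]) (c @ [j])" if rc: "r \<in> words n m" "c \<in> words n m" for r c
  proof (cases "mset r = mset c")
    case True
    have "Phi n m ?b r c = (\<Sum>p\<in>?I. if p = (r, c) then Phi n (Suc m) a (r @ [j]) (c @ [j]) else 0)"
      unfolding Phi_sum using rc True by (intro sum.cong refl) (auto simp: Phi_cscale Phi_mat_unit split: if_splits)
    also have "\<dots> = Phi n (Suc m) a (r @ [j]) (c @ [j])"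
      using fin rc True by simp
    finally show ?thesis .
  next
    case False
    \<comment> \<open>Appending \<open>j\<close> to both words does not change whether their
      multiplicities agree, so both entries are 0.\<close>
    then show ?thesis using rc j by (simp add: Phi_mset)
  qed
  show "alg_mult n (Suc m) (\<psi> n j (Suc m) (alg_one n m)) (alg_mult n (Suc m) a (\<psi> n j (Suc m) (alg_one n m))) = \<psi> n j (Suc m) ?b"
  proof (rule Phi_eqI)
    fix s t assume s: "s \<in> words n (Suc m)" and t: "t \<in> words n (Suc m)"
    obtain s' k where s': "s = s' @ [k]" "s' \<in> words n m" "k \<le> n" using words_SucE[OF s] .
    obtain t' l where t': "t = t' @ [l]" "t' \<in> words n m" "l \<le> n" using words_SucE[OF t] .
    have "Phi n (Suc m) (\<psi> n j (Suc m) ?b) s t = (if k = j \<and> l = j then Phi n (Suc m) a (s' @ [j]) (t' @ [j]) else 0)"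
      unfolding s'(1) t'(1) Phi_\<psi>[OF j s'(2) t'(2)] Phi_b[OF s'(2) t'(2)] ..
    then show "Phi n (Suc m) (alg_mult n (Suc m) (\<psi> n j (Suc m) (alg_one n m)) (alg_mult n (Suc m) a (\<psi> n j (Suc m) (alg_one n m)))) s t
      = Phi n (Suc m) (\<psi> n j (Suc m) ?b) s t"
      unfolding Phi_\<psi>_one_mult[OF j s t] by (simp add: s'(1) t'(1))
  qed simp_all
qed

section \<open>Restriction\<close>

locale restriction = CP_module n "Suc m" M for n m and M :: "(rook_alg, 'v) module" (structure) +
  fixes j :: nat
  assumes j: "j \<le> n"
begin

abbreviation "p \<equiv> \<psi> n j (Suc m) (alg_one n m)"

lemma Res_simps:
  "carrier (Res n j (Suc m) M) = (\<lambda>v. p \<odot> v) ` carrier M"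
  "zero (Res n j (Suc m) M) = \<zero>" "add (Res n j (Suc m) M) = add M"
  "x \<odot>\<^bsub>Res n j (Suc m) M\<^esub> v = \<psi> n j (Suc m) x \<odot> v"
  by (simp_all add: Res_def)

lemma p_\<psi>: "x \<in> carrier (CP n m) \<Longrightarrow> alg_mult n (Suc m) p (\<psi> n j (Suc m) x) = \<psi> n j (Suc m) x"
  by (simp add: \<psi>_mult[OF j, symmetric])

lemma carrier_Res_iff: "v \<in> carrier (Res n j (Suc m) M) \<longleftrightarrow> v \<in> carrier M \<and> p \<odot> v = v"
proof
  assume "v \<in> carrier (Res n j (Suc m) M)"
  then show "v \<in> carrier M \<and> p \<odot> v = v" unfolding Res_simps by (auto simp: mult p_\<psi>)
next
  assume "v \<in> carrier M \<and> p \<odot> v = v"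
  then show "v \<in> carrier (Res n j (Suc m) M)" unfolding Res_simps by (metis image_eqI)
qed

lemma left_module_Res: "left_module (CP n m) (Res n j (Suc m) M)"
proof -
  let ?R = "Res n j (Suc m) M"
  have ab: "abelian_group ?R"
  proof (rule abelian_groupI)
    fix x y assume x: "x \<in> carrier ?R" and y: "y \<in> carrier ?R"
    show "x \<oplus>\<^bsub>?R\<^esub> y \<in> carrier ?R"
      using x y L.smult_r_distr[of p x y] unfolding Res_simps(3) carrier_Res_iff by simp
    show "x \<oplus>\<^bsub>?R\<^esub> y = y \<oplus>\<^bsub>?R\<^esub> x"
      using x y unfolding Res_simps(3) carrier_Res_iff by (simp add: L.M.a_comm)
  next
    show "\<zero>\<^bsub>?R\<^esub> \<in> carrier ?R" unfolding Res_simps(2) carrier_Res_iff by simp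
  next
    fix x y z assume "x \<in> carrier ?R" "y \<in> carrier ?R" "z \<in> carrier ?R"
    then show "x \<oplus>\<^bsub>?R\<^esub> y \<oplus>\<^bsub>?R\<^esub> z = x \<oplus>\<^bsub>?R\<^esub> (y \<oplus>\<^bsub>?R\<^esub> z)"
      unfolding Res_simps(3) carrier_Res_iff by (simp add: L.M.a_assoc)
  next
    fix x assume x: "x \<in> carrier ?R"
    then show "\<zero>\<^bsub>?R\<^esub> \<oplus>\<^bsub>?R\<^esub> x = x" unfolding Res_simps(2,3) carrier_Res_iff by simp
    have xm: "x \<in> carrier M" "p \<odot> x = x" using x unfolding carrier_Res_iff by auto
    have inv: "\<ominus> x \<oplus> x = \<zero>" using xm by (simp add: L.M.l_neg)
    \<comment> \<open>The inverse is taken in the form \<open>p \<odot> (\<ominus> x)\<close>, which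
      visibly lies in the image of \<open>p\<close>.\<close>
    have "p \<odot> (\<ominus> x) \<oplus> x = p \<odot> (\<ominus> x \<oplus> x)" using L.smult_r_distr[of p "\<ominus> x" x] xm by simp
    also have "\<dots> = \<zero>" unfolding inv by simp
    finally have "p \<odot> (\<ominus> x) \<oplus>\<^bsub>?R\<^esub> x = \<zero>\<^bsub>?R\<^esub>" unfolding Res_simps .
    moreover have "p \<odot> (\<ominus> x) \<in> carrier ?R" unfolding Res_simps using xm by simp
    ultimately show "\<exists>y\<in>carrier ?R. y \<oplus>\<^bsub>?R\<^esub> x = \<zero>\<^bsub>?R\<^esub>" by blast
  qed
  show ?thesis
  proof (intro left_module.intro left_module_axioms.intro)
    show "ring (CP n m)" by (rule ring_CP)
    show "abelian_group ?R" by (rule ab)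
  next
    fix a b v assume a: "a \<in> carrier (CP n m)" and b: "b \<in> carrier (CP n m)" and "v \<in> carrier ?R"
    then have v: "v \<in> carrier M" by (simp add: carrier_Res_iff)
    show "(a \<oplus>\<^bsub>CP n m\<^esub> b) \<odot>\<^bsub>?R\<^esub> v = a \<odot>\<^bsub>?R\<^esub> v \<oplus>\<^bsub>?R\<^esub> b \<odot>\<^bsub>?R\<^esub> v"
      unfolding Res_simps(3,4) using add_left[OF CP_\<psi> CP_\<psi> v] by (simp add: \<psi>_add[OF j])
    show "(a \<otimes>\<^bsub>CP n m\<^esub> b) \<odot>\<^bsub>?R\<^esub> v = a \<odot>\<^bsub>?R\<^esub> (b \<odot>\<^bsub>?R\<^esub> v)"
      unfolding Res_simps(4) using mult[OF CP_\<psi> CP_\<psi> v] by (simp add: \<psi>_mult[OF j])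
  next
    fix a v assume a: "a \<in> carrier (CP n m)" and v: "v \<in> carrier ?R"
    then show "a \<odot>\<^bsub>?R\<^esub> v \<in> carrier ?R"
      unfolding carrier_Res_iff Res_simps(4) by (simp add: mult p_\<psi>)
  next
    fix a v w assume "a \<in> carrier (CP n m)" "v \<in> carrier ?R" "w \<in> carrier ?R"
    then show "a \<odot>\<^bsub>?R\<^esub> (v \<oplus>\<^bsub>?R\<^esub> w) = a \<odot>\<^bsub>?R\<^esub> v \<oplus>\<^bsub>?R\<^esub> a \<odot>\<^bsub>?R\<^esub> w"
      unfolding carrier_Res_iff Res_simps(3,4) using L.smult_r_distr[of "\<psi> n j (Suc m) a" v w] by simp
  next
    fix v assume "v \<in> carrier ?R"
    then show "\<one>\<^bsub>CP n m\<^esub> \<odot>\<^bsub>?R\<^esub> v = v" unfolding carrier_Res_iff Res_simps(4) by simp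
  qed
qed

text \<open>The generator itself survives, since \<open>p\<close> fixes it. An element
  \<open>x = a v\<close> of the restriction equals \<open>p a p v\<close>, and \<open>p a p\<close>
  lies in the image of \<open>\<psi>\<close>.\<close>

lemma cyclic_Res:
  assumes w: "w \<in> words n m" and cyc: "cyclic n (Suc m) M (w @ [j]) v"
  shows "cyclic n m (Res n j (Suc m) M) w v"
proof -
  note c = cyclicD[OF cyc]
  have Ew: "\<psi> n j (Suc m) (mat_unit w w) = mat_unit (w @ [j]) (w @ [j])" by (rule \<psi>_mat_unit[OF j w w refl])
  have pv: "p \<odot> v = v"
  proof -
    have "p \<odot> (mat_unit (w @ [j]) (w @ [j]) \<odot> v) = alg_mult n (Suc m) p (mat_unit (w @ [j]) (w @ [j])) \<odot> v"
      using c by (intro mult) simp_all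
    also have "alg_mult n (Suc m) p (mat_unit (w @ [j]) (w @ [j])) = mat_unit (w @ [j]) (w @ [j])"
      unfolding Ew[symmetric] using w by (simp add: p_\<psi>)
    finally show ?thesis using c(4) by simp
  qed
  show ?thesis
    unfolding cyclic_def
  proof (intro conjI ballI)
    show "w \<in> words n m" by (rule w)
    show "v \<in> carrier (Res n j (Suc m) M)" unfolding carrier_Res_iff using c pv by simp
    show "v \<noteq> \<zero>\<^bsub>Res n j (Suc m) M\<^esub>" unfolding Res_simps by (rule c(3))
    show "mat_unit w w \<odot>\<^bsub>Res n j (Suc m) M\<^esub> v = v" unfolding Res_simps Ew by (rule c(4))
    fix x assume "x \<in> carrier (Res n j (Suc m) M)"
    then have x: "x \<in> carrier M" "p \<odot> x = x" unfolding carrier_Res_iff by auto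
    obtain a where a: "a \<in> carrier (CP n (Suc m))" "x = a \<odot> v" using c(5)[OF x(1)] by blast
    obtain b where b: "b \<in> carrier (CP n m)" "alg_mult n (Suc m) p (alg_mult n (Suc m) a p) = \<psi> n j (Suc m) b"
      using \<psi>_compress[OF j] by blast
    have "x = p \<odot> (a \<odot> (p \<odot> v))" using x(2) unfolding pv a(2) by simp
    also have "\<dots> = \<psi> n j (Suc m) b \<odot> v"
      unfolding b(2)[symmetric] using a c by (simp add: mult)
    finally show "\<exists>b\<in>carrier (CP n m). x = b \<odot>\<^bsub>Res n j (Suc m) M\<^esub> v" unfolding Res_simps using b by blast
  qed
qed

text \<open>Nonzero rows of \<open>p a\<close> belong to words ending in \<open>j\<close>, whereas
  \<open>a\<close> links \<open>w\<close> only to its rearrangements, none of which contains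
  \<open>j\<close>.\<close>

lemma Res_zero:
  assumes cyc: "cyclic n (Suc m) M w v" and no: "j \<notin> set w"
  shows "carrier (Res n j (Suc m) M) = {\<zero>\<^bsub>Res n j (Suc m) M\<^esub>}"
proof -
  note c = cyclicD[OF cyc]
  have "p \<odot> x = \<zero>" if x: "x \<in> carrier M" for x
  proof -
    obtain a where a: "a \<in> carrier (CP n (Suc m))" "x = a \<odot> v" using c(5)[OF x] by blast
    have "p \<odot> (a \<odot> (mat_unit w w \<odot> v)) = p \<odot> (alg_mult n (Suc m) a (mat_unit w w) \<odot> v)"
      using a c by (intro arg_cong[where f = "\<lambda>x. p \<odot> x"] mult) simp_all
    also have "\<dots> = alg_mult n (Suc m) p (alg_mult n (Suc m) a (mat_unit w w)) \<odot> v"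
      using a c by (intro mult) simp_all
    also have "alg_mult n (Suc m) p (alg_mult n (Suc m) a (mat_unit w w)) = 0"
    proof (rule Phi_eqI[of _ n "Suc m"])
      fix s t assume s: "s \<in> words n (Suc m)" and t: "t \<in> words n (Suc m)"
      have "Phi n (Suc m) a s w = 0" if "last s = j"
      proof (rule Phi_mset[OF s c(1)])
        have "s \<noteq> []" using words_length[OF s] by auto
        then have "j \<in> set s" using that last_in_set by metis
        then show "mset s \<noteq> mset w" using no by (metis set_mset_mset)
      qed
      then show "Phi n (Suc m) (alg_mult n (Suc m) p (alg_mult n (Suc m) a (mat_unit w w))) s t = Phi n (Suc m) 0 s t"
        unfolding Phi_\<psi>_one_mult[OF j s t] using s t c by (simp add: Phi_mult_mat_unit_right)
    qed simp_all
    also have "0 \<odot> v = \<zero>" by (rule zero_left[OF c(2)])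
    finally show ?thesis using a c(4) by simp
  qed
  then show ?thesis unfolding Res_simps using L.M.zero_closed by (auto simp: image_iff)
qed

end

section \<open>Induction\<close>

locale induction_module = CP_module n m M for n m and M :: "(rook_alg, 'v) module" (structure) +
  fixes i :: nat
  assumes i: "i \<le> n"
begin

abbreviation "F \<equiv> tensor_free n (Suc m) M"
abbreviation "K \<equiv> tensor_rels n i (Suc m) M"
abbreviation "A \<equiv> carrier (CP n (Suc m))"
abbreviation "\<mu> \<equiv> alg_mult n (Suc m)"
abbreviation "act a \<equiv> frag_extend (\<lambda>(b, v). frag_of (\<mu> a b, v))"
abbreviation "coset t \<equiv> K #>\<^bsub>F\<^esub> t"

definition gens :: "((rook_alg \<times> 'v) \<Rightarrow>\<^sub>0 int) set" where
  "gens = {frag_of (a + b, v) - frag_of (a, v) - frag_of (b, v) |a b v. a \<in> A \<and> b \<in> A \<and> v \<in> carrier M} \<union>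
      {frag_of (a, v \<oplus> w) - frag_of (a, v) - frag_of (a, w) |a v w. a \<in> A \<and> v \<in> carrier M \<and> w \<in> carrier M} \<union>
      {frag_of (\<mu> a (\<psi> n i (Suc m) x), v) - frag_of (a, x \<odot> v) |a x v.
         a \<in> A \<and> x \<in> carrier (CP n m) \<and> v \<in> carrier M}"

lemma K_eq: "K = generate F gens"
  unfolding tensor_rels_def gens_def by simp

lemma carrier_F: "t \<in> carrier F \<longleftrightarrow> Poly_Mapping.keys t \<subseteq> A \<times> carrier M"
  by (simp add: tensor_free_def)

lemma F_simps: "t \<otimes>\<^bsub>F\<^esub> t' = t + t'" "\<one>\<^bsub>F\<^esub> = 0" "t \<in> carrier F \<Longrightarrow> inv\<^bsub>F\<^esub> t = - t"
  by (simp_all add: tensor_free_def)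

lemma comm_group_F: "comm_group F"
  unfolding tensor_free_def by (rule abelian_free_Abelian_group)

sublocale F: comm_group F by (rule comm_group_F)

lemma F_frag [simp]: "a \<in> A \<Longrightarrow> v \<in> carrier M \<Longrightarrow> frag_of (a, v) \<in> carrier F"
  by (simp add: carrier_F)

lemma F_diff [simp]: "t \<in> carrier F \<Longrightarrow> t' \<in> carrier F \<Longrightarrow> t - t' \<in> carrier F"
  using keys_diff[of t t'] unfolding carrier_F by blast

lemma F_add [simp]: "t \<in> carrier F \<Longrightarrow> t' \<in> carrier F \<Longrightarrow> t + t' \<in> carrier F"
  using F.m_closed[of t t'] by (simp add: F_simps)

lemma F_zero [simp]: "0 \<in> carrier F"
  using F.one_closed by (simp add: F_simps)

lemma F_induct [consumes 1, case_names zero frag diff]: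
  assumes "t \<in> carrier F" "P 0" "\<And>a v. \<lbrakk>a \<in> A; v \<in> carrier M\<rbrakk> \<Longrightarrow> P (frag_of (a, v))"
    "\<And>t t'. \<lbrakk>t \<in> carrier F; t' \<in> carrier F; P t; P t'\<rbrakk> \<Longrightarrow> P (t - t')"
  shows "P t"
proof (rule free_Abelian_group_induct[of t "A \<times> carrier M"])
  show "Poly_Mapping.keys t \<subseteq> A \<times> carrier M" using assms(1) unfolding carrier_F .
  show "P (x - y)" if "Poly_Mapping.keys x \<subseteq> A \<times> carrier M" "Poly_Mapping.keys y \<subseteq> A \<times> carrier M" "P x" "P y" for x y
    using assms(4) that unfolding carrier_F by blast
  show "P (frag_of a)" if "a \<in> A \<times> carrier M" for a using that assms(3) by (cases a) simp
qed (rule assms(2))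

lemma gens_subset: "gens \<subseteq> carrier F"
  unfolding gens_def by (auto intro!: F_diff F_frag)

lemma subgroup_K: "subgroup K F"
  unfolding K_eq by (rule F.generate_is_subgroup[OF gens_subset])

lemma K_subset: "t \<in> K \<Longrightarrow> t \<in> carrier F"
  using subgroup.subset[OF subgroup_K] by blast

lemma K_zero: "0 \<in> K"
  using subgroup.one_closed[OF subgroup_K] by (simp add: F_simps)

lemma K_add: "t \<in> K \<Longrightarrow> t' \<in> K \<Longrightarrow> t + t' \<in> K"
  using subgroup.m_closed[OF subgroup_K] by (simp add: F_simps)

lemma K_uminus: "t \<in> K \<Longrightarrow> - t \<in> K"
  using subgroup.m_inv_closed[OF subgroup_K] F_simps(3)[OF K_subset] by simp

lemma K_diff: "t \<in> K \<Longrightarrow> t' \<in> K \<Longrightarrow> t - t' \<in> K"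
  using K_add[OF _ K_uminus] by fastforce

lemma K_relations:
  shows "\<lbrakk>a \<in> A; b \<in> A; v \<in> carrier M\<rbrakk> \<Longrightarrow> frag_of (a + b, v) - frag_of (a, v) - frag_of (b, v) \<in> K"
    and "\<lbrakk>a \<in> A; v \<in> carrier M; w \<in> carrier M\<rbrakk> \<Longrightarrow> frag_of (a, v \<oplus> w) - frag_of (a, v) - frag_of (a, w) \<in> K"
    and "\<lbrakk>a \<in> A; x \<in> carrier (CP n m); v \<in> carrier M\<rbrakk> \<Longrightarrow>
      frag_of (\<mu> a (\<psi> n i (Suc m) x), v) - frag_of (a, x \<odot> v) \<in> K"
  unfolding K_eq by (rule generate.incl, auto simp: gens_def)+

lemma K_induct [consumes 1, case_names zero add uminus left right balance]:
  assumes t: "t \<in> K" and 0: "P 0" and add: "\<And>t t'. P t \<Longrightarrow> P t' \<Longrightarrow> P (t + t')"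
    and uminus: "\<And>t. P t \<Longrightarrow> P (- t)"
    and rels: "\<And>a b v. \<lbrakk>a \<in> A; b \<in> A; v \<in> carrier M\<rbrakk> \<Longrightarrow> P (frag_of (a + b, v) - frag_of (a, v) - frag_of (b, v))"
      "\<And>a v w. \<lbrakk>a \<in> A; v \<in> carrier M; w \<in> carrier M\<rbrakk> \<Longrightarrow> P (frag_of (a, v \<oplus> w) - frag_of (a, v) - frag_of (a, w))"
      "\<And>a x v. \<lbrakk>a \<in> A; x \<in> carrier (CP n m); v \<in> carrier M\<rbrakk> \<Longrightarrow>
        P (frag_of (\<mu> a (\<psi> n i (Suc m) x), v) - frag_of (a, x \<odot> v))"
  shows "P t"
proof -
  have gen: "P g" if "g \<in> gens" for g using that unfolding gens_def
  proof (elim UnE CollectE exE conjE)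
  qed (hypsubst, rule rels, assumption+)+
  show ?thesis
    using t unfolding K_eq
  proof (induction rule: generate.induct)
    case one
    show ?case using 0 by (simp add: F_simps)
  next
    case (incl h)
    then show ?case by (rule gen)
  next
    case (inv h)
    then have "inv\<^bsub>F\<^esub> h = - h" using gens_subset by (intro F_simps) blast
    then show ?case using uminus[OF gen[OF inv]] by simp
  next
    case (eng h1 h2)
    then show ?case using add by (simp add: F_simps)
  qed
qed

lemma coset_eq_iff: "t \<in> carrier F \<Longrightarrow> t' \<in> carrier F \<Longrightarrow> coset t = coset t' \<longleftrightarrow> t - t' \<in> K"
proof
  assume t: "t \<in> carrier F" "t' \<in> carrier F" and "coset t = coset t'"
  moreover have "t \<in> coset t" using K_zero by (auto simp: r_coset_def F_simps intro!: bexI[of _ 0])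
  ultimately obtain h where "h \<in> K" "t = h + t'" by (auto simp: r_coset_def F_simps)
  then show "t - t' \<in> K" by simp
next
  have sub: "coset t \<subseteq> coset t'" if d: "t - t' \<in> K" for t t'
  proof
    fix x assume "x \<in> coset t"
    then obtain h where "h \<in> K" "x = h + t" by (auto simp: r_coset_def F_simps)
    then have "h + (t - t') \<in> K" "x \<in> {(h + (t - t')) + t'}" using d K_add by auto
    then show "x \<in> coset t'" unfolding r_coset_def F_simps by (rule UN_I)
  qed
  assume d: "t - t' \<in> K"
  have "t' - t \<in> K" using K_uminus[OF d] by simp
  then show "coset t = coset t'" using sub[OF d] sub by blast
qed

lemma coset_memD: "t' \<in> coset t \<Longrightarrow> t \<in> carrier F \<Longrightarrow> t' \<in> carrier F \<and> t' - t \<in> K"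
  using K_subset by (auto simp: r_coset_def F_simps)

lemma act_closed [simp]: "t \<in> carrier F \<Longrightarrow> a \<in> A \<Longrightarrow> act a t \<in> carrier F"
  by (induction t rule: F_induct) (simp_all add: frag_extend_diff)

text \<open>Left multiplication turns each defining relation into one of the same kind, which makes
  the action on cosets independent of representatives.\<close>

lemma act_K: "t \<in> K \<Longrightarrow> a \<in> A \<Longrightarrow> act a t \<in> K"
proof (induction t rule: K_induct)
  case (left b c v)
  then show ?case using K_relations(1)[of "\<mu> a b" "\<mu> a c" v] by (simp add: frag_extend_diff alg_mult_distrib_left)
next
  case (right b v w)
  then show ?case using K_relations(2)[of "\<mu> a b" v w] by (simp add: frag_extend_diff)
next
  case (balance b x v)
  then show ?case using K_relations(3)[of "\<mu> a b" x v] by (simp add: frag_extend_diff alg_mult_assoc)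
qed (simp_all add: frag_extend_add frag_extend_minus K_zero K_add K_uminus)

abbreviation "Ind_M \<equiv> Ind n i (Suc m) M"

lemma Ind_add: "t \<in> carrier F \<Longrightarrow> t' \<in> carrier F \<Longrightarrow> coset t \<oplus>\<^bsub>Ind_M\<^esub> coset t' = coset (t + t')"
  using normal.rcos_sum[OF F.subgroup_imp_normal[OF subgroup_K], of t t'] by (simp add: Ind_def Let_def F_simps)

lemma Ind_carrier: "carrier Ind_M = coset ` carrier F"
  by (auto simp: Ind_def Let_def FactGroup_def RCOSETS_def)

lemma Ind_zero: "zero Ind_M = coset 0"
proof -
  have "zero Ind_M = K" by (simp add: Ind_def Let_def)
  also have "\<dots> = coset 0" by (auto simp: r_coset_def F_simps)
  finally show ?thesis .
qed

text \<open>The defining union runs over all representatives of a coset; all of them yield the same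
  coset.\<close>

lemma Ind_smult:
  assumes t: "t \<in> carrier F" and a: "a \<in> A"
  shows "a \<odot>\<^bsub>Ind_M\<^esub> coset t = coset (act a t)"
proof -
  have same: "coset (act a t') = coset (act a t)" if t': "t' \<in> coset t" for t'
  proof -
    have m: "t' \<in> carrier F" "t' - t \<in> K" using coset_memD[OF t' t] by auto
    have "act a t' - act a t \<in> K" using act_K[OF m(2) a] by (simp add: frag_extend_diff)
    then show ?thesis using coset_eq_iff act_closed[OF m(1) a] act_closed[OF t a] by blast
  qed
  have "t \<in> coset t" using K_zero by (auto simp: r_coset_def F_simps intro!: bexI[of _ 0])
  then have "(\<Union>t'\<in>coset t. coset (act a t')) = coset (act a t)" using same by blast
  then show ?thesis by (simp add: Ind_def Let_def)
qed

lemma left_module_Ind: "left_module (CP n (Suc m)) Ind_M"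
proof -
  have ab: "abelian_group Ind_M"
  proof (rule abelian_groupI)
    show "\<zero>\<^bsub>Ind_M\<^esub> \<in> carrier Ind_M" unfolding Ind_zero Ind_carrier by (intro imageI F_zero)
  next
    fix X Y assume "X \<in> carrier Ind_M" "Y \<in> carrier Ind_M"
    then obtain s t where t: "s \<in> carrier F" "X = coset s" "t \<in> carrier F" "Y = coset t" unfolding Ind_carrier by blast
    show "X \<oplus>\<^bsub>Ind_M\<^esub> Y \<in> carrier Ind_M" using t by (simp add: Ind_add Ind_carrier)
    show "X \<oplus>\<^bsub>Ind_M\<^esub> Y = Y \<oplus>\<^bsub>Ind_M\<^esub> X" using t by (simp add: Ind_add add.commute)
    fix Z assume "Z \<in> carrier Ind_M"
    then obtain r where "r \<in> carrier F" "Z = coset r" unfolding Ind_carrier by blast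
    then show "X \<oplus>\<^bsub>Ind_M\<^esub> Y \<oplus>\<^bsub>Ind_M\<^esub> Z = X \<oplus>\<^bsub>Ind_M\<^esub> (Y \<oplus>\<^bsub>Ind_M\<^esub> Z)" using t by (simp add: Ind_add add.assoc)
  next
    fix X assume "X \<in> carrier Ind_M"
    then obtain t where t: "t \<in> carrier F" "X = coset t" unfolding Ind_carrier by blast
    show "\<zero>\<^bsub>Ind_M\<^esub> \<oplus>\<^bsub>Ind_M\<^esub> X = X" unfolding Ind_zero using t by (simp add: Ind_add)
    have "- t \<in> carrier F" using F_diff[OF F_zero t(1)] by simp
    then show "\<exists>Y\<in>carrier Ind_M. Y \<oplus>\<^bsub>Ind_M\<^esub> X = \<zero>\<^bsub>Ind_M\<^esub>"
      unfolding Ind_zero using t by (intro bexI[of _ "coset (- t)"]) (simp_all add: Ind_add Ind_carrier)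
  qed
  have K0: "x \<in> K \<Longrightarrow> y \<in> K \<Longrightarrow> z = x - y \<Longrightarrow> z \<in> K" for x y z using K_diff by blast
  show ?thesis
  proof (intro left_module.intro left_module_axioms.intro)
    show "ring (CP n (Suc m))" by (rule ring_CP)
    show "abelian_group Ind_M" by (rule ab)
  next
    fix a b X assume a: "a \<in> A" and b: "b \<in> A" and "X \<in> carrier Ind_M"
    then obtain t where t: "t \<in> carrier F" "X = coset t" unfolding Ind_carrier by blast
    have ab: "a + b \<in> A" "\<mu> a b \<in> A" using a b by simp_all
    \<comment> \<open>This law holds only modulo \<open>K\<close>, by additivity in the first tensor
      factor; the other laws of the action hold already in the free abelian group.\<close>
    have "act (a + b) t - (act a t + act b t) \<in> K"
      using t(1)
    proof (induction t rule: F_induct)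
      case (frag c v)
      then have "frag_of (\<mu> a c + \<mu> b c, v) - frag_of (\<mu> a c, v) - frag_of (\<mu> b c, v) \<in> K"
        by (intro K_relations) simp_all
      then show ?case by (simp only: frag_extend_of prod.case alg_mult_distrib_right diff_diff_add)
    next
      case (diff t t')
      then show ?case by (intro K0[OF diff.IH]) (simp add: frag_extend_diff)
    qed (simp add: K_zero)
    then show "(a \<oplus>\<^bsub>CP n (Suc m)\<^esub> b) \<odot>\<^bsub>Ind_M\<^esub> X = a \<odot>\<^bsub>Ind_M\<^esub> X \<oplus>\<^bsub>Ind_M\<^esub> b \<odot>\<^bsub>Ind_M\<^esub> X"
      using t a b ab by (simp add: Ind_smult Ind_add coset_eq_iff)
    have "act (\<mu> a b) t = act a (act b t)"
      using t(1) by (induction t rule: F_induct) (simp_all add: frag_extend_diff alg_mult_assoc)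
    then show "(a \<otimes>\<^bsub>CP n (Suc m)\<^esub> b) \<odot>\<^bsub>Ind_M\<^esub> X = a \<odot>\<^bsub>Ind_M\<^esub> (b \<odot>\<^bsub>Ind_M\<^esub> X)"
      using t a b ab by (simp add: Ind_smult)
  next
    fix a X assume a: "a \<in> A" and "X \<in> carrier Ind_M"
    then obtain t where t: "t \<in> carrier F" "X = coset t" unfolding Ind_carrier by blast
    then show "a \<odot>\<^bsub>Ind_M\<^esub> X \<in> carrier Ind_M" using a by (simp add: Ind_smult Ind_carrier)
  next
    fix a X Y assume a: "a \<in> A" and "X \<in> carrier Ind_M" "Y \<in> carrier Ind_M"
    then obtain t t' where t: "t \<in> carrier F" "X = coset t" "t' \<in> carrier F" "Y = coset t'" unfolding Ind_carrier by blast
    then show "a \<odot>\<^bsub>Ind_M\<^esub> (X \<oplus>\<^bsub>Ind_M\<^esub> Y) = a \<odot>\<^bsub>Ind_M\<^esub> X \<oplus>\<^bsub>Ind_M\<^esub> a \<odot>\<^bsub>Ind_M\<^esub> Y"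
      using a by (simp add: Ind_smult Ind_add frag_extend_add)
  next
    fix X assume "X \<in> carrier Ind_M"
    then obtain t where t: "t \<in> carrier F" "X = coset t" unfolding Ind_carrier by blast
    have "act (alg_one n (Suc m)) t = t"
      using t(1) by (induction t rule: F_induct) (simp_all del: alg_one.simps add: frag_extend_diff)
    then show "\<one>\<^bsub>CP n (Suc m)\<^esub> \<odot>\<^bsub>Ind_M\<^esub> X = X"
      using t by (simp del: alg_one.simps add: Ind_smult)
  qed
qed

text \<open>A generator of \<open>M\<close> makes all tensors simple: \<open>b \<otimes> e v\<close>
  equals \<open>b \<psi>(e) \<otimes> v\<close>, and differences combine in the first
  factor.\<close>

lemma coset_simple_tensor:
  assumes cyc: "cyclic n m M w v" and t: "t \<in> carrier F"
  shows "\<exists>a\<in>A. t - frag_of (a, v) \<in> K"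
  using t
proof (induction t rule: F_induct)
  note c = cyclicD[OF cyc]
  case zero
  have "frag_of (0, v) \<in> K" using K_uminus[OF K_relations(1)[of 0 0 v]] c by simp
  then have "0 - frag_of (0, v) \<in> K" using K_uminus by (simp only: diff_0)
  then show ?case by (rule bexI[of _ "0 :: rook_alg"]) (rule CP_zero)
next
  note c = cyclicD[OF cyc]
  case (frag b x)
  obtain e where e: "e \<in> carrier (CP n m)" "x = e \<odot> v" using c(5)[OF frag(2)] by blast
  have "frag_of (b, x) - frag_of (\<mu> b (\<psi> n i (Suc m) e), v) \<in> K"
    using K_uminus[OF K_relations(3)[OF frag(1) e(1) c(2)]] e(2) by simp
  then show ?case by (rule bexI[of _ "\<mu> b (\<psi> n i (Suc m) e)"]) simp
next
  note c = cyclicD[OF cyc]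
  case (diff t t')
  then obtain a b where ab: "a \<in> A" "b \<in> A" "t - frag_of (a, v) \<in> K" "t' - frag_of (b, v) \<in> K" by blast
  \<comment> \<open>Additivity for \<open>a = (a - b) + b\<close> rewrites
    \<open>a \<otimes> v - b \<otimes> v\<close> as \<open>(a - b) \<otimes> v\<close>.\<close>
  have "frag_of (a - b + b, v) - frag_of (a - b, v) - frag_of (b, v) \<in> K"
    using ab c by (intro K_relations) simp_all
  then have "(t - frag_of (a, v)) - (t' - frag_of (b, v)) + (frag_of (a - b + b, v) - frag_of (a - b, v) - frag_of (b, v)) \<in> K"
    by (rule K_add[OF K_diff[OF ab(3,4)]])
  then have "t - t' - frag_of (a - b, v) \<in> K" by (simp add: algebra_simps)
  then show ?case by (rule bexI[of _ "a - b"]) (rule CP_diff[OF ab(1,2)])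
qed

text \<open>The bilinear map \<open>(a, x) \<mapsto> a \<psi>(g x)\<close>, for an isomorphism \<open>g\<close> of \<open>M\<close> onto a left ideal of
  the planar rook algebra, separates a generator of \<open>Ind M\<close> from 0.\<close>

lemma frag_not_in_K:
  assumes g: "\<And>x. x \<in> carrier M \<Longrightarrow> g x \<in> carrier (CP n m)"
    and g_add: "\<And>x y. \<lbrakk>x \<in> carrier M; y \<in> carrier M\<rbrakk> \<Longrightarrow> g (x \<oplus> y) = g x + g y"
    and g_smult: "\<And>a x. \<lbrakk>a \<in> carrier (CP n m); x \<in> carrier M\<rbrakk> \<Longrightarrow> g (a \<odot> x) = alg_mult n m a (g x)"
    and a: "a \<in> A" and v: "v \<in> carrier M" and nz: "\<mu> a (\<psi> n i (Suc m) (g v)) \<noteq> 0"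
  shows "frag_of (a, v) \<notin> K"
proof
  assume K: "frag_of (a, v) \<in> K"
  interpret R: ring "CP n (Suc m)" by (rule ring_CP)
  \<comment> \<open>The universal property of the free abelian group extends the map on pairs to a
    homomorphism, which kills each defining relation and hence all of \<open>K\<close>.\<close>
  obtain h where h: "h \<in> hom (free_Abelian_group (A \<times> carrier M)) (add_monoid (CP n (Suc m)))"
    and h_frag: "\<And>p. p \<in> A \<times> carrier M \<Longrightarrow> h (frag_of p) = (\<lambda>(b, x). \<mu> b (\<psi> n i (Suc m) (g x))) p"
    using R.a_comm_group comm_group.free_Abelian_group_universal[of "add_monoid (CP n (Suc m))"
      "\<lambda>(b, x). \<mu> b (\<psi> n i (Suc m) (g x))" "A \<times> carrier M"]
    by (auto simp: image_subset_iff)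
  have h_add: "h (s + t) = h s + h t" if "s \<in> carrier F" "t \<in> carrier F" for s t
    using hom_mult[OF h, of s t] that by (simp add: tensor_free_def)
  have h_diff: "h (s - t) = h s - h t" if "s \<in> carrier F" "t \<in> carrier F" for s t
    using h_add[of "s - t" t] that by simp
  have hf: "h (frag_of (b, x)) = \<mu> b (\<psi> n i (Suc m) (g x))" if "b \<in> A" "x \<in> carrier M" for b x
    using h_frag[of "(b, x)"] that by simp
  have "t \<in> carrier F \<and> h t = 0" if "t \<in> K" for t
    using that
  proof (induction t rule: K_induct)
    case zero
    show ?case using h_diff[of 0 0] by simp
  next
    case (add t t')
    then show ?case by (simp add: h_add)
  next
    case (uminus t)
    then show ?case using h_diff[of 0 t] h_diff[of 0 0] F_diff[of 0 t] by simp
  next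
    case (left b c x)
    then show ?case by (simp add: h_diff hf alg_mult_distrib_right)
  next
    case (right b x y)
    then show ?case by (simp add: h_diff hf g_add \<psi>_add[OF i] alg_mult_distrib_left)
  next
    case (balance b e x)
    then show ?case by (simp add: h_diff hf g_smult \<psi>_mult[OF i] alg_mult_assoc)
  qed
  then have "h (frag_of (a, v)) = 0" using K by blast
  then show False using hf[OF a v] nz by simp
qed

text \<open>The generator is \<open>?e \<otimes> v\<close>. As \<open>mat_unit w w\<close> fixes
  \<open>v\<close>, balancing moves it across the tensor sign, so \<open>a \<otimes> v\<close> is
  \<open>a ?e \<otimes> v\<close>, a multiple of the generator.\<close>

lemma cyclic_Ind:
  assumes cyc: "cyclic n m M w v"
  shows "\<exists>V. cyclic n (Suc m) Ind_M (w @ [i]) V"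
proof -
  note c = cyclicD[OF cyc]
  let ?e = "mat_unit (w @ [i]) (w @ [i])"
  have wi: "w @ [i] \<in> words n (Suc m)" using c i by simp
  have e: "?e \<in> A" using wi by simp
  have \<psi>E: "\<psi> n i (Suc m) (mat_unit w w) = ?e" using \<psi>_mat_unit[OF i c(1) c(1) refl] .
  have ee: "\<mu> ?e ?e = ?e" using wi by (simp add: mat_unit_mult)
  let ?V = "coset (frag_of (?e, v))"
  have Fe: "frag_of (?e, v) \<in> carrier F" using e c by simp
  have "?V \<noteq> \<zero>\<^bsub>Ind_M\<^esub>"
  proof -
    \<comment> \<open>Nonvanishing requires a copy of \<open>M\<close> inside the algebra, where
      \<open>\<psi>\<close> can be applied; the isomorphism with \<open>W_int\<close> provides
      it.\<close>
    obtain w' v' where W: "left_module (CP n m) (W_int n m (count (mset w)))"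
      "carrier (W_int n m (count (mset w))) = (\<lambda>a. alg_mult n m a (mat_unit w' w')) ` carrier (CP n m)"
      "add (W_int n m (count (mset w))) = (+)" "smult (W_int n m (count (mset w))) = alg_mult n m"
      using W_int_cyclic[OF count_words_tuple[OF c(1)]] by metis
    have "module_iso (CP n m) M (W_int n m (count (mset w)))"
      by (rule module_iso_sym[OF W(1) cyclic_module_iso[OF lm cyc]])
    then obtain g where g: "module_iso_map (CP n m) M (W_int n m (count (mset w))) g" unfolding module_iso_iff by blast
    note gD = module_iso_mapD[OF g]
    have gc: "g x \<in> carrier (CP n m)" if "x \<in> carrier M" for x
      using gD(4)[OF that] unfolding W(2) by auto
    have ev: "mat_unit w w \<odot> v = v" by (rule c(4))
    have "cyclic n m (W_int n m (count (mset w))) w (g v)"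
      by (rule cyclic_transfer[OF lm W(1) g cyc])
    then have "g v \<noteq> \<zero>\<^bsub>W_int n m (count (mset w))\<^esub>" by (rule cyclicD)
    then have gv: "g v \<noteq> 0" by (simp add: W_int_def W_def)
    have "\<mu> ?e (\<psi> n i (Suc m) (g v)) = \<psi> n i (Suc m) (alg_mult n m (mat_unit w w) (g v))"
      unfolding \<psi>E[symmetric] \<psi>_mult[OF i] ..
    also have "alg_mult n m (mat_unit w w) (g v) = g v"
      using gD(3)[of "mat_unit w w" v] c unfolding W(4) ev by simp
    finally have mu: "\<mu> ?e (\<psi> n i (Suc m) (g v)) = \<psi> n i (Suc m) (g v)" .
    \<comment> \<open>\<open>\<psi>\<close> is injective: its entries between words ending in
      \<open>i\<close> are those of the argument.\<close>
    have "\<psi> n i (Suc m) (g v) \<noteq> 0"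
    proof
      assume z: "\<psi> n i (Suc m) (g v) = 0"
      have "Phi n m (g v) r s = 0" if "r \<in> words n m" "s \<in> words n m" for r s
        using Phi_\<psi>[OF i that, of "g v" i i] unfolding z by simp
      then have "g v = 0" using Phi_eq_0D[OF gc[OF c(2)]] by blast
      then show False using gv by simp
    qed
    then have nz: "\<mu> ?e (\<psi> n i (Suc m) (g v)) \<noteq> 0" unfolding mu .
    have "frag_of (?e, v) \<notin> K"
    proof (rule frag_not_in_K[where g = g, OF gc _ _ e c(2) nz])
      show "g (x \<oplus> y) = g x + g y" if "x \<in> carrier M" "y \<in> carrier M" for x y
        using gD(2)[OF that] unfolding W(3) .
      show "g (a \<odot> x) = alg_mult n m a (g x)" if "a \<in> carrier (CP n m)" "x \<in> carrier M" for a x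
        using gD(3)[OF that] unfolding W(4) .
    qed
    then show ?thesis unfolding Ind_zero using coset_eq_iff[OF Fe F_zero] by simp
  qed
  moreover have "?e \<odot>\<^bsub>Ind_M\<^esub> ?V = ?V" using Ind_smult[OF Fe e] ee by simp
  moreover have "\<exists>a\<in>A. X = a \<odot>\<^bsub>Ind_M\<^esub> ?V" if X: "X \<in> carrier Ind_M" for X
  proof -
    obtain t where t: "t \<in> carrier F" "X = coset t" using X unfolding Ind_carrier by blast
    obtain a where a: "a \<in> A" "t - frag_of (a, v) \<in> K" using coset_simple_tensor[OF cyc t(1)] by blast
    have "frag_of (\<mu> a ?e, v) - frag_of (a, v) \<in> K"
      using K_relations(3)[OF a(1), of "mat_unit w w" v] c \<psi>E by simp
    from K_diff[OF a(2) this] have "t - frag_of (\<mu> a ?e, v) \<in> K" by simp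
    then have "X = coset (frag_of (\<mu> a ?e, v))" using t c by (simp add: coset_eq_iff)
    also have "\<dots> = a \<odot>\<^bsub>Ind_M\<^esub> ?V" using Ind_smult[OF Fe a(1)] by simp
    finally show ?thesis using a by blast
  qed
  ultimately have "cyclic n (Suc m) Ind_M (w @ [i]) ?V"
    unfolding cyclic_def using wi Fe by (auto simp: Ind_carrier)
  then show ?thesis ..
qed

end

section \<open>The crystal operators\<close>

text \<open>The target index comes first, the source second. The subtraction is truncated, so this
  is a move of one unit only if \<open>ms j \<noteq> 0\<close>.\<close>

definition shift_tuple :: "nat \<Rightarrow> nat \<Rightarrow> (nat \<Rightarrow> nat) \<Rightarrow> nat \<Rightarrow> nat" where
  "shift_tuple i j ms = (ms(j := ms j - 1))(i := (ms(j := ms j - 1)) i + 1)"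

text \<open>Covers both operators: \<open>E_functor\<close> induces with colour \<open>i - 1\<close>
  and restricts with \<open>i\<close>, \<open>F_functor\<close> the other way round. The colours
  differ, so induction creates no \<open>j\<close>, and whether \<open>w i\<close> can be rearranged
  to end in \<open>j\<close> depends on \<open>w\<close> alone.\<close>

lemma class_Res_Ind:
  assumes i: "i \<le> n" and j: "j \<le> n" and ij: "i \<noteq> j"
    and lm: "left_module (CP n m) M" and cyc: "cyclic n m M w v"
  shows "class_or_zero n m (Res n j (m + 1) (Ind n i (m + 1) M)) =
    (if count (mset w) j = 0 then None else Some (W_class n m (shift_tuple i j (count (mset w)))))"
proof -
  note w = cyclicD(1)[OF cyc]
  interpret I: induction_module n m M i using lm i by (intro induction_module.intro CP_module.intro induction_module_axioms.intro)
  let ?N = "Ind n i (Suc m) M"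
  interpret R: restriction n m ?N j
    using I.left_module_Ind j by (intro restriction.intro CP_module.intro restriction_axioms.intro)
  obtain V where V: "cyclic n (Suc m) ?N (w @ [i]) V" using I.cyclic_Ind[OF cyc] by blast
  show ?thesis
  proof (cases "count (mset w) j = 0")
    case True
    then have "j \<notin> set (w @ [i])" using ij by (simp add: count_list_0_iff)
    then have "carrier (Res n j (Suc m) ?N) = {\<zero>\<^bsub>Res n j (Suc m) ?N\<^esub>}" by (rule R.Res_zero[OF V])
    then show ?thesis using True by (simp add: class_or_zero_def)
  next
    case False
    then have "j \<in> set w" by (simp add: count_list_0_iff)
    \<comment> \<open>Any word with one \<open>i\<close> more and one \<open>j\<close> less than
      \<open>w\<close> serves; isomorphism classes see multiplicities only.\<close>
    obtain w' where w': "mset w' = mset (w @ [i]) - {#j#}" using ex_mset by blast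
    have eq: "mset (w' @ [j]) = mset (w @ [i])" using \<open>j \<in> set w\<close> w' by simp
    have "set (w' @ [j]) = set (w @ [i])" "length (w' @ [j]) = length (w @ [i])"
      using eq by (metis set_mset_mset, metis size_mset)
    then have w'i: "w' @ [j] \<in> words n (Suc m)" using w i unfolding words_def by simp
    then have ww: "w' \<in> words n m" by simp
    have "cyclic n (Suc m) ?N (w' @ [j]) (mat_unit (w' @ [j]) (w @ [i]) \<odot>\<^bsub>?N\<^esub> V)"
      by (rule R.cyclic_change_word[OF V w'i eq])
    from R.cyclic_Res[OF ww this]
    have cR: "cyclic n m (Res n j (Suc m) ?N) w' (mat_unit (w' @ [j]) (w @ [i]) \<odot>\<^bsub>?N\<^esub> V)" .
    have "count (mset w') = shift_tuple i j (count (mset w))"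
      unfolding w' shift_tuple_def using ij False by (auto simp: fun_eq_iff)
    then have "iso_class n m (Res n j (Suc m) ?N) = W_class n m (shift_tuple i j (count (mset w)))"
      using iso_class_cyclic[OF R.left_module_Res cR] by simp
    moreover have "carrier (Res n j (Suc m) ?N) \<noteq> {\<zero>\<^bsub>Res n j (Suc m) ?N\<^esub>}"
      using cyclicD(2,3)[OF cR] by blast
    ultimately show ?thesis using False by (simp add: class_or_zero_def)
  qed
qed

text \<open>\<open>the_elem\<close> needs a singleton: \<open>W_int\<close> makes the image
  nonempty, and the assumption makes it constant.\<close>

lemma induced_map_W_class:
  assumes ms: "ms \<in> tuples n m" and \<Phi>: "\<And>M. M \<in> W_class n m ms \<Longrightarrow> class_or_zero n m (\<Phi> M) = x"
  shows "induced_map n m \<Phi> (W_class n m ms) = x"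
proof -
  have "(\<lambda>M. class_or_zero n m (\<Phi> M)) ` W_class n m ms = {x}" using W_class_self[OF ms] \<Phi> by blast
  then show ?thesis by (simp add: induced_map_def)
qed

lemma e_op_W_class:
  assumes i: "i \<in> {1..n}" and ms: "ms \<in> tuples n m"
  shows "e_op n m i (W_class n m ms) = (if ms i = 0 then None else Some (W_class n m (shift_tuple (i - 1) i ms)))"
  unfolding e_op_def
proof (rule induced_map_W_class[OF ms])
  fix M assume "M \<in> W_class n m ms"
  then obtain w v where w: "count (mset w) = ms" "cyclic n m M w v" "left_module (CP n m) M" by (rule W_class_member[OF ms])
  show "class_or_zero n m (E_functor n i m M) = (if ms i = 0 then None else Some (W_class n m (shift_tuple (i - 1) i ms)))"
    unfolding E_functor_def w(1)[symmetric] using i by (intro class_Res_Ind[OF _ _ _ w(3,2)]) auto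
qed

lemma f_op_W_class:
  assumes i: "i \<in> {1..n}" and ms: "ms \<in> tuples n m"
  shows "f_op n m i (W_class n m ms) = (if ms (i - 1) = 0 then None else Some (W_class n m (shift_tuple i (i - 1) ms)))"
  unfolding f_op_def
proof (rule induced_map_W_class[OF ms])
  fix M assume "M \<in> W_class n m ms"
  then obtain w v where w: "count (mset w) = ms" "cyclic n m M w v" "left_module (CP n m) M" by (rule W_class_member[OF ms])
  show "class_or_zero n m (F_functor n i m M) = (if ms (i - 1) = 0 then None else Some (W_class n m (shift_tuple i (i - 1) ms)))"
    unfolding F_functor_def w(1)[symmetric] using i by (intro class_Res_Ind[OF _ _ _ w(3,2)]) auto
qed

section \<open>Weights and the crystal axioms\<close>

lemma shift_tuple_in_tuples:
  assumes ms: "ms \<in> tuples n m" and i: "i \<le> n" and j: "j \<le> n" and nz: "ms j \<noteq> 0"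
  shows "shift_tuple i j ms \<in> tuples n m"
proof -
  let ?ns = "ms(j := ms j - 1)"
  have "(\<Sum>k\<le>n. ?ns k) + 1 = (\<Sum>k\<le>n. ms k)"
    using j nz by (simp add: sum.remove[of "{..n}" j])
  moreover have "(\<Sum>k\<le>n. (?ns(i := ?ns i + 1)) k) = (\<Sum>k\<le>n. ?ns k) + 1"
    using i by (simp add: sum.remove[of "{..n}" i])
  ultimately show ?thesis using ms i j unfolding tuples_def shift_tuple_def by auto
qed

lemma shift_tuple_shift_tuple:
  assumes "ms j \<noteq> 0" "i \<noteq> j"
  shows "shift_tuple j i (shift_tuple i j ms) = ms"
  using assms by (auto simp: shift_tuple_def fun_eq_iff)

text \<open>Letters start at 0 and weight coordinates at 1, hence the index
  \<open>k - 1\<close>.\<close>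

lemma class_wt_W_class:
  assumes "ms \<in> tuples n m"
  shows "class_wt n m (W_class n m ms) k = (if k \<in> {1..n + 1} then int (ms (k - 1)) else 0)"
proof -
  have "class_wt n m (W_class n m ms) k = (\<Sum>j\<le>n. if k = j + 1 then int (ms j) else 0)"
    unfolding class_wt_def class_tuple_W_class[OF assms] coord_def by (intro sum.cong refl) auto
  also have "\<dots> = (if k \<in> {1..n + 1} then int (ms (k - 1)) else 0)"
  proof (cases k)
    case (Suc l)
    then have "(\<Sum>j\<le>n. if k = j + 1 then int (ms j) else 0) = (\<Sum>j\<le>n. if j = l then int (ms j) else 0)"
      by (intro sum.cong refl) auto
    then show ?thesis using Suc by simp
  qed simp
  finally show ?thesis .
qed

lemma class_wt_shift_tuple:
  assumes ms: "ms \<in> tuples n m" and i: "i \<le> n" and j: "j \<le> n" and ij: "i \<noteq> j" and nz: "ms j \<noteq> 0"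
  shows "class_wt n m (W_class n m (shift_tuple i j ms)) = class_wt n m (W_class n m ms) + \<epsilon> (i + 1) - \<epsilon> (j + 1)"
proof (rule ext)
  fix k
  show "class_wt n m (W_class n m (shift_tuple i j ms)) k = (class_wt n m (W_class n m ms) + \<epsilon> (i + 1) - \<epsilon> (j + 1)) k"
    unfolding plus_fun_apply minus_apply class_wt_W_class[OF ms] class_wt_W_class[OF shift_tuple_in_tuples[OF ms i j nz]]
    using i j ij nz by (cases k) (auto simp: shift_tuple_def coord_def)
qed

lemma weight_eval_coord:
  assumes "i \<in> {1..n + 1}" shows "weight_eval n l (coord i) = l i"
proof -
  have "weight_eval n l (coord i) = (\<Sum>j\<in>{1..n + 1}. if j = i then l i else 0)"
    unfolding weight_eval_def coord_def by (intro sum.cong refl) auto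
  then show ?thesis using assms by simp
qed

lemma weight_eval_diff: "weight_eval n l (h - h') = weight_eval n l h - weight_eval n l h'"
  by (simp add: weight_eval_def algebra_simps sum_subtractf)

lemma gl_crystal_irr_classes:
  "gl_crystal n (irr_classes n m) (class_wt n m) (e_op n m) (f_op n m) (class_eps n m) (class_phi n m)"
proof (unfold_locales, unfold irr_classes_eq)
  fix b assume "b \<in> W_class n m ` tuples n m"
  then obtain ms where ms: "ms \<in> tuples n m" "b = W_class n m ms" by blast
  show "class_wt n m b \<in> weight_lattice n"
    unfolding ms(2) weight_lattice_def by (auto simp: class_wt_W_class[OF ms(1)])
next
  fix i b assume i: "i \<in> {1..n}" and "b \<in> W_class n m ` tuples n m"
  then obtain ms where ms: "ms \<in> tuples n m" "b = W_class n m ms" by blast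
  have i': "i - 1 \<le> n" "i \<le> n" "i - 1 \<noteq> i" "i - 1 + 1 = i" using i by auto
  show "class_eps n m i b \<noteq> Pinf" "class_phi n m i b \<noteq> Pinf" by (simp_all add: class_eps_def class_phi_def)
  show "e_op n m i b \<in> insert None (Some ` W_class n m ` tuples n m)"
    unfolding ms(2) e_op_W_class[OF i ms(1)] using shift_tuple_in_tuples[OF ms(1) i'(1,2)] by auto
  show "f_op n m i b \<in> insert None (Some ` W_class n m ` tuples n m)"
    unfolding ms(2) f_op_W_class[OF i ms(1)] using shift_tuple_in_tuples[OF ms(1) i'(2,1)] by auto
  \<comment> \<open>Coordinates \<open>i\<close> and \<open>i + 1\<close> of the weight are
    \<open>ms (i - 1)\<close> and \<open>ms i\<close>, the values of \<open>class_phi\<close> and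
    \<open>class_eps\<close>.\<close>
  have "weight_eval n (class_wt n m b) (E_diag i - E_diag (i + 1)) = int (ms (i - 1)) - int (ms i)"
    using i unfolding weight_eval_diff ms(2) by (simp add: weight_eval_coord class_wt_W_class[OF ms(1)])
  then show "class_phi n m i b = class_eps n m i b + Fin (weight_eval n (class_wt n m b) (E_diag i - E_diag (i + 1)))"
    unfolding class_phi_def class_eps_def ms(2) class_tuple_W_class[OF ms(1)] by simp
  show "class_wt n m b' = class_wt n m b + \<epsilon> i - \<epsilon> (i + 1)" if "e_op n m i b = Some b'" for b'
  proof -
    have nz: "ms i \<noteq> 0" and b': "b' = W_class n m (shift_tuple (i - 1) i ms)"
      using that unfolding ms(2) e_op_W_class[OF i ms(1)] by (auto split: if_splits)
    show ?thesis unfolding b' ms(2) class_wt_shift_tuple[OF ms(1) i'(1,2,3) nz] i'(4) ..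
  qed
  show "class_wt n m b' = class_wt n m b - \<epsilon> i + \<epsilon> (i + 1)" if "f_op n m i b = Some b'" for b'
  proof -
    have nz: "ms (i - 1) \<noteq> 0" and b': "b' = W_class n m (shift_tuple i (i - 1) ms)"
      using that unfolding ms(2) f_op_W_class[OF i ms(1)] by (auto split: if_splits)
    show ?thesis unfolding b' ms(2) class_wt_shift_tuple[OF ms(1) i'(2,1) i'(3)[symmetric] nz] i'(4)
      by (simp add: algebra_simps)
  qed
  show "e_op n m i b = None" "f_op n m i b = None" if "class_eps n m i b = Minf"
    using that by (simp_all add: class_eps_def)
next
  fix i b1 b2 assume i: "i \<in> {1..n}" and "b1 \<in> W_class n m ` tuples n m" "b2 \<in> W_class n m ` tuples n m"
  then obtain r s where r: "r \<in> tuples n m" "b1 = W_class n m r" and s: "s \<in> tuples n m" "b2 = W_class n m s" by blast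
  have i': "i - 1 \<le> n" "i \<le> n" "i - 1 \<noteq> i" using i by auto
  \<comment> \<open>Injectivity of \<open>W_class\<close> reduces axiom (c) to an equivalence
    between tuples, where the two shifts undo each other.\<close>
  have "f_op n m i b2 = Some b1 \<longleftrightarrow> s (i - 1) \<noteq> 0 \<and> shift_tuple i (i - 1) s = r"
    unfolding r(2) s(2) f_op_W_class[OF i s(1)]
    using W_class_inject[OF shift_tuple_in_tuples[OF s(1) i'(2,1)] r(1)] by auto
  also have "\<dots> \<longleftrightarrow> r i \<noteq> 0 \<and> shift_tuple (i - 1) i r = s"
  proof
    assume h: "s (i - 1) \<noteq> 0 \<and> shift_tuple i (i - 1) s = r"
    \<comment> \<open>The shift has just raised the entry at \<open>i\<close>, so the reverse
      operator does not give 0.\<close>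
    then have "r i \<noteq> 0" by (auto simp: shift_tuple_def)
    moreover have "shift_tuple (i - 1) i r = s" using shift_tuple_shift_tuple[of s "i - 1" i] h i'(3) by auto
    ultimately show "r i \<noteq> 0 \<and> shift_tuple (i - 1) i r = s" ..
  next
    assume h: "r i \<noteq> 0 \<and> shift_tuple (i - 1) i r = s"
    then have "s (i - 1) \<noteq> 0" by (auto simp: shift_tuple_def)
    moreover have "shift_tuple i (i - 1) s = r" using shift_tuple_shift_tuple[of r i "i - 1"] h i'(3) by auto
    ultimately show "s (i - 1) \<noteq> 0 \<and> shift_tuple i (i - 1) s = r" ..
  qed
  also have "\<dots> \<longleftrightarrow> e_op n m i b1 = Some b2"
    unfolding r(2) s(2) e_op_W_class[OF i r(1)]
    using W_class_inject[OF shift_tuple_in_tuples[OF r(1) i'(1,2)] s(1)] by auto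
  finally show "f_op n m i b2 = Some b1 \<longleftrightarrow> e_op n m i b1 = Some b2" .
qed

theorem proposition4p2:
  fixes n m :: nat
  assumes "n \<ge> 1" and "m \<ge> 1"
  shows "irr_classes n m =
      {iso_class n m M |M :: rook_module. fd_module n m M \<and> irreducible_module (CP n m) M}
    \<and> gl_crystal n (irr_classes n m) (class_wt n m) (e_op n m) (f_op n m) (class_eps n m) (class_phi n m)"
  using irr_classes_irreducible gl_crystal_irr_classes by blast

end
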